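(* Let $S\subset\mathbb{R}$ be a finite set and let $d\geq 2$ and $i\geq 0$ be integers. Then the $\operatorname{FS^{op}}$-module $B_S^{i,d}$ is finitely generated in degrees $\leq |S|^i$.
   Context: $\operatorname{FS}$ denotes the category whose objects are nonempty finite sets and whose morphisms are surjective maps. An $\operatorname{FS^{op}}$-module (over $\mathbb{Q}$) is a contravariant functor from $\operatorname{FS}$ to rational vector spaces. For a finite set $F$, the principal projective $P_F$ sends a finite set $E$ to the $\mathbb{Q}$-vector space with basis $\operatorname{Hom}_{\operatorname{FS}}(E,F)$ (the surjections $E\to F$), with morphisms acting on basis elements by composition. An $\operatorname{FS^{op}}$-module $N$ is finitely generated in degrees $\leq m$ if it is a quotient of a finite direct sum $\bigoplus_j P_{F_j}$ of principal projectives with $|F_j|\leq m$ for all $j$; equivalently, for every $E$, $N(E)$ is finite dimensional and spanned by the images of pullbacks $\varphi^*$ along surjections $\varphi:E\to F$ with $|F|\leq m$. For a finite set $S\subset\mathbb{R}$, a positive integer $d$, and a finite set $E$, let $M_S(E,d)$ be the space of $E$-tuples of vectors in $\mathbb{R}^d$ such that every nontrivial linear combination of these vectors with coefficients in $S$ (one coefficient from $S$ for each vector; "nontrivial" means that, if $0\in S$, not all coefficients are $0$) is nonzero. A surjection $\varphi:E\to F$ induces a map $\varphi_*:M_S(E,d)\to M_S(F,d)$ sending an $E$-tuple to the $F$-tuple whose entry at $f\in F$ is the sum of the vectors indexed by the fiber $\varphi^{-1}(f)$. This gives a functor from $\operatorname{FS}$ to topological spaces, and $B_S^{i,d}$ is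 the $\operatorname{FS^{op}}$-module $E\mapsto H^{(d-1)i}\big(M_S(E,d);\mathbb{Q}\big)$ with the induced pullback maps. *)

theory Defs
  imports "HOL-Analysis.Analysis" "HOL-Algebra.Module" "HOL-Algebra.AbelCoset" "HOL-Homology.Homology"
begin

section \<open>Rational vector spaces\<close>

text \<open>Rational vector spaces are modules, in the sense of HOL-Algebra, over the field of rational
  numbers. The record type of modules extends that of rings; the fields \<open>mult\<close> and \<open>one\<close> play no
  role in the locale of modules and are left unspecified below.\<close>

definition rat_field :: "rat ring" where
  "rat_field = \<lparr>carrier = UNIV, monoid.mult = (*), one = 1, ring.zero = 0, ring.add = (+)\<rparr>"

definition linear_map ::
    "(rat, 'v) module \<Rightarrow> (rat, 'w) module \<Rightarrow> ('v \<Rightarrow> 'w) \<Rightarrow> bool" where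
  "linear_map V W f \<longleftrightarrow>
     f \<in> hom (add_monoid V) (add_monoid W) \<and>
     (\<forall>q. \<forall>x\<in>carrier V. f (q \<odot>\<^bsub>V\<^esub> x) = q \<odot>\<^bsub>W\<^esub> f x)"

definition fun_space :: "'a set \<Rightarrow> (rat, 'a \<Rightarrow> rat) module" where
  "fun_space A =
     \<lparr>carrier = A \<rightarrow>\<^sub>E UNIV, monoid.mult = undefined, one = undefined,
      ring.zero = (\<lambda>a\<in>A. 0), ring.add = (\<lambda>u v. \<lambda>a\<in>A. u a + v a), smult = (\<lambda>q v. \<lambda>a\<in>A. q * v a)\<rparr>"

definition quotient_space :: "(rat, 'v) module \<Rightarrow> 'v set \<Rightarrow> (rat, 'v set) module" where
  "quotient_space V W =
     \<lparr>carrier = a_rcosets\<^bsub>V\<^esub> W, monoid.mult = undefined, one = undefined,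
      ring.zero = W, ring.add = set_add V, smult = (\<lambda>q A. \<Union>x\<in>A. W +>\<^bsub>V\<^esub> (q \<odot>\<^bsub>V\<^esub> x))\<rparr>"

text \<open>The product over the index set, which is the direct sum when the index set is finite.\<close>

definition sum_space :: "'j set \<Rightarrow> ('j \<Rightarrow> (rat, 'v) module) \<Rightarrow> (rat, 'j \<Rightarrow> 'v) module" where
  "sum_space J V =
     \<lparr>carrier = (\<Pi>\<^sub>E j\<in>J. carrier (V j)), monoid.mult = undefined, one = undefined,
      ring.zero = (\<lambda>j\<in>J. \<zero>\<^bsub>V j\<^esub>), ring.add = (\<lambda>u v. \<lambda>j\<in>J. u j \<oplus>\<^bsub>V j\<^esub> v j),
      smult = (\<lambda>q v. \<lambda>j\<in>J. q \<odot>\<^bsub>V j\<^esub> v j)\<rparr>"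


section \<open>Modules over the opposite category of finite sets and surjections\<close>

text \<open>The objects are the nonempty finite subsets of \<^typ>\<open>nat\<close>; up to equivalence of categories
  these are all nonempty finite sets. Morphisms are extensional functions, composed by
  \<^const>\<open>compose\<close>.\<close>

definition FS_obj :: "nat set set" where
  "FS_obj = {E. finite E \<and> E \<noteq> {}}"

definition FS_hom :: "nat set \<Rightarrow> nat set \<Rightarrow> (nat \<Rightarrow> nat) set" where
  "FS_hom E F = {\<phi> \<in> E \<rightarrow>\<^sub>E F. \<phi> ` E = F}"

text \<open>For a surjection \<open>\<phi>\<close> from \<open>E\<close> to \<open>F\<close>, the pullback \<open>pull N E F \<phi>\<close> goes from \<open>space_at N F\<close> to
  \<open>space_at N E\<close>.\<close>

record 'v FSop_data =
  space_at :: "nat set \<Rightarrow> (rat, 'v) module"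
  pull :: "nat set \<Rightarrow> nat set \<Rightarrow> (nat \<Rightarrow> nat) \<Rightarrow> 'v \<Rightarrow> 'v"

definition FSop_module :: "'v FSop_data \<Rightarrow> bool" where
  "FSop_module N \<longleftrightarrow>
     (\<forall>E\<in>FS_obj. module rat_field (space_at N E)) \<and>
     (\<forall>E\<in>FS_obj. \<forall>F\<in>FS_obj. \<forall>\<phi>\<in>FS_hom E F.
        linear_map (space_at N F) (space_at N E) (pull N E F \<phi>)) \<and>
     (\<forall>E\<in>FS_obj. \<forall>x\<in>carrier (space_at N E). pull N E E (\<lambda>e\<in>E. e) x = x) \<and>
     (\<forall>E\<in>FS_obj. \<forall>F\<in>FS_obj. \<forall>G\<in>FS_obj. \<forall>\<phi>\<in>FS_hom E F. \<forall>\<psi>\<in>FS_hom F G.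
        \<forall>x\<in>carrier (space_at N G).
          pull N E G (compose E \<psi> \<phi>) x = pull N E F \<phi> (pull N F G \<psi> x))"

definition FSop_hom ::
    "'v FSop_data \<Rightarrow> 'w FSop_data \<Rightarrow> (nat set \<Rightarrow> 'v \<Rightarrow> 'w) \<Rightarrow> bool" where
  "FSop_hom M N \<eta> \<longleftrightarrow>
     (\<forall>E\<in>FS_obj. linear_map (space_at M E) (space_at N E) (\<eta> E)) \<and>
     (\<forall>E\<in>FS_obj. \<forall>F\<in>FS_obj. \<forall>\<phi>\<in>FS_hom E F. \<forall>x\<in>carrier (space_at M F).
        \<eta> E (pull M E F \<phi> x) = pull N E F \<phi> (\<eta> F x))"

text \<open>Since \<open>FS_hom E F\<close> is finite, the space with basis \<open>FS_hom E F\<close> is the space of all rational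
  functions on it, a basis element being the indicator function of a point. The pullback along
  \<open>\<phi>\<close> is the linear extension of the map sending \<open>\<psi>\<close> to \<open>\<psi> \<circ> \<phi>\<close>.\<close>

definition principal_projective :: "nat set \<Rightarrow> ((nat \<Rightarrow> nat) \<Rightarrow> rat) FSop_data" where
  "principal_projective F =
     \<lparr>space_at = (\<lambda>E. fun_space (FS_hom E F)),
      pull = (\<lambda>E E' \<phi> v. \<lambda>\<theta>\<in>FS_hom E F. \<Sum>\<psi> | \<psi> \<in> FS_hom E' F \<and> compose E \<psi> \<phi> = \<theta>. v \<psi>)\<rparr>"

definition FSop_sum :: "'j set \<Rightarrow> ('j \<Rightarrow> 'v FSop_data) \<Rightarrow> ('j \<Rightarrow> 'v) FSop_data" where
  "FSop_sum J N =
     \<lparr>space_at = (\<lambda>E. sum_space J (\<lambda>j. space_at (N j) E)),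
      pull = (\<lambda>E F \<phi> v. \<lambda>j\<in>J. pull (N j) E F \<phi> (v j))\<rparr>"

definition finitely_generated_in_degrees :: "'v FSop_data \<Rightarrow> nat \<Rightarrow> bool" where
  "finitely_generated_in_degrees N m \<longleftrightarrow>
     FSop_module N \<and>
     (\<exists>(k::nat) F \<eta>.
        (\<forall>j<k. F j \<in> FS_obj \<and> card (F j) \<le> m) \<and>
        FSop_hom (FSop_sum {..<k} (\<lambda>j. principal_projective (F j))) N \<eta> \<and>
        (\<forall>E\<in>FS_obj.
           \<eta> E ` carrier (space_at (FSop_sum {..<k} (\<lambda>j. principal_projective (F j))) E) =
           carrier (space_at N E)))"


section \<open>Singular cohomology with rational coefficients\<close>

text \<open>The cohomology of the complex dual, over the rationals, to the complex of integral singular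
  chains. A cochain is extended by \<^const>\<open>undefined\<close> outside the chain group, so that cochains
  equal as homomorphisms are equal.\<close>

definition cochains :: "nat \<Rightarrow> 'a topology \<Rightarrow> ('a chain \<Rightarrow> rat) set" where
  "cochains p X =
     hom (chain_group p X) (add_monoid rat_field) \<inter> extensional (carrier (chain_group p X))"

definition coboundary :: "nat \<Rightarrow> 'a topology \<Rightarrow> ('a chain \<Rightarrow> rat) \<Rightarrow> 'a chain \<Rightarrow> rat" where
  "coboundary p X c = (\<lambda>z\<in>carrier (chain_group (Suc p) X). c (chain_boundary (Suc p) z))"

definition cocycles :: "nat \<Rightarrow> 'a topology \<Rightarrow> ('a chain \<Rightarrow> rat) set" where
  "cocycles p X =
     {c \<in> cochains p X. coboundary p X c = (\<lambda>z\<in>carrier (chain_group (Suc p) X). 0)}"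

fun coboundaries :: "nat \<Rightarrow> 'a topology \<Rightarrow> ('a chain \<Rightarrow> rat) set" where
  "coboundaries 0 X = {\<lambda>z\<in>carrier (chain_group 0 X). 0}"
| "coboundaries (Suc p) X = coboundary p X ` cochains p X"

definition cocycle_space :: "nat \<Rightarrow> 'a topology \<Rightarrow> (rat, 'a chain \<Rightarrow> rat) module" where
  "cocycle_space p X = (fun_space (carrier (chain_group p X)))\<lparr>carrier := cocycles p X\<rparr>"

definition cohomology :: "nat \<Rightarrow> 'a topology \<Rightarrow> (rat, ('a chain \<Rightarrow> rat) set) module" where
  "cohomology p X = quotient_space (cocycle_space p X) (coboundaries p X)"

definition cochain_pullback ::
    "nat \<Rightarrow> 'a topology \<Rightarrow> ('a \<Rightarrow> 'b) \<Rightarrow> ('b chain \<Rightarrow> rat) \<Rightarrow> 'a chain \<Rightarrow> rat" where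
  "cochain_pullback p X g c = (\<lambda>z\<in>carrier (chain_group p X). c (chain_map p g z))"

text \<open>The map in cohomology induced by a continuous map \<open>g\<close> from \<open>X\<close>; it sends the class of a
  cocycle to the class of its pullback.\<close>

definition cohomology_map ::
    "nat \<Rightarrow> 'a topology \<Rightarrow> ('a \<Rightarrow> 'b) \<Rightarrow> ('b chain \<Rightarrow> rat) set \<Rightarrow> ('a chain \<Rightarrow> rat) set" where
  "cohomology_map p X g A =
     (\<Union>c\<in>A. coboundaries p X +>\<^bsub>cocycle_space p X\<^esub> cochain_pullback p X g c)"


section \<open>The spaces of tuples and their cohomology\<close>

text \<open>Tuples indexed by \<open>E\<close> are extensional functions on \<open>E\<close>, with the product topology.\<close>

definition tuple_space :: "real set \<Rightarrow> 'e set \<Rightarrow> ('e \<Rightarrow> real ^ 'd) topology" where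
  "tuple_space S E =
     subtopology (product_topology (\<lambda>_. euclidean) E)
       {x. \<forall>c \<in> E \<rightarrow> S. (\<exists>e\<in>E. c e \<noteq> 0) \<longrightarrow> (\<Sum>e\<in>E. c e *\<^sub>R x e) \<noteq> 0}"

definition fiber_sum ::
    "'e set \<Rightarrow> 'f set \<Rightarrow> ('e \<Rightarrow> 'f) \<Rightarrow> ('e \<Rightarrow> real ^ 'd) \<Rightarrow> 'f \<Rightarrow> real ^ 'd" where
  "fiber_sum E F \<phi> x = (\<lambda>f\<in>F. \<Sum>e | e \<in> E \<and> \<phi> e = f. x e)"

text \<open>The dimension of the ambient space is the cardinality of the type \<open>'d\<close>.\<close>

definition B_module ::
    "real set \<Rightarrow> nat \<Rightarrow> (((nat \<Rightarrow> real ^ 'd) chain \<Rightarrow> rat) set) FSop_data" where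
  "B_module S i =
     \<lparr>space_at = (\<lambda>E. cohomology ((CARD('d) - 1) * i) (tuple_space S E)),
      pull = (\<lambda>E F \<phi>. cohomology_map ((CARD('d) - 1) * i) (tuple_space S E) (fiber_sum E F \<phi>))\<rparr>"

end

theory Submission
  imports Defs
begin

text \<open>
  Over the rationals cohomology is dual to integral homology, so a spanning statement for cohomology is
  a joint injectivity statement for maps on homology, and no cup products are needed. The space of
  tuples is the complement of an arrangement of subspaces \<open>c \<cdot> x = 0\<close> of codimension \<open>d\<close>. Each
  \<open>i\<close>-tuple of the forms \<open>c\<close> maps it to \<open>Y i\<close>, the \<open>i\<close>-fold power of the punctured \<open>d\<close>-space, and in
  degree \<open>(d - 1) i\<close> these maps are jointly injective on homology, by deletion and restriction: a class
  that dies after the deletion of a form \<open>a\<close> is the boundary of a relative class, which by excision and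
  a Thom isomorphism is a class of degree \<open>(d - 1) (i - 1)\<close> on the restricted arrangement; the
  tuples that contain \<open>a\<close> detect it. As the top homology of \<open>Y i\<close> is infinite cyclic, the cohomology
  is spanned by the pullbacks of a single cocycle of \<open>Y i\<close> along the \<open>i\<close>-tuples of forms. An \<open>i\<close>-tuple
  of forms on \<open>E\<close> with coefficients in \<open>S\<close> is a map from \<open>E\<close> to \<open>S\<^sup>i\<close>; so its pullback comes from
  the image of that map, a quotient of \<open>E\<close> with at most \<open>|S|\<^sup>i\<close> elements.
\<close>

section \<open>Excision and joint injectivity\<close>

text \<open>The obstacle in the induction is that a form \<open>c\<close> on the deleted complement
  is not the pullback of its restriction to the kernel of \<open>a\<close>: the two differ by a
  multiple of the normal coordinate. They are therefore compared only on a neighbourhood of the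
  restricted complement in which that multiple is too small to cancel the restriction, and excision
  shows that this neighbourhood carries the whole relative homology. Detection of a relative class
  by an absolute one rests on a second fact: over \<open>Y\<close> the complement of the zero
  section has a section up to homotopy, so the boundary map of the pair is injective there. The
  bound \<open>d \<ge> 2\<close> makes the degree \<open>(d - 1) n\<close> strictly increasing in
  \<open>n\<close>; this separates the top degree of a power from that of the previous one and
  excludes degree zero for \<open>n > 0\<close>. Rational coefficients enter through divisibility:
  homomorphisms to the rationals extend from any subgroup of chains, so functions on cycles extend
  to cochains and a cochain that vanishes on cycles is a coboundary.\<close>

definition jointly_inj ::
    "('a, 'm) monoid_scheme \<Rightarrow> ('b, 'n) monoid_scheme \<Rightarrow> 'i set \<Rightarrow> ('i \<Rightarrow> 'a \<Rightarrow> 'b) \<Rightarrow> bool" where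
  "jointly_inj G H I h \<longleftrightarrow> (\<forall>z\<in>carrier G. (\<forall>i\<in>I. h i z = \<one>\<^bsub>H\<^esub>) \<longrightarrow> z = \<one>\<^bsub>G\<^esub>)"

lemma jointly_injD:
  assumes "jointly_inj G H I h" "z \<in> carrier G" "\<And>i. i \<in> I \<Longrightarrow> h i z = \<one>\<^bsub>H\<^esub>"
  shows "z = \<one>\<^bsub>G\<^esub>"
  using assms by (auto simp: jointly_inj_def)

lemma iso_eq_one_iff:
  assumes "group G" "group H" "a \<in> iso G H" "z \<in> carrier G"
  shows "a z = \<one>\<^bsub>H\<^esub> \<longleftrightarrow> z = \<one>\<^bsub>G\<^esub>"
proof -
  interpret group_hom G H a
    using assms by (simp add: group_hom_def group_hom_axioms_def Group.iso_def)
  show ?thesis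
    using assms by (metis Group.iso_iff group.is_monoid hom_one inj_onD monoid.one_closed)
qed

text \<open>Vanishing is carried forward from \<open>H\<close> to \<open>H'\<close>, so
  \<open>b\<close> may be any homomorphism, while \<open>a\<close> has to be an isomorphism to bring
  the conclusion back to \<open>G\<close>.\<close>

lemma jointly_inj_pullback:
  assumes "jointly_inj G' H' I h'" "group G" "group G'" "a \<in> iso G G'"
    and "group H" "group H'" "b \<in> hom H H'"
    and "\<And>i z. i \<in> I \<Longrightarrow> z \<in> carrier G \<Longrightarrow> h' i (a z) = b (h i z)"
  shows "jointly_inj G H I h"
  unfolding jointly_inj_def
proof (intro ballI impI)
  fix z assume z: "z \<in> carrier G" "\<forall>i\<in>I. h i z = \<one>\<^bsub>H\<^esub>"
  have "b \<one>\<^bsub>H\<^esub> = \<one>\<^bsub>H'\<^esub>"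
    using assms by (metis hom_one)
  then have "a z = \<one>\<^bsub>G'\<^esub>"
    using assms z by (intro jointly_injD[OF assms(1)]) (auto simp: Group.iso_def hom_in_carrier)
  then show "z = \<one>\<^bsub>G\<^esub>"
    using assms z iso_eq_one_iff by metis
qed

text \<open>Both vertical arrows point the other way here. Vanishing has to be carried from
  \<open>H\<close> back to \<open>H'\<close>, which takes the injectivity of \<open>b\<close>;
  surjectivity of \<open>a\<close> supplies the class in \<open>G'\<close>.\<close>

lemma jointly_inj_pushforward:
  assumes "jointly_inj G' H' I h'" "group G" "group G'" "a \<in> iso G' G"
    and "group H" "group H'" "b \<in> iso H' H"
    and "\<And>i z. i \<in> I \<Longrightarrow> z \<in> carrier G' \<Longrightarrow> h' i z \<in> carrier H'"
    and "\<And>i z. i \<in> I \<Longrightarrow> z \<in> carrier G' \<Longrightarrow> h i (a z) = b (h' i z)"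
  shows "jointly_inj G H I h"
  unfolding jointly_inj_def
proof (intro ballI impI)
  fix z assume z: "z \<in> carrier G" "\<forall>i\<in>I. h i z = \<one>\<^bsub>H\<^esub>"
  then obtain y where y: "y \<in> carrier G'" "z = a y"
    using assms(4) by (auto simp: Group.iso_def bij_betw_def)
  have "h' i y = \<one>\<^bsub>H'\<^esub>" if "i \<in> I" for i
    using assms(5-9) y z that iso_eq_one_iff by metis
  then have "y = \<one>\<^bsub>G'\<^esub>"
    using y by (intro jointly_injD[OF assms(1)]) auto
  then show "z = \<one>\<^bsub>G\<^esub>"
    using assms y iso_eq_one_iff by metis
qed

text \<open>The excised set is the complement of \<open>N\<close>: it is closed, and it lies in the
  open set \<open>T\<close> because \<open>N\<close> and \<open>T\<close> cover the space.\<close>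

lemma homology_excision_open_cover:
  assumes "openin X N" "openin X T" "N \<union> T = topspace X"
  shows "hom_induced p (subtopology X N) (N \<inter> T) X T id
         \<in> iso (relative_homology_group p (subtopology X N) (N \<inter> T)) (relative_homology_group p X T)"
proof -
  have N: "N \<subseteq> topspace X" "T \<subseteq> topspace X"
    using assms by (auto dest: openin_subset)
  then have eq: "topspace X - (topspace X - N) = N" "T - (topspace X - N) = N \<inter> T"
    by auto
  have "closedin X (topspace X - N)"
    using assms by (simp add: openin_closedin_eq)
  then have "(X closure_of (topspace X - N)) \<subseteq> (X interior_of T)"
    using assms N by (auto simp: closure_of_closedin interior_of_openin)
  then show ?thesis
    using homology_excision_axiom[of X "topspace X - N" T "topspace X" p] N by (simp add: eq)
qed

lemma hom_induced_square:
  assumes "continuous_map A B f" "f \<in> S \<rightarrow> T" "continuous_map B D g" "g \<in> T \<rightarrow> V"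
    and "continuous_map A C f'" "f' \<in> S \<rightarrow> U" "continuous_map C D g'" "g' \<in> U \<rightarrow> V"
    and "\<And>x. x \<in> topspace A \<Longrightarrow> g (f x) = g' (f' x)"
  shows "hom_induced p B T D V g (hom_induced p A S B T f z) =
         hom_induced p C U D V g' (hom_induced p A S C U f' z)"
proof -
  have "hom_induced p A S D V (g \<circ> f) = hom_induced p A S D V (g' \<circ> f')"
    using assms(9) by (intro hom_induced_eq) simp
  then show ?thesis
    using hom_induced_compose'[OF assms(1-4), of p z] hom_induced_compose'[OF assms(5-8), of p z] by simp
qed

text \<open>In the long exact sequence of the triple, both neighbours of this boundary map are
  homology groups of \<open>X\<close> relative to \<open>T\<close>, which vanish.\<close>

lemma iso_hom_relboundary:
  assumes "T \<subseteq> S" "\<And>q. trivial_group (relative_homology_group q X T)"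
  shows "hom_relboundary p X S T
         \<in> iso (relative_homology_group p X S) (relative_homology_group (p - 1) (subtopology X S) T)"
proof (rule very_short_exact_sequence)
  show "exact_seq ([relative_homology_group (p - 1) X T,
     relative_homology_group (p - 1) (subtopology X S) T,
     relative_homology_group p X S, relative_homology_group p X T],
     [hom_induced (p - 1) (subtopology X S) T X T id, hom_relboundary p X S T,
      hom_induced p X T X S id])"
    using homology_exactness_triple_1[OF assms(1)] homology_exactness_triple_2[OF assms(1)]
    by (metis exact_seq_cons_iff)
qed (use assms in auto)

section \<open>Straight-line homotopies in a product with a vector space\<close>

lemma continuous_map_scaleR [continuous_intros]:
  fixes g :: "'a \<Rightarrow> 'e::real_normed_vector"
  assumes "continuous_map X euclideanreal f" "continuous_map X euclidean g"
  shows "continuous_map X euclidean (\<lambda>x. f x *\<^sub>R g x)"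
proof -
  have "continuous_map X (prod_topology euclidean euclidean) (\<lambda>x. (f x, g x))"
    using assms by (rule continuous_map_pairedI)
  moreover have "continuous_map (prod_topology euclidean euclidean) euclidean (\<lambda>(r, x::'e). r *\<^sub>R x)"
    by (auto simp: case_prod_unfold intro!: continuous_intros)
  ultimately show ?thesis
    by (simp add: continuous_map_compose[unfolded o_def, of X _ "\<lambda>x. (f x, g x)" _ "\<lambda>(r, x). r *\<^sub>R x", simplified])
qed

text \<open>The property \<open>P\<close> is left open so that one lemma serves homotopies of spaces
  and of pairs: it only has to follow from carrying \<open>V \<inter> A\<close> into
  \<open>W\<close>. The first component never moves, so segments are taken in the vector direction
  alone.\<close>

lemma homotopic_with_linear_snd:
  fixes f g :: "'a \<times> 'e::real_normed_vector \<Rightarrow> 'e"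
  assumes F: "\<And>x. F x = (fst x, f x)" and G: "\<And>x. G x = (fst x, g x)"
    and P: "\<And>h. h \<in> V \<inter> A \<rightarrow> W \<Longrightarrow> P h"
    and cf: "continuous_map (subtopology (prod_topology X euclidean) A) euclidean f"
    and cg: "continuous_map (subtopology (prod_topology X euclidean) A) euclidean g"
    and B: "\<And>x t. x \<in> A \<Longrightarrow> 0 \<le> t \<Longrightarrow> t \<le> 1 \<Longrightarrow> (fst x, (1 - t) *\<^sub>R f x + t *\<^sub>R g x) \<in> B"
    and W: "\<And>x t. x \<in> V \<Longrightarrow> x \<in> A \<Longrightarrow> 0 \<le> t \<Longrightarrow> t \<le> 1 \<Longrightarrow> (fst x, (1 - t) *\<^sub>R f x + t *\<^sub>R g x) \<in> W"
  shows "homotopic_with P (subtopology (prod_topology X euclidean) A) (subtopology (prod_topology X euclidean) B) F G"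
proof -
  let ?P = "prod_topology X (euclidean :: 'e topology)"
  let ?I = "top_of_set {0..1::real}"
  let ?Q = "prod_topology ?I (subtopology ?P A)"
  let ?h = "\<lambda>(t::real, x). (fst x, (1 - t) *\<^sub>R f x + t *\<^sub>R g x)"
  have 1: "continuous_map ?Q X (\<lambda>z. fst (snd z))"
    using continuous_map_compose[OF continuous_map_snd continuous_map_subtopology_fst, unfolded o_def]
    by blast
  have 2: "continuous_map ?Q euclidean (\<lambda>z. f (snd z))" "continuous_map ?Q euclidean (\<lambda>z. g (snd z))"
    using continuous_map_compose[OF continuous_map_snd] cf cg by (auto simp: o_def)
  have 3: "continuous_map ?Q euclideanreal fst"
    using continuous_map_into_fulltopology continuous_map_fst by blast
  have "continuous_map ?Q euclidean (\<lambda>z. (1 - fst z) *\<^sub>R f (snd z) + fst z *\<^sub>R g (snd z))"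
    using 2 3 by (intro continuous_map_add continuous_intros) 
  then have "continuous_map ?Q ?P ?h"
    using 1 by (auto simp: case_prod_unfold intro: continuous_map_pairedI)
  moreover have "?h z \<in> B" if "z \<in> topspace ?Q" for z
    using that B by (auto simp: case_prod_unfold)
  ultimately have "continuous_map ?Q (subtopology ?P B) ?h"
    by (intro continuous_map_into_subtopology) auto
  then show ?thesis
    unfolding homotopic_with_def using W by (intro exI[of _ ?h]) (auto simp: F G intro!: P)
qed

section \<open>The Thom isomorphism\<close>

definition axis_update :: "'d \<Rightarrow> real \<Rightarrow> real ^ 'd \<Rightarrow> real ^ 'd::finite" where
  "axis_update j a v = (\<chi> k. if k = j then a else v $ k)"

lemma axis_update_nth [simp]: "axis_update j a v $ k = (if k = j then a else v $ k)"
  by (simp add: axis_update_def)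

lemma continuous_on_axis_update: "continuous_on UNIV (axis_update j a)"
  unfolding axis_update_def
proof (rule continuous_on_vec_lambda)
  show "continuous_on UNIV (\<lambda>v::real ^ 'a. if k = j then a else v $ k)" for k
    by (cases "k = j") (auto intro: continuous_intros)
qed

text \<open>A coordinate \<open>j\<close> is added to \<open>K\<close> by comparing \<open>away X (insert j K)\<close> with its subset \<open>behind X K j\<close>:
  pushing in the negative direction \<open>j\<close> shows that the cylinder has no homology relative to that subset,
  and excision leaves \<open>ahead X j\<close> relative to its part in \<open>behind X K j\<close>, which is equivalent to the
  cylinder relative to \<open>away X K\<close>.\<close>

definition away :: "'a topology \<Rightarrow> 'd set \<Rightarrow> ('a \<times> (real ^ 'd::finite)) set" where
  "away X K = topspace X \<times> {v. \<exists>k\<in>K. v $ k \<noteq> 0}"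

abbreviation cyl :: "'a topology \<Rightarrow> ('a \<times> (real ^ 'd::finite)) topology" where
  "cyl X \<equiv> prod_topology X euclidean"

definition ahead :: "'a topology \<Rightarrow> 'd \<Rightarrow> ('a \<times> (real ^ 'd::finite)) set" where
  "ahead X j = topspace X \<times> {v. v $ j > 0}"

definition behind :: "'a topology \<Rightarrow> 'd set \<Rightarrow> 'd \<Rightarrow> ('a \<times> (real ^ 'd::finite)) set" where
  "behind X K j = topspace X \<times> {v. (\<exists>k\<in>K. v $ k \<noteq> 0) \<or> v $ j < 0}"

lemma openin_times_halves:
  "openin (cyl X) (away X K)" "openin (cyl X) (ahead X j)" "openin (cyl X) (behind X K j)"
proof -
  have "open {v::real^'b. v $ k \<noteq> 0}" for k
    by (intro open_Collect_neq continuous_intros)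
  then have 1: "open {v::real^'b. \<exists>k\<in>K. v $ k \<noteq> 0}"
    unfolding Collect_bex_eq by blast
  moreover have "open {v::real^'b. v $ j > 0}" "open {v::real^'b. v $ j < 0}"
    by (intro open_Collect_less continuous_intros)+
  ultimately show "openin (cyl X) (away X K)" "openin (cyl X) (ahead X j)" "openin (cyl X) (behind X K j)"
    unfolding away_def ahead_def behind_def
    by (auto simp: openin_prod_Times_iff Collect_disj_eq)
qed

text \<open>Only coordinate \<open>j\<close> moves, on the segment between \<open>a\<close> and its
  own value. The hypotheses ask that \<open>V\<close> and \<open>W\<close> be closed under this
  motion, which makes the homotopy one of pairs.\<close>

lemma homotopic_axis_update:
  assumes "W \<subseteq> V"
    and "\<And>x v t. (x, v) \<in> V \<Longrightarrow> 0 \<le> t \<Longrightarrow> t \<le> 1 \<Longrightarrow> (x, axis_update j ((1 - t) * a + t * v $ j) v) \<in> V"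
    and "\<And>x v t. (x, v) \<in> W \<Longrightarrow> 0 \<le> t \<Longrightarrow> t \<le> 1 \<Longrightarrow> (x, axis_update j ((1 - t) * a + t * v $ j) v) \<in> W"
  shows "homotopic_with (\<lambda>h. h \<in> W \<rightarrow> W) (subtopology (cyl X) V) (subtopology (cyl X) V)
           (map_prod id (axis_update j a)) id"
proof -
  have eq: "(1 - t) *\<^sub>R axis_update j a v + t *\<^sub>R v = axis_update j ((1 - t) * a + t * v $ j) v" for t v
    by (simp add: vec_eq_iff algebra_simps)
  have c: "continuous_map (subtopology (cyl X) V) euclidean (\<lambda>x. axis_update j a (snd x))"
    by (rule continuous_map_compose[OF continuous_map_subtopology_snd, unfolded o_def])
      (simp add: continuous_on_axis_update)
  show ?thesis
    by (rule homotopic_with_linear_snd[where f = "\<lambda>x. axis_update j a (snd x)" and g = snd and V = W and W = W])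
      (use c assms in \<open>auto simp del: mult_1_right simp: eq continuous_map_subtopology_snd\<close>)
qed

text \<open>Setting coordinate \<open>j\<close> to \<open>-1\<close> lands in
  \<open>behind X K j\<close> and is homotopic to the identity both on the cylinder and on that
  subset. Where some coordinate in \<open>K\<close> is nonzero it stays so, since \<open>j\<close>
  is not in \<open>K\<close>; elsewhere coordinate \<open>j\<close> runs between two negative
  values.\<close>

lemma trivial_homology_behind:
  assumes "j \<notin> K"
  shows "trivial_group (relative_homology_group p (cyl X) (behind X K j))"
proof (rule trivial_relative_homology_group_gen)
  let ?f = "map_prod id (axis_update j (-1))"
  have 1: "homotopic_with (\<lambda>h. h \<in> W \<rightarrow> W) (subtopology (cyl X) W) (subtopology (cyl X) W) ?f id"
    if "W = UNIV \<or> W = behind X K j" for W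
    using that
  proof
    assume W: "W = behind X K j"
    have "(x, axis_update j ((1 - t) * (- 1) + t * v $ j) v) \<in> W"
      if "(x, v) \<in> W" "0 \<le> t" "t \<le> 1" for x v t
    proof (cases "\<exists>k\<in>K. v $ k \<noteq> 0")
      case True
      then show ?thesis
        using that assms by (auto simp: W behind_def)
    next
      case False
      then have "v $ j < 0"
        using that by (auto simp: W behind_def)
      then have "(1 - t) * (-1) + t * v $ j < 0"
        using that convex_bound_lt[of "-1" 0 "v $ j" "1 - t" t] by simp
      then show ?thesis
        using that by (auto simp: W behind_def)
    qed
    then show ?thesis
      by (intro homotopic_axis_update) auto
  qed (intro homotopic_axis_update, auto)
  show "homotopic_with (\<lambda>h. True) (subtopology (cyl X) (behind X K j)) (subtopology (cyl X) (behind X K j)) ?f id"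
    using homotopic_with_mono[OF 1[of "behind X K j"]] by simp
  show "homotopic_with (\<lambda>h. True) (cyl X) (cyl X) ?f id"
    using homotopic_with_mono[OF 1[of "UNIV"]] by simp
  then have "continuous_map (cyl X) (cyl X) ?f"
    by (simp add: homotopic_with_imp_continuous_maps)
  then show "continuous_map (cyl X) (subtopology (cyl X) (behind X K j)) ?f"
    by (intro continuous_map_into_subtopology) (auto simp: behind_def)
qed

context
  fixes K :: "'d::finite set" and j :: 'd
  assumes j: "j \<notin> K"
begin

lemma iso_relboundary_behind:
  "hom_relboundary p (cyl X) (away X (insert j K)) (behind X K j)
   \<in> iso (relative_homology_group p (cyl X) (away X (insert j K)))
         (relative_homology_group (p - 1) (subtopology (cyl X) (away X (insert j K))) (behind X K j))"
  by (intro iso_hom_relboundary trivial_homology_behind j) (auto simp: behind_def away_def)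

lemma iso_excision_ahead:
  "hom_induced p (subtopology (cyl X) (ahead X j)) (ahead X j \<inter> behind X K j)
     (subtopology (cyl X) (away X (insert j K))) (behind X K j) id
   \<in> iso (relative_homology_group p (subtopology (cyl X) (ahead X j)) (ahead X j \<inter> behind X K j))
         (relative_homology_group p (subtopology (cyl X) (away X (insert j K))) (behind X K j))"
proof -
  have "ahead X j \<subseteq> away X (insert j K)" "behind X K j \<subseteq> away X (insert j K)"
    "ahead X j \<union> behind X K j = away X (insert j K)" "away X (insert j K) \<subseteq> topspace (cyl X)"
    by (force simp: ahead_def behind_def away_def)+
  then show ?thesis
    using homology_excision_open_cover[of "subtopology (cyl X) (away X (insert j K))" "ahead X j" "behind X K j" p]
    by (simp add: openin_times_halves openin_open_subtopology subtopology_subtopology Int_absorb1 Int_absorb2)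
qed

lemma iso_inclusion_ahead:
  "hom_induced p (subtopology (cyl X) (ahead X j)) (ahead X j \<inter> behind X K j) (cyl X) (away X K) id
   \<in> iso (relative_homology_group p (subtopology (cyl X) (ahead X j)) (ahead X j \<inter> behind X K j))
         (relative_homology_group p (cyl X) (away X K))"
proof (rule homotopy_equivalence_relative_homology_group_isomorphism)
  \<comment> \<open>Setting coordinate \<open>j\<close> to \<open>1\<close> is the homotopy inverse
    of the inclusion: it takes the whole cylinder into \<open>ahead X j\<close> and leaves the
    coordinates in \<open>K\<close> as they are.\<close>
  let ?g = "map_prod id (axis_update j 1)"
  have pos: "(1 - t) * 1 + t * a > 0" if "0 < a" "0 \<le> t" "t \<le> 1" for t a :: real
    using that convex_bound_lt[of "-1" 0 "- a" "1 - t" t] by simp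
  have AB: "ahead X j \<inter> behind X K j = topspace X \<times> {v. v $ j > 0 \<and> (\<exists>k\<in>K. v $ k \<noteq> 0)}"
    by (auto simp: ahead_def behind_def)
  have "homotopic_with (\<lambda>h. h \<in> away X K \<rightarrow> away X K) (subtopology (cyl X) UNIV) (subtopology (cyl X) UNIV) ?g id"
    using j by (intro homotopic_axis_update) (auto simp: away_def)
  then show 1: "homotopic_with (\<lambda>k. k \<in> away X K \<rightarrow> away X K) (cyl X) (cyl X) (id \<circ> ?g) id"
    by simp
  have "homotopic_with (\<lambda>h. h \<in> ahead X j \<inter> behind X K j \<rightarrow> ahead X j \<inter> behind X K j)
     (subtopology (cyl X) (ahead X j)) (subtopology (cyl X) (ahead X j)) ?g id"
  proof (rule homotopic_axis_update)
    fix x :: 'a and v :: "real ^ 'd" and t :: real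
    assume t: "0 \<le> t" "t \<le> 1"
    show "(x, axis_update j ((1 - t) * 1 + t * v $ j) v) \<in> ahead X j" if "(x, v) \<in> ahead X j"
      using pos[of "v $ j" t] t that unfolding ahead_def by simp
    show "(x, axis_update j ((1 - t) * 1 + t * v $ j) v) \<in> ahead X j \<inter> behind X K j"
      if "(x, v) \<in> ahead X j \<inter> behind X K j"
    proof -
      from that obtain k where "k \<in> K" "v $ k \<noteq> 0" "v $ j > 0" "x \<in> topspace X"
        unfolding AB by auto
      then show ?thesis
        unfolding AB using pos[of "v $ j" t] t j by (auto intro!: bexI[of _ k])
    qed
  qed blast
  then show "homotopic_with (\<lambda>h. h \<in> ahead X j \<inter> behind X K j \<rightarrow> ahead X j \<inter> behind X K j)
     (subtopology (cyl X) (ahead X j)) (subtopology (cyl X) (ahead X j)) (?g \<circ> id) id"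
    by simp
  show "continuous_map (subtopology (cyl X) (ahead X j)) (cyl X) id"
    by simp
  show "id \<in> ahead X j \<inter> behind X K j \<rightarrow> away X K" "?g \<in> away X K \<rightarrow> ahead X j \<inter> behind X K j"
    using j by (auto simp: ahead_def behind_def away_def)
  show "continuous_map (cyl X) (subtopology (cyl X) (ahead X j)) ?g"
    using homotopic_with_imp_continuous_maps[OF 1]
    by (intro continuous_map_into_subtopology) (auto simp: ahead_def)
qed

lemma isomorphic_homology_away_insert:
  "relative_homology_group (p + 1) (cyl X) (away X (insert j K)) \<cong> relative_homology_group p (cyl X) (away X K)"
proof -
  let ?S = "subtopology (cyl X) (away X (insert j K))"
  have "relative_homology_group (p + 1) (cyl X) (away X (insert j K))
        \<cong> relative_homology_group p ?S (behind X K j)"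
    using is_isoI[OF iso_relboundary_behind[of "p + 1" X]] by simp
  also have "\<dots> \<cong> relative_homology_group p (subtopology (cyl X) (ahead X j)) (ahead X j \<inter> behind X K j)"
    by (rule group.iso_sym[OF group_relative_homology_group is_isoI[OF iso_excision_ahead]])
  also have "\<dots> \<cong> relative_homology_group p (cyl X) (away X K)"
    using is_isoI[OF iso_inclusion_ahead[of p X]] .
  finally show ?thesis .
qed

text \<open>The three isomorphisms behind the degree shift are natural for the maps
  \<open>map_prod (g i) id\<close>. Joint injectivity is pulled back along the inclusion, pushed
  forward along the excision and pulled back along the boundary map, following the directions of
  these arrows.\<close>

lemma jointly_inj_away_insert:
  assumes g: "\<And>i. i \<in> I \<Longrightarrow> continuous_map X Y (g i)"
    and "jointly_inj (relative_homology_group p (cyl X) (away X K))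
           (relative_homology_group p (cyl Y) (away Y K)) I
           (\<lambda>i. hom_induced p (cyl X) (away X K) (cyl Y) (away Y K) (map_prod (g i) id))"
  shows "jointly_inj (relative_homology_group (p + 1) (cyl X) (away X (insert j K)))
           (relative_homology_group (p + 1) (cyl Y) (away Y (insert j K))) I
           (\<lambda>i. hom_induced (p + 1) (cyl X) (away X (insert j K)) (cyl Y) (away Y (insert j K)) (map_prod (g i) id))"
proof -
  let ?A = "\<lambda>Z. subtopology (cyl Z) (ahead Z j)" and ?AB = "\<lambda>Z. ahead Z j \<inter> behind Z K j"
  let ?S = "\<lambda>Z. subtopology (cyl Z) (away Z (insert j K))" and ?B = "\<lambda>Z. behind Z K j"
  have c: "continuous_map (cyl X) (cyl Y) (map_prod (g i) id)" if "i \<in> I" for i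
    using g[OF that] by (auto simp: map_prod_def case_prod_unfold
        intro!: continuous_map_pairedI continuous_map_compose[OF continuous_map_fst, unfolded o_def] continuous_map_snd)
  have gX: "g i x \<in> topspace Y" if "i \<in> I" "x \<in> topspace X" for i x
    using g that by (auto simp: continuous_map_def)
  have cA: "continuous_map (?A X) (?A Y) (map_prod (g i) id)" if "i \<in> I" for i
    using c[OF that] gX that
    by (intro continuous_map_into_subtopology continuous_map_from_subtopology) (auto simp: ahead_def)
  have cS: "continuous_map (?S X) (?S Y) (map_prod (g i) id)" if "i \<in> I" for i
    using c[OF that] gX that
    by (intro continuous_map_into_subtopology continuous_map_from_subtopology) (auto simp: away_def)
  have AS: "ahead Z j \<subseteq> away Z (insert j K)" for Z :: "'z topology"
    by (auto simp: away_def ahead_def)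
  have im: "map_prod (g i) id \<in> ?AB X \<rightarrow> ?AB Y" "map_prod (g i) id \<in> away X L \<rightarrow> away Y L"
    "map_prod (g i) id \<in> ?B X \<rightarrow> ?B Y" if "i \<in> I" for i L
    using gX that by (auto simp: ahead_def behind_def away_def)
  have idA: "id \<in> ?AB Z \<rightarrow> away Z K" for Z :: "'z topology"
    by (auto simp: ahead_def behind_def away_def)
  have idB: "id \<in> ?AB Z \<rightarrow> ?B Z" for Z :: "'z topology"
    by auto
  have idS: "continuous_map (?A Z) (?S Z) id" for Z :: "'z topology"
    by (rule continuous_map_from_subtopology_mono[OF continuous_map_id AS])
  have "jointly_inj (relative_homology_group p (?A X) (?AB X)) (relative_homology_group p (?A Y) (?AB Y)) I
          (\<lambda>i. hom_induced p (?A X) (?AB X) (?A Y) (?AB Y) (map_prod (g i) id))"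
  proof (rule jointly_inj_pullback[OF assms(2) _ _ iso_inclusion_ahead _ _ hom_induced_hom[of _ "?A Y" "?AB Y" _ _ id]])
    show "hom_induced p (cyl X) (away X K) (cyl Y) (away Y K) (map_prod (g i) id)
        (hom_induced p (?A X) (?AB X) (cyl X) (away X K) id z) =
      hom_induced p (?A Y) (?AB Y) (cyl Y) (away Y K) id
        (hom_induced p (?A X) (?AB X) (?A Y) (?AB Y) (map_prod (g i) id) z)" if "i \<in> I" for i z
      by (rule hom_induced_square) (simp_all only: c cA im idA that continuous_map_id_subt id_apply)
  qed (simp_all only: group_relative_homology_group)
  then have inner: "jointly_inj (relative_homology_group p (?S X) (?B X)) (relative_homology_group p (?S Y) (?B Y)) I
          (\<lambda>i. hom_induced p (?S X) (?B X) (?S Y) (?B Y) (map_prod (g i) id))"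
  proof (rule jointly_inj_pushforward[OF _ _ _ iso_excision_ahead _ _ iso_excision_ahead])
    show "hom_induced p (?S X) (?B X) (?S Y) (?B Y) (map_prod (g i) id)
        (hom_induced p (?A X) (?AB X) (?S X) (?B X) id z) =
      hom_induced p (?A Y) (?AB Y) (?S Y) (?B Y) id
        (hom_induced p (?A X) (?AB X) (?A Y) (?AB Y) (map_prod (g i) id) z)" if "i \<in> I" for i z
      by (rule hom_induced_square) (simp_all only: cS cA im idB idS that id_apply)
  qed (simp_all only: group_relative_homology_group hom_induced_carrier)
  have square: "hom_induced p (?S X) (?B X) (?S Y) (?B Y) (map_prod (g i) id)
        (hom_relboundary (p + 1) (cyl X) (away X (insert j K)) (?B X) z)
      = hom_relboundary (p + 1) (cyl Y) (away Y (insert j K)) (?B Y)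
          (hom_induced (p + 1) (cyl X) (away X (insert j K)) (cyl Y) (away Y (insert j K)) (map_prod (g i) id) z)"
    if "i \<in> I" for i z
    using fun_cong[OF naturality_hom_induced_relboundary[OF c[OF that] im(2)[OF that] im(3)[OF that]],
        of "p + 1" "insert j K" z] by (simp only: o_apply add_diff_cancel_right')
  show ?thesis
    by (rule jointly_inj_pullback[OF inner _ _
          iso_relboundary_behind[of "p + 1" X, unfolded add_diff_cancel_right'] _ _
          group_homomorphism_hom_relboundary[of "p + 1" "cyl Y" "away Y (insert j K)" "?B Y", unfolded add_diff_cancel_right']
          square])
      (simp_all only: group_relative_homology_group)
qed

end

section \<open>The Thom isomorphism in all coordinates and the complement of the zero
  section\<close>

lemma exact_seq_image_eq_kernel:
  "exact_seq ([C, B, A], [g, f]) \<Longrightarrow> f ` carrier A = kernel B C g"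
  by simp

lemma away_UNIV: "away X UNIV = topspace X \<times> (- {0})"
  by (auto simp: away_def vec_eq_iff)

lemma away_empty: "away X {} = {}"
  by (simp add: away_def)

lemma cyl_subtopology: "cyl (subtopology X S) = subtopology (cyl X) (S \<times> UNIV)"
  using prod_topology_subtopology(1)[of X S euclidean] by simp

lemma continuous_map_cyl:
  assumes "continuous_map X Y g"
  shows "continuous_map (cyl X) (cyl Y) (map_prod g id)"
  using assms by (auto simp: map_prod_def case_prod_unfold
      intro!: continuous_map_pairedI continuous_map_compose[OF continuous_map_fst, unfolded o_def] continuous_map_snd)

lemma iso_homology_cyl:
  "hom_induced p (cyl X :: ('a \<times> (real ^ 'd::finite)) topology) {} X {} fst \<in> iso (homology_group p (cyl X)) (homology_group p X)"
proof (rule homotopy_equivalence_homology_group_isomorphism)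
  have "homotopic_with (\<lambda>h. True) (subtopology (cyl X) UNIV) (subtopology (cyl X) UNIV) ((\<lambda>x. (x, 0::real ^ 'd)) \<circ> fst) id"
    by (rule homotopic_with_linear_snd[where f = "\<lambda>x. 0" and g = snd and V = UNIV and W = UNIV])
      (simp_all add: continuous_map_snd)
  then show "homotopic_with (\<lambda>h. True) (cyl X) (cyl X) ((\<lambda>x. (x, 0::real ^ 'd)) \<circ> fst) id"
    by (simp only: subtopology_UNIV)
  show "homotopic_with (\<lambda>k. True) X X (fst \<circ> (\<lambda>x. (x, 0::real ^ 'd))) id"
    by (rule homotopic_with_equal) (simp_all add: o_def)
qed (simp_all add: continuous_map_fst continuous_map_pairedI)

text \<open>Every coordinate in \<open>K\<close> raises the degree by one, and for empty
  \<open>K\<close> the cylinder contracts onto \<open>X\<close>. With all coordinates in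
  \<open>K\<close> this is the Thom isomorphism of a trivial bundle.\<close>

lemma isomorphic_homology_away:
  "relative_homology_group (p + int (card K)) (cyl X) (away X K) \<cong> homology_group p X"
proof (induction K rule: infinite_finite_induct)
  case empty
  then show ?case
    using is_isoI[OF iso_homology_cyl] by (simp add: away_def)
next
  case (insert j K)
  have "relative_homology_group (p + int (card K) + 1) (cyl X) (away X (insert j K))
        \<cong> relative_homology_group (p + int (card K)) (cyl X) (away X K)"
    using insert.hyps by (intro isomorphic_homology_away_insert)
  also have "\<dots> \<cong> homology_group p X"
    by (fact insert.IH)
  finally show ?case
    using insert.hyps by (simp add: add_ac)
qed simp

lemma jointly_inj_away:
  assumes g: "\<And>i. i \<in> I \<Longrightarrow> continuous_map X Y (g i)"
    and inj: "jointly_inj (homology_group p X) (homology_group p Y) I (\<lambda>i. hom_induced p X {} Y {} (g i))"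
  shows "jointly_inj (relative_homology_group (p + int (card K)) (cyl X) (away X K))
           (relative_homology_group (p + int (card K)) (cyl Y) (away Y K)) I
           (\<lambda>i. hom_induced (p + int (card K)) (cyl X) (away X K) (cyl Y) (away Y K) (map_prod (g i) id))"
proof (induction K rule: infinite_finite_induct)
  case empty
  have "jointly_inj (homology_group p (cyl X)) (homology_group p (cyl Y)) I
          (\<lambda>i. hom_induced p (cyl X) {} (cyl Y) {} (map_prod (g i) id))"
  proof (rule jointly_inj_pullback[OF inj _ _ iso_homology_cyl _ _ hom_induced_hom[of _ "cyl Y" _ _ _ fst]])
    show "hom_induced p X {} Y {} (g i) (hom_induced p (cyl X) {} X {} fst z) =
          hom_induced p (cyl Y) {} Y {} fst (hom_induced p (cyl X) {} (cyl Y) {} (map_prod (g i) id) z)"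
      if "i \<in> I" for i z
      by (rule hom_induced_square)
        (simp_all only: continuous_map_fst g[OF that] continuous_map_cyl[OF g[OF that]] Pi_empty UNIV_I fst_map_prod)
  qed (simp_all only: group_relative_homology_group)
  then show ?case
    by (simp only: card.empty of_nat_0 add_0_right away_empty)
next
  case (insert j K)
  have eq: "p + int (card (insert j K)) = p + int (card K) + 1"
    using insert.hyps by simp
  show ?case
    unfolding eq by (rule jointly_inj_away_insert[OF insert.hyps(2) g insert.IH])
qed simp

text \<open>Replacing the vector by the constant vector with all entries \<open>1\<close> maps the
  cylinder into the complement of the zero section, and as a self-map of the cylinder it is
  homotopic to the identity. Every class therefore comes from the complement.\<close>

lemma surj_homology_away_inclusion:
  "hom_induced p (subtopology (cyl X) (away X UNIV)) {} (cyl X :: ('a \<times> (real ^ 'd::finite)) topology) {} id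
     ` carrier (homology_group p (subtopology (cyl X) (away X UNIV))) = carrier (homology_group p (cyl X))"
proof
  let ?s = "\<lambda>x :: 'a \<times> (real ^ 'd). (fst x, \<chi> k. 1) :: 'a \<times> (real ^ 'd)"
  let ?A = "subtopology (cyl X) (away X UNIV :: ('a \<times> (real ^ 'd)) set)"
  have e: "(\<chi> k. 1 :: real ^ 'd) \<noteq> 0"
    by (simp add: vec_eq_iff)
  have "homotopic_with (\<lambda>h. True) (subtopology (cyl X) UNIV) (subtopology (cyl X) UNIV) ?s id"
    by (rule homotopic_with_linear_snd[where f = "\<lambda>x. \<chi> k. 1" and g = snd and V = UNIV and W = UNIV])
      (simp_all add: continuous_map_snd)
  then have hom: "homotopic_with (\<lambda>h. True) (cyl X) (cyl X) ?s id"
    by (simp only: subtopology_UNIV)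
  then have "continuous_map (cyl X) (cyl X) ?s"
    using homotopic_with_imp_continuous_maps by blast
  then have s: "continuous_map (cyl X) ?A ?s"
    by (intro continuous_map_into_subtopology) (auto simp: away_def)
  have "w \<in> hom_induced p ?A {} (cyl X) {} id ` carrier (homology_group p ?A)"
    if w: "w \<in> carrier (homology_group p (cyl X))" for w
  proof
    have "w = hom_induced p (cyl X) {} (cyl X) {} id w"
      using w by (simp add: hom_induced_id)
    also have "\<dots> = hom_induced p (cyl X) {} (cyl X) {} (id \<circ> ?s) w"
      using homology_homotopy_empty[OF hom, of p] by simp
    also have "\<dots> = hom_induced p ?A {} (cyl X) {} id (hom_induced p (cyl X) {} ?A {} ?s w)"
      using hom_induced_compose'[OF s _ continuous_map_id_subt, of "{}" "{}" "{}" p w] by simp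
    finally show "w = hom_induced p ?A {} (cyl X) {} id (hom_induced p (cyl X) {} ?A {} ?s w)" .
  qed (rule hom_induced_carrier)
  then show "carrier (homology_group p (cyl X)) \<subseteq> hom_induced p ?A {} (cyl X) {} id ` carrier (homology_group p ?A)"
    by blast
qed (auto simp: hom_induced_carrier)

text \<open>As absolute classes of the cylinder all come from the complement of the zero section,
  they die in relative homology, and exactness makes the boundary map injective. This lets maps to
  the complement of the zero section detect relative classes.\<close>

lemma hom_boundary_away_eq_one:
  assumes y: "y \<in> carrier (relative_homology_group p (cyl X) (away X UNIV))"
    and 1: "hom_boundary p (cyl X) (away X UNIV) y = \<one>\<^bsub>homology_group (p - 1) (subtopology (cyl X) (away X UNIV))\<^esub>"
  shows "y = \<one>\<^bsub>relative_homology_group p (cyl X) (away X UNIV)\<^esub>"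
proof -
  let ?A = "away X UNIV"
  have "y \<in> kernel (relative_homology_group p (cyl X) ?A) (homology_group (p - 1) (subtopology (cyl X) ?A))
      (hom_boundary p (cyl X) ?A)"
    using y 1 by (simp add: kernel_def)
  then obtain w where w: "w \<in> carrier (homology_group p (cyl X))" "y = hom_induced p (cyl X) {} (cyl X) ?A id w"
    unfolding exact_seq_image_eq_kernel[OF homology_exactness_axiom_1, symmetric] by blast
  then obtain u where u: "u \<in> carrier (homology_group p (subtopology (cyl X) ?A))"
    "w = hom_induced p (subtopology (cyl X) ?A) {} (cyl X) {} id u"
    unfolding surj_homology_away_inclusion[symmetric] by blast
  then have "w \<in> kernel (homology_group p (cyl X))
      (relative_homology_group p (cyl X) ?A) (hom_induced p (cyl X) {} (cyl X) ?A id)"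
    unfolding exact_seq_image_eq_kernel[OF homology_exactness_axiom_3, symmetric] by blast
  then show ?thesis
    using w by (simp add: kernel_def)
qed

section \<open>Deletion of a subspace\<close>

text \<open>The second component stays constant during the homotopy, so points off the zero section
  remain off it and the homotopy is one of pairs.\<close>

lemma homotopic_with_pair_snd:
  fixes X :: "'a topology" and Y :: "'b topology"
  assumes "homotopic_with (\<lambda>h. True) (subtopology (cyl X) N) Y f (g :: 'a \<times> (real ^ 'd::finite) \<Rightarrow> 'b)"
    and "N \<subseteq> topspace (cyl X)"
  shows "homotopic_with (\<lambda>h. h \<in> N \<inter> (UNIV \<times> - {0}) \<rightarrow> away Y UNIV) (subtopology (cyl X) N) (cyl Y)
           (\<lambda>x. (f x, snd x)) (\<lambda>x. (g x, snd x))"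
proof -
  let ?Q = "prod_topology (top_of_set {0..1::real}) (subtopology (cyl X) N)"
  obtain h where h: "continuous_map ?Q Y h" "\<And>x. h (0, x) = f x" "\<And>x. h (1, x) = g x"
    using assms(1) unfolding homotopic_with_def by blast
  have "continuous_map ?Q euclidean (\<lambda>x. snd (snd x))"
    by (rule continuous_map_compose[OF continuous_map_snd continuous_map_subtopology_snd, unfolded o_def])
  with h(1) have "continuous_map ?Q (cyl Y) (\<lambda>x. (h x, snd (snd x)))"
    by (rule continuous_map_pairedI)
  moreover have "h (t, x) \<in> topspace Y" if "0 \<le> t" "t \<le> 1" "x \<in> N" for t x
    using continuous_map_funspace[OF h(1)] that assms(2) by (auto simp: Pi_iff)
  ultimately show ?thesis
    unfolding homotopic_with_def away_UNIV using h by (intro exI[of _ "\<lambda>x. (h x, snd (snd x))"]) auto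
qed

lemma jointly_inj_same_target:
  assumes "jointly_inj G' H I h'" "group G" "group G'" "a \<in> iso G G'" "group H"
    and "\<And>i z. i \<in> I \<Longrightarrow> h' i (a z) = h i z"
  shows "jointly_inj G H I h"
proof (rule jointly_inj_pullback[OF assms(1-4)])
  show "(\<lambda>x. x) \<in> hom H H"
    by (simp add: hom_def)
qed (use assms(5,6) in auto)

text \<open>In the application the second component is the value of the removed form,
  \<open>M'\<close> is the complement of the remaining forms, \<open>M\<close> that of all forms,
  and \<open>M0\<close> that of the restricted ones. The relative class with boundary
  \<open>z\<close> has degree \<open>n + 1\<close>, and the Thom shift by the dimension explains the
  degree in \<open>inj\<close>. On \<open>N\<close> the map \<open>F i\<close> is homotopic to
  \<open>g i\<close> of the base point, so in relative homology the map with components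
  \<open>F i\<close> and \<open>snd\<close> agrees with the product of \<open>g i\<close> and the
  identity, to which the Thom isomorphism applies.\<close>

lemma deletion_step:
  fixes X :: "'a topology" and Y :: "'b topology" and M' N :: "('a \<times> (real ^ 'd::finite)) set"
  defines "M \<equiv> M' \<inter> (UNIV \<times> - {0})"
  assumes M': "openin (cyl X) M'" and N: "openin (cyl X) N" "N \<subseteq> M'" "N \<subseteq> M0 \<times> UNIV"
    and M0: "M0 \<subseteq> topspace X" "\<And>x. (x, 0) \<in> M' \<Longrightarrow> (x, 0) \<in> N" "\<And>x. x \<in> M0 \<Longrightarrow> (x, 0) \<in> N"
    and F: "\<And>i. i \<in> I \<Longrightarrow> continuous_map (subtopology (cyl X) M') Y (F i)"
    and g: "\<And>i. i \<in> I \<Longrightarrow> continuous_map (subtopology X M0) Y (g i)"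
    and Fg: "\<And>i. i \<in> I \<Longrightarrow> homotopic_with (\<lambda>h. True) (subtopology (cyl X) N) Y (F i) (g i \<circ> fst)"
    and inj: "jointly_inj (homology_group (n + 1 - int CARD('d)) (subtopology X M0))
                (homology_group (n + 1 - int CARD('d)) Y) I
                (\<lambda>i. hom_induced (n + 1 - int CARD('d)) (subtopology X M0) {} Y {} (g i))"
    and z: "z \<in> carrier (homology_group n (subtopology (cyl X) M))"
    and z_incl: "hom_induced n (subtopology (cyl X) M) {} (subtopology (cyl X) M') {} id z
                 = \<one>\<^bsub>homology_group n (subtopology (cyl X) M')\<^esub>"
    and z_F: "\<And>i. i \<in> I \<Longrightarrow> hom_induced n (subtopology (cyl X) M) {} (subtopology (cyl Y) (away Y UNIV)) {}
                 (\<lambda>x. (F i x, snd x)) z = \<one>\<^bsub>homology_group n (subtopology (cyl Y) (away Y UNIV))\<^esub>"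
  shows "z = \<one>\<^bsub>homology_group n (subtopology (cyl X) M)\<^esub>"
proof -
  let ?X0 = "subtopology X M0" and ?aY = "away Y UNIV :: ('b \<times> (real ^ 'd)) set"
  let ?a0 = "away ?X0 UNIV :: ('a \<times> (real ^ 'd)) set"
  let ?CN = "subtopology (cyl X) N" and ?CM' = "subtopology (cyl X) M'"
  let ?H = "relative_homology_group (n + 1) (cyl Y) ?aY"
  have sub: "N \<subseteq> topspace (cyl X)" "M' \<subseteq> topspace (cyl X)"
    using N M' by (simp_all only: openin_subset)
  have NM: "N \<inter> ?a0 = N \<inter> M"
    using N sub by (auto simp: away_UNIV M_def)
  have CN: "subtopology (cyl ?X0) N = ?CN"
    using N by (simp add: cyl_subtopology subtopology_subtopology Int_absorb1)
  have openN: "openin (cyl ?X0) N"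
    unfolding cyl_subtopology openin_subtopology using N by blast
  have M_open: "openin ?CM' M"
  proof -
    have "M = M' \<inter> away X UNIV"
      using sub by (auto simp: M_def away_UNIV)
    then show ?thesis
      unfolding openin_subtopology using openin_times_halves(1)[of X UNIV] by (auto simp: Int_commute)
  qed
  have step1: "jointly_inj (relative_homology_group (n + 1) (cyl ?X0) ?a0) ?H I
          (\<lambda>i. hom_induced (n + 1) (cyl ?X0) ?a0 (cyl Y) ?aY (map_prod (g i) id))"
    using jointly_inj_away[OF g inj, where K = "UNIV :: 'd set"] by simp
  \<comment> \<open>The pair of \<open>N\<close> and \<open>N \<inter> M\<close> is excised out of
    two larger pairs, here out of the full cylinder over \<open>M0\<close> and in
    \<open>exc2\<close> out of \<open>M'\<close>. Both times \<open>N\<close> contains every point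
    at which the second component is zero, so the open sets cover.\<close>
  have exc1: "hom_induced (n + 1) ?CN (N \<inter> M) (cyl ?X0) ?a0 id
      \<in> iso (relative_homology_group (n + 1) ?CN (N \<inter> M)) (relative_homology_group (n + 1) (cyl ?X0) ?a0)"
  proof -
    have "(x, v) \<in> N \<union> ?a0" if "x \<in> topspace X \<inter> M0" for x v
      using that M0 by (cases "v = 0") (auto simp: away_UNIV)
    then have "N \<union> ?a0 = topspace (cyl ?X0)"
      using N sub by (auto simp: away_UNIV)
    from homology_excision_open_cover[OF openN openin_times_halves(1) this] show ?thesis
      by (simp only: NM CN)
  qed
  have exc2: "hom_induced (n + 1) ?CN (N \<inter> M) ?CM' M id
      \<in> iso (relative_homology_group (n + 1) ?CN (N \<inter> M)) (relative_homology_group (n + 1) ?CM' M)"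
  proof -
    have "openin ?CM' N"
      unfolding openin_subtopology using N by blast
    moreover have "(x, v) \<in> N \<union> M" if "(x, v) \<in> M'" for x v
      using that M0 by (cases "v = 0") (auto simp: M_def)
    then have "N \<union> M = topspace ?CM'"
      using N sub by (auto simp: M_def)
    moreover have "subtopology ?CM' N = ?CN"
      using N by (simp add: subtopology_subtopology Int_absorb1)
    ultimately show ?thesis
      using homology_excision_open_cover[of ?CM' N M "n + 1"] M_open by (simp only:)
  qed
  have cont: "continuous_map ?CM' (cyl Y) (\<lambda>x. (F i x, snd x))" if "i \<in> I" for i
    by (rule continuous_map_pairedI[OF F[OF that] continuous_map_subtopology_snd])
  have im: "(\<lambda>x. (F i x, snd x)) \<in> M \<rightarrow> ?aY" if "i \<in> I" for i
    using continuous_map_funspace[OF F[OF that]] sub by (auto simp: M_def away_UNIV Pi_iff)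
  have contN: "continuous_map ?CN (cyl ?X0) id"
    using continuous_map_id_subt[of "cyl ?X0" N] by (simp only: CN)
  have step2: "jointly_inj (relative_homology_group (n + 1) ?CN (N \<inter> M)) ?H I
          (\<lambda>i. hom_induced (n + 1) ?CN (N \<inter> M) (cyl Y) ?aY (\<lambda>x. (F i x, snd x)))"
  proof (rule jointly_inj_same_target[OF step1 _ _ exc1])
    fix i z assume i: "i \<in> I"
    have "map_prod (g i) id \<in> ?a0 \<rightarrow> ?aY"
      using continuous_map_funspace[OF g[OF i]] by (auto simp: away_UNIV)
    moreover have "id \<in> N \<inter> M \<rightarrow> ?a0"
      unfolding NM[symmetric] by (rule Pi_I) simp
    ultimately have "hom_induced (n + 1) (cyl ?X0) ?a0 (cyl Y) ?aY (map_prod (g i) id)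
        (hom_induced (n + 1) ?CN (N \<inter> M) (cyl ?X0) ?a0 id z)
      = hom_induced (n + 1) ?CN (N \<inter> M) (cyl Y) ?aY (map_prod (g i) id \<circ> id) z"
      by (intro hom_induced_compose' contN continuous_map_cyl g i)
    also have "map_prod (g i) id \<circ> id = (\<lambda>x. ((g i \<circ> fst) x, snd x))"
      by (simp add: fun_eq_iff map_prod_def case_prod_unfold)
    also have "hom_induced (n + 1) ?CN (N \<inter> M) (cyl Y) ?aY \<dots>
        = hom_induced (n + 1) ?CN (N \<inter> M) (cyl Y) ?aY (\<lambda>x. (F i x, snd x))"
    proof (rule homology_homotopy_axiom[symmetric])
      have "N \<inter> (UNIV \<times> - {0}) = N \<inter> M"
        using N by (auto simp: M_def)
      then show "homotopic_with (\<lambda>h. h \<in> N \<inter> M \<rightarrow> ?aY) ?CN (cyl Y) (\<lambda>x. (F i x, snd x)) (\<lambda>x. ((g i \<circ> fst) x, snd x))"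
        using homotopic_with_pair_snd[OF Fg[OF i] sub(1)] by (simp only:)
    qed
    finally show "hom_induced (n + 1) (cyl ?X0) ?a0 (cyl Y) ?aY (map_prod (g i) id)
        (hom_induced (n + 1) ?CN (N \<inter> M) (cyl ?X0) ?a0 id z)
      = hom_induced (n + 1) ?CN (N \<inter> M) (cyl Y) ?aY (\<lambda>x. (F i x, snd x)) z" .
  qed (simp_all only: group_relative_homology_group)
  have step3: "jointly_inj (relative_homology_group (n + 1) ?CM' M) ?H I
          (\<lambda>i. hom_induced (n + 1) ?CM' M (cyl Y) ?aY (\<lambda>x. (F i x, snd x)))"
  proof (rule jointly_inj_pushforward[OF step2 _ _ exc2 _ _ iso_set_refl[of ?H]])
    fix i z assume i: "i \<in> I"
    have "hom_induced (n + 1) ?CM' M (cyl Y) ?aY (\<lambda>x. (F i x, snd x))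
        (hom_induced (n + 1) ?CN (N \<inter> M) ?CM' M id z)
      = hom_induced (n + 1) ?CN (N \<inter> M) (cyl Y) ?aY ((\<lambda>x. (F i x, snd x)) \<circ> id) z"
      by (intro hom_induced_compose' cont im i continuous_map_from_subtopology_mono[OF continuous_map_id N(2)]) simp
    then show "hom_induced (n + 1) ?CM' M (cyl Y) ?aY (\<lambda>x. (F i x, snd x))
        (hom_induced (n + 1) ?CN (N \<inter> M) ?CM' M id z)
      = hom_induced (n + 1) ?CN (N \<inter> M) (cyl Y) ?aY (\<lambda>x. (F i x, snd x)) z"
      by (simp only: comp_id)
  qed (simp_all only: group_relative_homology_group hom_induced_carrier)
  have CM: "subtopology ?CM' M = subtopology (cyl X) M"
    by (simp add: subtopology_subtopology M_def Int_absorb1)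
  \<comment> \<open>Exactness for the pair of \<open>M'\<close> and \<open>M\<close>; the degree is
    written \<open>n + 1 - 1\<close> to match the target of the boundary map in degree
    \<open>n + 1\<close>.\<close>
  have "z \<in> kernel (homology_group (n + 1 - 1) (subtopology ?CM' M)) (homology_group (n + 1 - 1) ?CM')
      (hom_induced (n + 1 - 1) (subtopology ?CM' M) {} ?CM' {} id)"
    unfolding CM using z z_incl by (simp add: kernel_def)
  then obtain y where y: "y \<in> carrier (relative_homology_group (n + 1) ?CM' M)" "z = hom_boundary (n + 1) ?CM' M y"
    unfolding exact_seq_image_eq_kernel[OF homology_exactness_axiom_2, symmetric] by blast
  have "y = \<one>\<^bsub>relative_homology_group (n + 1) ?CM' M\<^esub>"
  proof (rule jointly_injD[OF step3 y(1)])
    fix i assume i: "i \<in> I"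
    show "hom_induced (n + 1) ?CM' M (cyl Y) ?aY (\<lambda>x. (F i x, snd x)) y = \<one>\<^bsub>?H\<^esub>"
    \<comment> \<open>Naturality turns the boundary of the image of \<open>y\<close> into the image
      of \<open>z\<close>, which is trivial by \<open>z_F\<close>; injectivity of the boundary map
      over \<open>Y\<close> lifts this to the relative class.\<close>
    proof (rule hom_boundary_away_eq_one)
      show "hom_boundary (n + 1) (cyl Y) ?aY (hom_induced (n + 1) ?CM' M (cyl Y) ?aY (\<lambda>x. (F i x, snd x)) y)
          = \<one>\<^bsub>homology_group (n + 1 - 1) (subtopology (cyl Y) ?aY)\<^esub>"
        using fun_cong[OF naturality_hom_induced[OF cont[OF i] im[OF i], of "n + 1"], of y] z_F[OF i] y(2)
        by (simp only: o_apply CM add_diff_cancel_right')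
    qed (rule hom_induced_carrier)
  qed
  then show ?thesis
    using y(2) hom_one[OF hom_boundary_hom group_relative_homology_group group_relative_homology_group, of "n + 1" ?CM' M]
    by (simp add: CM)
qed

section \<open>Powers of the punctured space\<close>

definition punctured_power :: "nat \<Rightarrow> (nat \<Rightarrow> real ^ 'd::finite) topology" where
  "punctured_power n = product_topology (\<lambda>_. top_of_set (- {0})) {..<n}"

lemma continuous_map_punctured_power:
  "continuous_map X (punctured_power n) f \<longleftrightarrow>
     (\<forall>x\<in>topspace X. f x \<in> extensional {..<n} \<and> (\<forall>k<n. f x k \<noteq> 0)) \<and>
     (\<forall>k<n. continuous_map X euclidean (\<lambda>x. f x k))"
  unfolding punctured_power_def continuous_map_componentwise continuous_map_in_subtopology
  by (auto simp: image_subset_iff)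

lemma topspace_punctured_power:
  "topspace (punctured_power n) = {y \<in> extensional {..<n}. \<forall>k<n. y k \<noteq> 0}"
  by (auto simp: punctured_power_def PiE_def Pi_iff)

text \<open>The normal coordinate of the Thom isomorphism becomes the last factor of the next power.
  The homology of powers is computed through this identification, and it is also how a removed form
  is appended to a tuple.\<close>

lemma homeomorphic_map_append_punctured:
  "homeomorphic_map (subtopology (cyl (punctured_power n)) (away (punctured_power n) UNIV))
     (punctured_power (Suc n)) (\<lambda>(y, v :: real ^ 'd::finite). y(n := v))"
proof (rule homeomorphic_maps_imp_map)
  let ?Y = "punctured_power n :: (nat \<Rightarrow> real ^ 'd) topology"
  let ?Y' = "punctured_power (Suc n) :: (nat \<Rightarrow> real ^ 'd) topology"
  let ?C = "subtopology (cyl ?Y) (away ?Y UNIV) :: ((nat \<Rightarrow> real ^ 'd) \<times> (real ^ 'd)) topology"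
  have "continuous_map ?Y euclidean (\<lambda>y. y k)" if "k < n" for k
    using continuous_map_id[of ?Y] that unfolding continuous_map_punctured_power by simp
  then have y: "continuous_map ?C euclidean (\<lambda>x. fst x k)" if "k < n" for k
    using that by (intro continuous_map_compose[OF continuous_map_subtopology_fst, unfolded o_def])
  have "continuous_map ?C ?Y' (\<lambda>(y, v). y(n := v))"
    unfolding continuous_map_punctured_power
  proof (intro conjI ballI allI impI)
    show "continuous_map ?C euclidean (\<lambda>x. (case x of (y, v) \<Rightarrow> y(n := v)) k)" if "k < Suc n" for k
      using that y[of k] by (cases "k = n") (auto simp: case_prod_unfold continuous_map_subtopology_snd)
  qed (auto simp: away_UNIV topspace_punctured_power extensional_def less_Suc_eq split: if_splits)
  moreover have "continuous_map ?Y' ?C (\<lambda>y. (restrict y {..<n}, y n))"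
  proof (rule continuous_map_into_subtopology)
    have "continuous_map ?Y' euclidean (\<lambda>y. y k)" if "k < Suc n" for k
      using continuous_map_id[of ?Y'] that unfolding continuous_map_punctured_power by simp
    moreover from this have "continuous_map ?Y' ?Y (\<lambda>y. restrict y {..<n})"
      unfolding continuous_map_punctured_power by (auto simp: topspace_punctured_power)
    ultimately show "continuous_map ?Y' (cyl ?Y) (\<lambda>y. (restrict y {..<n}, y n))"
      by (intro continuous_map_pairedI) auto
  qed (auto simp: away_UNIV topspace_punctured_power)
  ultimately show "homeomorphic_maps ?C ?Y' (\<lambda>(y, v). y(n := v)) (\<lambda>y. (restrict y {..<n}, y n))"
    unfolding homeomorphic_maps_def
    by (auto simp: away_UNIV topspace_punctured_power extensional_def fun_eq_iff)
qed

section \<open>The homology of the powers in and above the top degree\<close>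

lemma exact_seq_trivial_middle:
  assumes "exact_seq ([C, B, A], [g, f])" "trivial_group A" "trivial_group C"
  shows "trivial_group B"
proof -
  have "group B" "f \<in> hom A B" "group A" "g \<in> hom B C"
    using assms(1) by (auto simp: group_hom_def group_hom_axioms_def)
  moreover from this have "f \<one>\<^bsub>A\<^esub> = \<one>\<^bsub>B\<^esub>"
    by (metis hom_one assms(1) exact_seq_image_eq_kernel)
  moreover have "f ` carrier A = carrier B"
    using exact_seq_image_eq_kernel[OF assms(1)] assms(3) \<open>g \<in> hom B C\<close>
    by (auto simp: kernel_def trivial_group_def hom_def Pi_iff)
  ultimately show ?thesis
    using assms(2) by (simp add: trivial_group_def)
qed

lemma trivial_group_if_isomorphic:
  assumes "trivial_group H" "G \<cong> H" "group G" "group H"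
  shows "trivial_group G"
  using isomorphic_group_triviality[OF assms(2-4)] assms(1) by simp

context
  assumes d: "CARD('d::finite) \<ge> 2"
begin

text \<open>Exactness places the homology of the next power between two groups of the present one,
  in degree \<open>p\<close> and, after the Thom shift, in degree \<open>p + 1 - d\<close>. Both
  degrees are still above \<open>(d - 1) n\<close>.\<close>

lemma trivial_homology_punctured_power:
  "p > (int CARD('d) - 1) * int n \<Longrightarrow>
     trivial_group (homology_group p (punctured_power n :: (nat \<Rightarrow> real ^ 'd) topology))"
proof (induction n arbitrary: p)
  case 0
  have "topspace (punctured_power 0 :: (nat \<Rightarrow> real ^ 'd) topology) = {\<lambda>_. undefined}"
    by (auto simp: topspace_punctured_power)
  then show ?case
    using 0 by (intro homology_dimension_axiom) auto
next
  case (Suc n)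
  let ?Y = "punctured_power n :: (nat \<Rightarrow> real ^ 'd) topology"
  let ?A = "away ?Y UNIV :: ((nat \<Rightarrow> real ^ 'd) \<times> (real ^ 'd)) set"
  have "(int CARD('d) - 1) * int (Suc n) = (int CARD('d) - 1) * int n + (int CARD('d) - 1)"
    by (simp add: algebra_simps)
  then have p: "p + 1 - int CARD('d) > (int CARD('d) - 1) * int n" "p > (int CARD('d) - 1) * int n"
    using Suc.prems d by linarith+
  have "relative_homology_group (p + 1 - int CARD('d) + int (card (UNIV :: 'd set))) (cyl ?Y) ?A
        \<cong> homology_group (p + 1 - int CARD('d)) ?Y"
    by (rule isomorphic_homology_away)
  then have iso: "relative_homology_group (p + 1) (cyl ?Y) ?A \<cong> homology_group (p + 1 - int CARD('d)) ?Y"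
    by simp
  have 1: "trivial_group (relative_homology_group (p + 1) (cyl ?Y) ?A)"
    by (rule trivial_group_if_isomorphic[OF Suc.IH[OF p(1)] iso]) simp_all
  have 2: "trivial_group (homology_group (p + 1 - 1) (cyl ?Y :: ((nat \<Rightarrow> real ^ 'd) \<times> (real ^ 'd)) topology))"
    unfolding add_diff_cancel_right'
    by (rule trivial_group_if_isomorphic[OF Suc.IH[OF p(2)] is_isoI[OF iso_homology_cyl]]) simp_all
  have "trivial_group (homology_group (p + 1 - 1) (subtopology (cyl ?Y) ?A))"
    by (rule exact_seq_trivial_middle[OF homology_exactness_axiom_2 1 2])
  then have "trivial_group (homology_group p (subtopology (cyl ?Y) ?A))"
    by simp
  then show ?case
    by (rule trivial_group_if_isomorphic[OF _ group.iso_sym[OF group_relative_homology_group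
          is_isoI[OF homeomorphic_map_homology_iso[OF homeomorphic_map_append_punctured]]]]) simp_all
qed

text \<open>In degree \<open>(d - 1) (n + 1)\<close> the cylinder over the \<open>n\<close>-th power
  has no homology, because \<open>d \<ge> 2\<close> puts this degree above \<open>(d - 1) n\<close>.
  So the boundary map is onto; it is injective as well, and the Thom shift leads down to degree
  \<open>(d - 1) n\<close>.\<close>

lemma homology_punctured_power:
  "homology_group ((int CARD('d) - 1) * int n) (punctured_power n :: (nat \<Rightarrow> real ^ 'd) topology) \<cong> integer_group"
proof (induction n)
  case 0
  have "topspace (punctured_power 0 :: (nat \<Rightarrow> real ^ 'd) topology) = {\<lambda>_. undefined}"
    by (auto simp: topspace_punctured_power)
  then show ?case
    using homology_coefficients by simp
next
  case (Suc n)
  let ?Y = "punctured_power n :: (nat \<Rightarrow> real ^ 'd) topology"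
  let ?A = "away ?Y UNIV :: ((nat \<Rightarrow> real ^ 'd) \<times> (real ^ 'd)) set"
  define p where "p = (int CARD('d) - 1) * int (Suc n)"
  have p': "p + 1 = (int CARD('d) - 1) * int n + int (card (UNIV :: 'd set))"
    by (simp add: p_def algebra_simps)
  then have "trivial_group (homology_group p ?Y)"
    using d by (intro trivial_homology_punctured_power) linarith
  from this is_isoI[OF iso_homology_cyl]
  have triv: "trivial_group (homology_group (p + 1 - 1) (cyl ?Y :: ((nat \<Rightarrow> real ^ 'd) \<times> (real ^ 'd)) topology))"
    unfolding add_diff_cancel_right' by (rule trivial_group_if_isomorphic) simp_all
  let ?R = "relative_homology_group (p + 1) (cyl ?Y) ?A" and ?B = "homology_group (p + 1 - 1) (subtopology (cyl ?Y) ?A)"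
  let ?d = "hom_boundary (p + 1) (cyl ?Y) ?A"
  interpret d: group_hom ?R ?B ?d
    by (simp only: group_hom_def group_hom_axioms_def hom_boundary_hom group_relative_homology_group simp_thms)
  have "?d ` carrier ?R = carrier ?B"
    unfolding exact_seq_image_eq_kernel[OF homology_exactness_axiom_2]
    using triv hom_induced_carrier by (fastforce simp: kernel_def trivial_group_def)
  moreover have "inj_on ?d (carrier ?R)"
    using hom_boundary_away_eq_one by (intro d.inj_on_one_iff[THEN iffD2]) blast
  ultimately have iso: "?d \<in> iso ?R ?B"
    unfolding iso_iff using d.homh by blast
  have "homology_group p (punctured_power (Suc n) :: (nat \<Rightarrow> real ^ 'd) topology) \<cong> homology_group p (subtopology (cyl ?Y) ?A)"
    by (rule group.iso_sym[OF group_relative_homology_group is_isoI[OF homeomorphic_map_homology_iso[OF homeomorphic_map_append_punctured]]])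
  also have "\<dots> \<cong> ?R"
    using group.iso_sym[OF d.G.is_group is_isoI[OF iso]] by (simp only: add_diff_cancel_right')
  also have "\<dots> \<cong> homology_group ((int CARD('d) - 1) * int n) ?Y"
    unfolding p' by (rule isomorphic_homology_away)
  also have "\<dots> \<cong> integer_group"
    by (fact Suc.IH)
  finally show ?case
    by (simp only: p_def)
qed

end

section \<open>Arrangement complements\<close>

definition combination :: "'e set \<Rightarrow> ('e \<Rightarrow> real) \<Rightarrow> ('e \<Rightarrow> real ^ 'd) \<Rightarrow> real ^ 'd::finite" where
  "combination E c x = (\<Sum>e\<in>E. c e *\<^sub>R x e)"

abbreviation tuples :: "'e set \<Rightarrow> ('e \<Rightarrow> real ^ 'd::finite) topology" where
  "tuples E \<equiv> product_topology (\<lambda>_. euclidean) E"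

text \<open>The arrangement is a set of coefficient functions rather than of subspaces. Proportional
  forms may occur together, and a form that is zero on \<open>E\<close>, as restriction can produce,
  makes the space empty.\<close>

definition arrangement_complement ::
    "'e set \<Rightarrow> ('e \<Rightarrow> real) set \<Rightarrow> ('e \<Rightarrow> real ^ 'd::finite) topology" where
  "arrangement_complement E A = subtopology (tuples E) {x. \<forall>c\<in>A. combination E c x \<noteq> 0}"

definition combinations ::
    "'e set \<Rightarrow> nat \<Rightarrow> (nat \<Rightarrow> 'e \<Rightarrow> real) \<Rightarrow> ('e \<Rightarrow> real ^ 'd) \<Rightarrow> nat \<Rightarrow> real ^ 'd::finite" where
  "combinations E n \<tau> x = (\<lambda>k\<in>{..<n}. combination E (\<tau> k) x)"

lemma continuous_map_combination:
  assumes "finite E"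
  shows "continuous_map (tuples E) euclidean (combination E c)"
  unfolding combination_def[abs_def] using assms
  by (intro continuous_map_sum continuous_map_scaleR continuous_map_product_projection) auto

lemma continuous_map_combinations:
  assumes "finite E" "\<And>k. k < n \<Longrightarrow> \<tau> k \<in> A"
  shows "continuous_map (arrangement_complement E A) (punctured_power n) (combinations E n \<tau>)"
  unfolding continuous_map_punctured_power arrangement_complement_def combinations_def[abs_def]
  using assms by (simp add: continuous_map_from_subtopology[OF continuous_map_combination])

lemma topspace_arrangement_complement:
  "topspace (arrangement_complement E A) = {x \<in> extensional E. \<forall>c\<in>A. combination E c x \<noteq> 0}"
  by (auto simp: arrangement_complement_def PiE_def)

text \<open>On a contractible space the identity is homotopic to a constant map, which factors
  through the one-point space \<open>Y\<close>. This serves the empty arrangement, where the zeroth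
  power is the only space available for detection.\<close>

lemma homology_contractible_eq_one:
  assumes X: "contractible_space X" and e: "continuous_map X Y e" "topspace Y = {b}"
    and z: "z \<in> carrier (homology_group p X)" and "hom_induced p X {} Y {} e z = \<one>\<^bsub>homology_group p Y\<^esub>"
  shows "z = \<one>\<^bsub>homology_group p X\<^esub>"
proof (cases "topspace X = {}")
  case True
  then show ?thesis
    using trivial_homology_group_empty[of X p] z by (simp add: trivial_group_def)
next
  case False
  then obtain a where a: "a \<in> topspace X"
    by blast
  then have hom: "homotopic_with (\<lambda>x. True) X X id (\<lambda>x. a)"
    using X by (simp add: contractible_space_alt)
  have "z = hom_induced p X {} X {} id z"
    using z by (simp add: hom_induced_id)
  also have "\<dots> = hom_induced p X {} X {} ((\<lambda>_. a) \<circ> e) z"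
    using homology_homotopy_empty[OF hom, of p] by (simp add: o_def)
  also have "\<dots> = hom_induced p Y {} X {} (\<lambda>_. a) (hom_induced p X {} Y {} e z)"
  proof -
    have "continuous_map Y X (\<lambda>_. a)"
      using a by simp
    from hom_induced_compose_empty[OF e(1) this] show ?thesis
      by (simp only: o_apply)
  qed
  also have "\<dots> = \<one>\<^bsub>homology_group p X\<^esub>"
    unfolding assms(5) by (rule hom_one[OF hom_induced_hom]) simp_all
  finally show ?thesis .
qed

lemma contractible_space_tuples: "contractible_space (tuples E :: ('e \<Rightarrow> real ^ 'd::finite) topology)"
proof -
  have "contractible (UNIV :: (real ^ 'd) set)"
    by (simp add: convex_imp_contractible)
  then have "contractible_space (euclidean :: (real ^ 'd) topology)"
    using contractible_space_top_of_set[of "UNIV :: (real ^ 'd) set"] by simp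
  then show ?thesis
    by (simp add: contractible_space_product_topology)
qed

text \<open>Coordinates adapted to the removed subspace: the value of the form \<open>a\<close> replaces the entry at \<open>e0\<close>,
  and \<open>slice e0 a c\<close> is the restriction of the form \<open>c\<close> to the kernel of \<open>a\<close>.\<close>

definition slice :: "'e \<Rightarrow> ('e \<Rightarrow> real) \<Rightarrow> ('e \<Rightarrow> real) \<Rightarrow> 'e \<Rightarrow> real" where
  "slice e0 a c = (\<lambda>e. c e - c e0 / a e0 * a e)"

text \<open>The entry at \<open>e0\<close> is recovered by solving the equation that the form
  \<open>a\<close> takes the value \<open>v\<close>.\<close>

definition unslice :: "'e set \<Rightarrow> 'e \<Rightarrow> ('e \<Rightarrow> real) \<Rightarrow> ('e \<Rightarrow> real ^ 'd) \<times> (real ^ 'd) \<Rightarrow> 'e \<Rightarrow> real ^ 'd::finite" where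
  "unslice E e0 a = (\<lambda>(h, v). \<lambda>e\<in>E. if e = e0 then (v - combination (E - {e0}) a h) /\<^sub>R a e0 else h e)"

context
  fixes E :: "'e set" and e0 :: 'e and a :: "'e \<Rightarrow> real"
  assumes E: "finite E" and e0: "e0 \<in> E" and a: "a e0 \<noteq> 0"
begin

text \<open>Subtracting from \<open>c\<close> the multiple of \<open>a\<close> with the same
  coefficient at \<open>e0\<close> eliminates that entry. In the new coordinates every form is thus
  its restriction plus a multiple of the normal coordinate, and \<open>a\<close> is the normal
  coordinate itself.\<close>

lemma combination_unslice:
  "combination E c (unslice E e0 a (h, v)) = combination (E - {e0}) (slice e0 a c) h + (c e0 / a e0) *\<^sub>R v"
proof -
  let ?E0 = "E - {e0}"
  have "combination E c (unslice E e0 a (h, v)) = c e0 *\<^sub>R ((v - combination ?E0 a h) /\<^sub>R a e0) + combination ?E0 c h"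
    unfolding combination_def[of E] using E e0
    by (auto simp: sum.remove[of E e0] unslice_def combination_def[of ?E0 c] intro!: sum.cong)
  also have "combination ?E0 c h = combination ?E0 (slice e0 a c) h + (c e0 / a e0) *\<^sub>R combination ?E0 a h"
    by (simp add: combination_def slice_def scaleR_diff_left sum_subtractf scaleR_sum_right)
  finally show ?thesis
    by (simp add: scaleR_diff_right divide_inverse)
qed

lemma combination_slice:
  assumes "x \<in> extensional E"
  shows "unslice E e0 a (restrict x (E - {e0}), combination E a x) = x"
proof
  fix e
  have "combination E a x = a e0 *\<^sub>R x e0 + combination (E - {e0}) a (restrict x (E - {e0}))"
    using E e0 by (simp add: combination_def sum.remove[of E e0])
  then show "unslice E e0 a (restrict x (E - {e0}), combination E a x) e = x e"
    using a assms by (auto simp: unslice_def extensional_def)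
qed

lemma continuous_map_unslice: "continuous_map (cyl (tuples (E - {e0}))) (tuples E) (unslice E e0 a)"
  unfolding continuous_map_componentwise
proof (intro conjI ballI)
  let ?C = "cyl (tuples (E - {e0})) :: (('e \<Rightarrow> real ^ 'd) \<times> (real ^ 'd)) topology"
  fix e assume e: "e \<in> E"
  show "continuous_map ?C euclidean (\<lambda>x. unslice E e0 a x e)"
  proof (cases "e = e0")
    case True
    have "continuous_map ?C euclidean (\<lambda>x. combination (E - {e0}) a (fst x))"
      using E by (intro continuous_map_compose[OF continuous_map_fst continuous_map_combination, unfolded o_def]) auto
    then have "continuous_map ?C euclidean (\<lambda>x. inverse (a e0) *\<^sub>R (snd x - combination (E - {e0}) a (fst x)))"
      by (intro continuous_map_scaleR continuous_map_diff continuous_map_snd) simp_all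
    then show ?thesis
      using True e0 by (simp add: unslice_def case_prod_unfold)
  next
    case False
    then have "continuous_map ?C euclidean (\<lambda>x. fst x e)"
      using e by (intro continuous_map_compose[OF continuous_map_fst continuous_map_product_projection, unfolded o_def]) auto
    then show ?thesis
      using False e by (simp add: unslice_def case_prod_unfold)
  qed
qed (auto simp: unslice_def)

lemma continuous_map_slice:
  "continuous_map (tuples E) (cyl (tuples (E - {e0}))) (\<lambda>x. (restrict x (E - {e0}), combination E a x))"
proof (intro continuous_map_pairedI continuous_map_combination E)
  show "continuous_map (tuples E) (tuples (E - {e0})) (\<lambda>x. restrict x (E - {e0}))"
    unfolding continuous_map_componentwise by (auto intro: continuous_map_product_projection)
qed

end

text \<open>The induction is on the number of forms with \<open>E\<close> and \<open>n\<close>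
  arbitrary: the deletion keeps both, while the restriction drops an index from \<open>E\<close> and
  lowers \<open>n\<close> by one. Tuples may repeat forms, so nothing has to be known about linear
  dependence among them.\<close>

lemma jointly_inj_combinations:
  fixes E :: "'e set"
  assumes d: "CARD('d::finite) \<ge> 2" and "finite E" "finite A"
  shows "jointly_inj
    (homology_group ((int CARD('d) - 1) * int n) (arrangement_complement E A :: ('e \<Rightarrow> real ^ 'd) topology))
    (homology_group ((int CARD('d) - 1) * int n) (punctured_power n)) ({..<n} \<rightarrow> A)
    (\<lambda>\<tau>. hom_induced ((int CARD('d) - 1) * int n) (arrangement_complement E A) {} (punctured_power n) {}
      (combinations E n \<tau>))"
  using assms(2,3)
proof (induction "card A" arbitrary: E A n rule: less_induct)
  case less
  let ?M = "\<lambda>E A. arrangement_complement E A :: ('e \<Rightarrow> real ^ 'd) topology"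
  let ?Y = "\<lambda>n. punctured_power n :: (nat \<Rightarrow> real ^ 'd) topology"
  define q where "q n = (int CARD('d) - 1) * int n" for n
  show ?case
    unfolding jointly_inj_def q_def[symmetric]
  proof (intro ballI impI)
    fix z assume z: "z \<in> carrier (homology_group (q n) (?M E A))"
      and z1: "\<forall>\<tau>\<in>{..<n} \<rightarrow> A. hom_induced (q n) (?M E A) {} (?Y n) {} (combinations E n \<tau>) z
                = \<one>\<^bsub>homology_group (q n) (?Y n)\<^esub>"
    \<comment> \<open>The last case provides a pivot: a form and an index at which its coefficient
      can be divided by. If there are forms but no pivot, all of them are zero on \<open>E\<close>
      and the complement is empty.\<close>
    consider "A = {}" | c where "c \<in> A" "\<forall>e\<in>E. c e = 0" | a e0 where "a \<in> A" "e0 \<in> E" "a e0 \<noteq> 0"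
      by blast
    then show "z = \<one>\<^bsub>homology_group (q n) (?M E A)\<^esub>"
    proof cases
      case 1
      let ?pt = "discrete_topology {()}"
      have M: "?M E A = tuples E"
        using 1 by (simp add: arrangement_complement_def)
      have cM: "contractible_space (?M E A)"
        unfolding M by (rule contractible_space_tuples)
      have Y0: "topspace (?Y 0) = {\<lambda>_. undefined}"
        by (auto simp: topspace_punctured_power)
      have e: "continuous_map (?M E A) (?Y 0) (combinations E 0 \<tau>)" for \<tau>
        by (rule continuous_map_combinations) (use less.prems in auto)
      \<comment> \<open>For \<open>n = 0\<close> this is the hypothesis itself, as any function is a
        tuple over the empty index set. For \<open>n > 0\<close> the degree is nonzero because
        \<open>d \<ge> 2\<close>, and a point has no homology there.\<close>
      have "hom_induced (q n) (?M E A) {} (?Y 0) {} (combinations E 0 (\<lambda>_ _. 0)) z = \<one>\<^bsub>homology_group (q n) (?Y 0)\<^esub>"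
      proof (cases "n = 0")
        case True
        then show ?thesis
          using z1 by auto
      next
        case False
        then have "q n \<noteq> 0"
          using d by (simp add: q_def)
        then have "trivial_group (homology_group (q n) (?Y 0))"
          by (rule homology_dimension_axiom[OF Y0])
        then show ?thesis
          using hom_induced_carrier[of "q n" "?M E A" "{}" "?Y 0" "{}" "combinations E 0 (\<lambda>_ _. 0)" z]
          by (simp add: trivial_group_def)
      qed
      then show ?thesis
        by (rule homology_contractible_eq_one[OF cM e Y0 z])
    next
      case 2
      then have "combination E c x = 0" for x :: "'e \<Rightarrow> real ^ 'd"
        by (simp add: combination_def)
      then have "topspace (?M E A) = {}"
        using 2 by (auto simp: topspace_arrangement_complement)
      then show ?thesis
        using trivial_homology_group_empty[of "?M E A" "q n"] z by (simp add: trivial_group_def)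
    next
      case 3
      define A' where "A' = A - {a}"
      have A': "finite A'" "card A' < card A" "A' \<subseteq> A" "A = insert a A'"
        using less.prems 3 card_Diff1_less[of A a] by (auto simp: A'_def)
      define E0 where "E0 = E - {e0}"
      have E0: "finite E0"
        using less.prems by (simp add: E0_def)
      \<comment> \<open>Distinct forms may restrict to the same form, and multiples of
        \<open>a\<close> restrict to zero. The induction hypothesis covers both, since it asks only
        for a finite set with fewer elements.\<close>
      define A'' where "A'' = slice e0 a ` A'"
      have A'': "finite A''" "card A'' < card A"
        using A' card_image_le[of A' "slice e0 a"] by (auto simp: A''_def)
      let ?X = "tuples E0 :: ('e \<Rightarrow> real ^ 'd) topology"
      let ?C = "cyl ?X :: (('e \<Rightarrow> real ^ 'd) \<times> (real ^ 'd)) topology"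
      define f where "f = (\<lambda>c h. combination E0 (slice e0 a c) h :: real ^ 'd)"
      define b where "b = (\<lambda>c. c e0 / a e0)"
      note E3 = less.prems(1) 3(2) 3(3)
      have comb: "combination E c (unslice E e0 a (h, v)) = f c h + b c *\<^sub>R v" for c h v
        unfolding f_def b_def E0_def by (rule combination_unslice[where E = E and ?e0.0 = e0 and a = a, OF E3])
      have fa: "f a h = 0" "b a = 1" for h
        using 3 by (simp_all add: f_def b_def slice_def combination_def)
      \<comment> \<open>\<open>M'\<close> and \<open>M\<close> are the complements of \<open>A'\<close> and \<open>A\<close> in the new coordinates, \<open>M0\<close> is that of the
        restricted arrangement, and \<open>N\<close> is a neighbourhood of \<open>M0\<close> in \<open>M'\<close> on which every form can be
        deformed to its restriction without vanishing.\<close>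
      define M' where "M' = {x \<in> topspace ?C. \<forall>c\<in>A'. f c (fst x) + b c *\<^sub>R snd x \<noteq> 0}"
      define N where "N = {x \<in> topspace ?C. \<forall>c\<in>A'. norm (b c *\<^sub>R snd x) < norm (f c (fst x))}"
      define M0 where "M0 = {h \<in> topspace ?X. \<forall>c\<in>A'. f c h \<noteq> 0}"
      define M where "M = M' \<inter> (UNIV \<times> - {0})"
      let ?\<Psi> = "\<lambda>x :: 'e \<Rightarrow> real ^ 'd. (restrict x E0, combination E a x)"
      have cf: "continuous_map ?X euclidean (f c)" for c
        unfolding f_def by (rule continuous_map_combination[OF E0])
      have cf': "continuous_map ?C euclidean (\<lambda>x. f c (fst x))" for c
        by (rule continuous_map_compose[OF continuous_map_fst cf, unfolded o_def])
      have cb: "continuous_map ?C euclidean (\<lambda>x. b c *\<^sub>R snd x)" for c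
        by (intro continuous_map_scaleR continuous_map_snd) simp
      have M'_open: "openin ?C M'"
      proof -
        have "openin ?C {x \<in> topspace ?C. f c (fst x) + b c *\<^sub>R snd x \<in> - {0}}" for c
          by (rule openin_continuous_map_preimage[OF continuous_map_add[OF cf' cb]]) (simp add: open_Compl)
        note * = this
        have M'_eq: "M' = (\<Inter>c\<in>A'. {x \<in> topspace ?C. f c (fst x) + b c *\<^sub>R snd x \<in> - {0}}) \<inter> topspace ?C"
          unfolding M'_def by blast
        show ?thesis
          unfolding M'_eq by (rule openin_INT[OF A'(1) *])
      qed
      have N_open: "openin ?C N"
      proof -
        have "openin ?C {x \<in> topspace ?C. norm (f c (fst x)) - norm (b c *\<^sub>R snd x) \<in> {0<..}}" for c
          by (rule openin_continuous_map_preimage[OF continuous_map_diff[OF continuous_map_norm[OF cf'] continuous_map_norm[OF cb]]]) auto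
        note * = this
        have N_eq: "N = (\<Inter>c\<in>A'. {x \<in> topspace ?C. norm (f c (fst x)) - norm (b c *\<^sub>R snd x) \<in> {0<..}}) \<inter> topspace ?C"
          unfolding N_def by auto
        show ?thesis
          unfolding N_eq by (rule openin_INT[OF A'(1) *])
      qed
      \<comment> \<open>The strict norm inequality in \<open>N\<close> prevents cancellation on the
        whole segment from the form at \<open>t = 0\<close> to its restriction at
        \<open>t = 1\<close>. The two ends give the inclusions of \<open>N\<close> in
        \<open>M'\<close> and in the cylinder over \<open>M0\<close>.\<close>
      have N_line: "f c h + (1 - t) *\<^sub>R b c *\<^sub>R v \<noteq> 0" if "(h, v) \<in> N" "c \<in> A'" "0 \<le> t" "t \<le> 1" for c h v t
      proof
        assume "f c h + (1 - t) *\<^sub>R b c *\<^sub>R v = 0"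
        then have "norm (f c h) = norm ((1 - t) *\<^sub>R b c *\<^sub>R v)"
          by (metis add_eq_0_iff norm_minus_cancel)
        also have "\<dots> \<le> norm (b c *\<^sub>R v)"
          using that by (simp add: abs_mult mult.assoc mult_left_le_one_le)
        finally show False
          using that by (auto simp: N_def)
      qed
      have N_sub: "N \<subseteq> M'" "N \<subseteq> M0 \<times> UNIV"
      proof -
        show "N \<subseteq> M'"
          using N_line[where t = 0] by (auto simp: M'_def N_def)
        show "N \<subseteq> M0 \<times> UNIV"
          using N_line[where t = 1] by (auto simp: M0_def N_def)
      qed
      have M0_sub: "M0 \<subseteq> topspace ?X" "\<And>x. (x, 0) \<in> M' \<Longrightarrow> (x, 0) \<in> N" "\<And>x. x \<in> M0 \<Longrightarrow> (x, 0) \<in> N"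
        by (auto simp: M0_def M'_def N_def)
      have "M0 = topspace ?X \<inter> {x. \<forall>c\<in>A''. combination E0 c x \<noteq> 0}"
        by (auto simp: M0_def A''_def f_def)
      then have X0: "subtopology ?X M0 = ?M E0 A''"
        unfolding arrangement_complement_def by (simp only: subtopology_restrict)
      have \<Psi>: "continuous_map (tuples E) ?C ?\<Psi>"
        unfolding E0_def by (rule continuous_map_slice[where E = E and ?e0.0 = e0 and a = a, OF E3])
      have \<Phi>\<Psi>: "unslice E e0 a (?\<Psi> x) = x" if "x \<in> extensional E" for x
        unfolding E0_def using combination_slice[where E = E and ?e0.0 = e0 and a = a, OF E3 that] .
      have \<Psi>': "continuous_map (?M E A') (subtopology ?C M') ?\<Psi>"
      proof (rule continuous_map_into_subtopology)
        show "continuous_map (?M E A') ?C ?\<Psi>"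
          unfolding arrangement_complement_def by (rule continuous_map_from_subtopology[OF \<Psi>])
        show "?\<Psi> \<in> topspace (?M E A') \<rightarrow> M'"
        proof
          fix x assume x: "x \<in> topspace (?M E A')"
          then have "combination E c (unslice E e0 a (?\<Psi> x)) \<noteq> 0" if "c \<in> A'" for c
            using that by (simp add: \<Phi>\<Psi> topspace_arrangement_complement)
          then show "?\<Psi> x \<in> M'"
            by (simp add: M'_def comb PiE_def)
        qed
      qed
      have AA': "arrangement_complement E A = subtopology (?M E A') {x. combination E a x \<noteq> 0}"
        unfolding arrangement_complement_def subtopology_subtopology A'(4)
        by (rule arg_cong[where f = "subtopology (tuples E)"]) auto
      have \<Psi>'': "continuous_map (?M E A) (subtopology ?C M) ?\<Psi>"
      proof (rule continuous_map_into_subtopology)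
        show "continuous_map (?M E A) ?C ?\<Psi>"
          unfolding arrangement_complement_def by (rule continuous_map_from_subtopology[OF \<Psi>])
        have "?\<Psi> x \<in> M'" if "x \<in> topspace (?M E A)" for x
          using that continuous_map_funspace[OF \<Psi>'] A'(4) by (auto simp: Pi_iff topspace_arrangement_complement)
        then show "?\<Psi> \<in> topspace (?M E A) \<rightarrow> M"
          using 3 by (auto simp: M_def topspace_arrangement_complement)
      qed
      have \<Phi>: "continuous_map (subtopology ?C M) (?M E A) (unslice E e0 a)"
        unfolding arrangement_complement_def
      proof (rule continuous_map_into_subtopology)
        show "continuous_map (subtopology ?C M) (tuples E) (unslice E e0 a)"
          unfolding E0_def by (rule continuous_map_from_subtopology[OF continuous_map_unslice[where E = E and ?e0.0 = e0 and a = a, OF E3]])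
        show "unslice E e0 a \<in> topspace (subtopology ?C M) \<rightarrow> {x. \<forall>c\<in>A. combination E c x \<noteq> 0}"
          unfolding A'(4) by (auto simp: M_def M'_def comb fa)
      qed
      define z' where "z' = hom_induced (q n) (?M E A) {} (subtopology ?C M) {} ?\<Psi> z"
      have z': "z' \<in> carrier (homology_group (q n) (subtopology ?C M))"
        unfolding z'_def by (rule hom_induced_carrier)
      have inclA: "continuous_map (?M E A) (?M E A') id" "continuous_map (subtopology ?C M) (subtopology ?C M') id"
        unfolding AA' by (auto simp: M_def intro!: continuous_map_from_subtopology_mono[OF continuous_map_id])
      have cA': "continuous_map (?M E A') (?Y n) (combinations E n \<tau>)" if "\<tau> \<in> {..<n} \<rightarrow> A'" for \<tau>
        using that less.prems by (intro continuous_map_combinations) auto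
      \<comment> \<open>The tuples with all entries in \<open>A'\<close> are already defined on the
        larger complement, so the hypothesis on \<open>z\<close> passes to its image there and the
        induction hypothesis for \<open>A'\<close> applies.\<close>
      have "hom_induced (q n) (?M E A) {} (?M E A') {} id z = \<one>\<^bsub>homology_group (q n) (?M E A')\<^esub>"
      proof (rule jointly_injD[OF less.hyps[OF A'(2) less.prems(1) A'(1), of n, folded q_def]])
        fix \<tau> assume \<tau>: "\<tau> \<in> {..<n} \<rightarrow> A'"
        have "hom_induced (q n) (?M E A') {} (?Y n) {} (combinations E n \<tau>) (hom_induced (q n) (?M E A) {} (?M E A') {} id z)
            = hom_induced (q n) (?M E A) {} (?Y n) {} (combinations E n \<tau> \<circ> id) z"
          by (rule hom_induced_compose'[OF inclA(1) _ cA'[OF \<tau>]]) simp_all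
        also have "\<dots> = \<one>\<^bsub>homology_group (q n) (?Y n)\<^esub>"
          unfolding comp_id using \<tau> A'(3) by (intro z1[rule_format]) blast
        finally show "hom_induced (q n) (?M E A') {} (?Y n) {} (combinations E n \<tau>) (hom_induced (q n) (?M E A) {} (?M E A') {} id z)
            = \<one>\<^bsub>homology_group (q n) (?Y n)\<^esub>" .
      qed (rule hom_induced_carrier)
      moreover have "hom_induced (q n) (subtopology ?C M) {} (subtopology ?C M') {} id z'
          = hom_induced (q n) (?M E A') {} (subtopology ?C M') {} ?\<Psi> (hom_induced (q n) (?M E A) {} (?M E A') {} id z)"
        unfolding z'_def by (rule hom_induced_square) (simp_all add: \<Psi>' \<Psi>'' inclA)
      ultimately have z'_incl: "hom_induced (q n) (subtopology ?C M) {} (subtopology ?C M') {} id z'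
          = \<one>\<^bsub>homology_group (q n) (subtopology ?C M')\<^esub>"
        using hom_one[OF hom_induced_hom] by simp
      have "z' = \<one>\<^bsub>homology_group (q n) (subtopology ?C M)\<^esub>"
      proof (cases n)
        case 0
        \<comment> \<open>For \<open>n = 0\<close> the degree \<open>1 - d\<close> is negative, so
          the homology of the restricted complement vanishes there and the empty family is jointly
          injective.\<close>
        have "trivial_group (homology_group (q n + 1 - int CARD('d)) (subtopology ?X M0))"
          using d 0 by (intro trivial_relative_homology_group) (simp add: q_def)
        then have inj: "jointly_inj (homology_group (q n + 1 - int CARD('d)) (subtopology ?X M0))
            (homology_group (q n + 1 - int CARD('d)) (?Y 0)) ({} :: nat set)
            (\<lambda>i. hom_induced (q n + 1 - int CARD('d)) (subtopology ?X M0) {} (?Y 0) {} ((\<lambda>_ _ _. 0) i))"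
          by (simp add: jointly_inj_def trivial_group_def)
        show ?thesis
          unfolding M_def
          by (rule deletion_step[where F = "\<lambda>_ _ _. 0", OF M'_open N_open N_sub M0_sub(1) _ _ _ _ _ inj
                z'[unfolded M_def] z'_incl[unfolded M_def]])
            (fact M0_sub | erule emptyE)+
      next
        case (Suc m)
        \<comment> \<open>\<open>F \<sigma>\<close> evaluates the tuple \<open>\<sigma>\<close> in
          the new coordinates and \<open>g \<sigma>\<close> evaluates its restriction. The homotopy
          \<open>Fg\<close> between them scales the contribution of the normal coordinate down to
          zero.\<close>
        define F where "F = (\<lambda>\<sigma> x. \<lambda>k\<in>{..<m}. f (\<sigma> k) (fst x) + b (\<sigma> k) *\<^sub>R snd x)"
        define g where "g = (\<lambda>\<sigma>. combinations E0 m (\<lambda>k. slice e0 a (\<sigma> k)) :: _ \<Rightarrow> nat \<Rightarrow> real ^ 'd)"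
        have qm: "q n + 1 - int CARD('d) = q m"
          by (simp add: q_def Suc algebra_simps)
        have cg: "continuous_map (subtopology ?X M0) (?Y m) (g \<sigma>)" if "\<sigma> \<in> {..<m} \<rightarrow> A'" for \<sigma>
          unfolding X0 g_def using that E0 by (intro continuous_map_combinations) (auto simp: A''_def)
        have cF: "continuous_map (subtopology ?C M') (?Y m) (F \<sigma>)" if "\<sigma> \<in> {..<m} \<rightarrow> A'" for \<sigma>
          unfolding continuous_map_punctured_power
        proof (intro conjI ballI allI impI)
          show "continuous_map (subtopology ?C M') euclidean (\<lambda>x. F \<sigma> x k)" if "k < m" for k
            using that by (simp add: F_def continuous_map_from_subtopology continuous_map_add[OF cf' cb])
        qed (use that in \<open>auto simp: F_def M'_def Pi_iff\<close>)
        have Fg: "homotopic_with (\<lambda>h. True) (subtopology ?C N) (?Y m) (F \<sigma>) (g \<sigma> \<circ> fst)" if \<sigma>: "\<sigma> \<in> {..<m} \<rightarrow> A'" for \<sigma>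
        proof -
          let ?Q = "prod_topology (top_of_set {0..1::real}) (subtopology ?C N)"
          let ?h = "\<lambda>(t::real, x). \<lambda>k\<in>{..<m}. f (\<sigma> k) (fst x) + (1 - t) *\<^sub>R b (\<sigma> k) *\<^sub>R snd x"
          have "continuous_map ?Q (?Y m) ?h"
            unfolding continuous_map_punctured_power
          proof (intro conjI ballI allI impI)
            have t: "continuous_map ?Q euclideanreal fst"
              by (rule continuous_map_into_fulltopology[OF continuous_map_fst])
            have cQ: "continuous_map ?Q euclidean (\<lambda>x. f c (fst (snd x)))" "continuous_map ?Q euclidean (\<lambda>x. b c *\<^sub>R snd (snd x))" for c
              by (rule continuous_map_compose[OF continuous_map_snd continuous_map_from_subtopology[OF cf'], unfolded o_def],
                  rule continuous_map_compose[OF continuous_map_snd continuous_map_from_subtopology[OF cb], unfolded o_def])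
            have "continuous_map ?Q euclidean (\<lambda>x. f c (fst (snd x)) + (1 - fst x) *\<^sub>R b c *\<^sub>R snd (snd x))" for c
              by (rule continuous_map_add[OF cQ(1) continuous_map_scaleR[OF continuous_map_diff[OF _ t] cQ(2)]]) simp
            then show "continuous_map ?Q euclidean (\<lambda>x. ?h x k)" if "k < m" for k
              using that by (simp add: case_prod_unfold)
            show "?h x k \<noteq> 0" if "k < m" "x \<in> topspace ?Q" for x k
              using that \<sigma> N_line[of "fst (snd x)" "snd (snd x)" "\<sigma> k" "fst x"] by (auto simp: case_prod_unfold Pi_iff)
          qed auto
          then show ?thesis
            unfolding homotopic_with_def
            by (intro exI[of _ ?h]) (auto simp: F_def g_def combinations_def f_def fun_eq_iff)
        qed
        have inj: "jointly_inj (homology_group (q n + 1 - int CARD('d)) (subtopology ?X M0))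
            (homology_group (q n + 1 - int CARD('d)) (?Y m)) ({..<m} \<rightarrow> A')
            (\<lambda>\<sigma>. hom_induced (q n + 1 - int CARD('d)) (subtopology ?X M0) {} (?Y m) {} (g \<sigma>))"
          unfolding jointly_inj_def qm X0
        proof (intro ballI impI)
          fix w assume w: "w \<in> carrier (homology_group (q m) (?M E0 A''))"
            and w1: "\<forall>\<sigma>\<in>{..<m} \<rightarrow> A'. hom_induced (q m) (?M E0 A'') {} (?Y m) {} (g \<sigma>) w = \<one>\<^bsub>homology_group (q m) (?Y m)\<^esub>"
          show "w = \<one>\<^bsub>homology_group (q m) (?M E0 A'')\<^esub>"
          proof (rule jointly_injD[OF less.hyps[OF A''(2) E0 A''(1), of m, folded q_def] w])
            fix \<tau> assume \<tau>: "\<tau> \<in> {..<m} \<rightarrow> A''"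
            \<comment> \<open>A tuple of restricted forms lifts entry by entry to a tuple from
              \<open>A'\<close>. The choice of lift is immaterial because \<open>g\<close> sees only
              the restrictions.\<close>
            then have "\<forall>k\<in>{..<m}. \<exists>c\<in>A'. \<tau> k = slice e0 a c"
              by (auto simp: A''_def Pi_iff image_iff)
            then obtain \<sigma> where \<sigma>: "\<forall>k\<in>{..<m}. \<sigma> k \<in> A' \<and> \<tau> k = slice e0 a (\<sigma> k)"
              by metis
            then have "combinations E0 m \<tau> = (g \<sigma> :: _ \<Rightarrow> nat \<Rightarrow> real ^ 'd)"
              unfolding g_def combinations_def[abs_def] by (intro ext[of _ "\<lambda>x. restrict (F x) {..<m}" for F] restrict_ext) simp
            then show "hom_induced (q m) (?M E0 A'') {} (?Y m) {} (combinations E0 m \<tau>) w = \<one>\<^bsub>homology_group (q m) (?Y m)\<^esub>"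
              using w1 \<sigma> by simp
          qed
        qed
        let ?D = "subtopology (cyl (?Y m)) (away (?Y m) UNIV) :: ((nat \<Rightarrow> real ^ 'd) \<times> (real ^ 'd)) topology"
        have zF: "hom_induced (q n) (subtopology ?C M) {} ?D {} (\<lambda>x. (F \<sigma> x, snd x)) z' = \<one>\<^bsub>homology_group (q n) ?D\<^esub>"
          if \<sigma>: "\<sigma> \<in> {..<m} \<rightarrow> A'" for \<sigma>
        proof -
          let ?\<psi> = "\<lambda>(y, v :: real ^ 'd). y(m := v)"
          \<comment> \<open>The removed form is appended as the last entry. Its value is the normal
            coordinate, so the map with components \<open>F \<sigma>\<close> and \<open>snd\<close>
            is \<open>combinations E n \<tau>\<close> up to the homeomorphism that appends a
            factor.\<close>
          define \<tau> where "\<tau> = \<sigma>(m := a)"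
          have \<tau>: "\<tau> \<in> {..<n} \<rightarrow> A"
            using \<sigma> A'(3) 3(1) by (auto simp: \<tau>_def Suc less_Suc_eq Pi_iff subset_iff)
          have \<psi>: "homeomorphic_map ?D (?Y n) ?\<psi>"
            unfolding Suc by (rule homeomorphic_map_append_punctured)
          have FD: "continuous_map (subtopology ?C M) ?D (\<lambda>x. (F \<sigma> x, snd x))"
          proof (rule continuous_map_into_subtopology)
            have "continuous_map (subtopology ?C M) (?Y m) (F \<sigma>)"
              using continuous_map_compose[OF inclA(2) cF[OF \<sigma>]] by (simp only: comp_id)
            then show "continuous_map (subtopology ?C M) (cyl (?Y m)) (\<lambda>x. (F \<sigma> x, snd x))"
              by (rule continuous_map_pairedI[OF _ continuous_map_subtopology_snd])
            show "(\<lambda>x. (F \<sigma> x, snd x)) \<in> topspace (subtopology ?C M) \<rightarrow> away (?Y m) UNIV"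
              using continuous_map_funspace[OF cF[OF \<sigma>]] by (auto simp: away_UNIV M_def Pi_iff)
          qed
          have *: "?\<psi> ((\<lambda>x. (F \<sigma> x, snd x)) (?\<Psi> x)) = combinations E n \<tau> x" if "x \<in> topspace (?M E A)" for x
          proof -
            have x: "x \<in> extensional E"
              using that by (simp add: topspace_arrangement_complement)
            show ?thesis
            proof
              fix k
              show "?\<psi> ((\<lambda>x. (F \<sigma> x, snd x)) (?\<Psi> x)) k = combinations E n \<tau> x k"
                using comb[of "\<sigma> k" "restrict x E0" "combination E a x"] \<Phi>\<Psi>[OF x]
                by (auto simp: F_def combinations_def \<tau>_def Suc)
            qed
          qed
          have "hom_induced (q n) ?D {} (?Y n) {} ?\<psi>
              (hom_induced (q n) (subtopology ?C M) {} ?D {} (\<lambda>x. (F \<sigma> x, snd x)) z')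
            = hom_induced (q n) ?D {} (?Y n) {} ?\<psi>
              (hom_induced (q n) (?M E A) {} ?D {} ((\<lambda>x. (F \<sigma> x, snd x)) \<circ> ?\<Psi>) z)"
            unfolding z'_def by (subst hom_induced_compose'[OF \<Psi>'' _ FD]) simp_all
          also have "\<dots> = hom_induced (q n) (?M E A) {} (?Y n) {} (?\<psi> \<circ> ((\<lambda>x. (F \<sigma> x, snd x)) \<circ> ?\<Psi>)) z"
            by (rule hom_induced_compose'[OF continuous_map_compose[OF \<Psi>'' FD] _ homeomorphic_imp_continuous_map[OF \<psi>]]) simp_all
          also have "\<dots> = hom_induced (q n) (?M E A) {} (?Y n) {} (combinations E n \<tau>) z"
          proof -
            have "hom_induced (q n) (?M E A) {} (?Y n) {} (?\<psi> \<circ> ((\<lambda>x. (F \<sigma> x, snd x)) \<circ> ?\<Psi>))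
                = hom_induced (q n) (?M E A) {} (?Y n) {} (combinations E n \<tau>)"
              by (rule hom_induced_eq) (simp only: o_apply *)
            then show ?thesis
              by (rule fun_cong)
          qed
          also have "\<dots> = \<one>\<^bsub>homology_group (q n) (?Y n)\<^esub>"
            using z1 \<tau> by blast
          finally show "hom_induced (q n) (subtopology ?C M) {} ?D {} (\<lambda>x. (F \<sigma> x, snd x)) z' = \<one>\<^bsub>homology_group (q n) ?D\<^esub>"
            by (rule iso_eq_one_iff[OF group_relative_homology_group group_relative_homology_group
                  homeomorphic_map_homology_iso[OF \<psi>] hom_induced_carrier, THEN iffD1])
        qed
        show ?thesis
          unfolding M_def
          by (rule deletion_step[where F = F, OF M'_open N_open N_sub M0_sub(1) _ _ _ _ _ inj
                z'[unfolded M_def] z'_incl[unfolded M_def]])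
            (fact M0_sub cF cg Fg zF[unfolded M_def])+
      qed
      moreover have "z = hom_induced (q n) (subtopology ?C M) {} (?M E A) {} (unslice E e0 a) z'"
      proof -
        \<comment> \<open>\<open>unslice\<close> is a left inverse of the coordinate map on
          extensional tuples, so \<open>z\<close> can be recovered from \<open>z'\<close>.\<close>
        have "z = hom_induced (q n) (?M E A) {} (?M E A) {} (unslice E e0 a \<circ> ?\<Psi>) z"
        proof (rule hom_induced_id_gen[OF continuous_map_compose[OF \<Psi>'' \<Phi>] _ z, symmetric])
          show "(unslice E e0 a \<circ> ?\<Psi>) x = x" if "x \<in> topspace (?M E A)" for x
            using that \<Phi>\<Psi>[of x] by (simp add: topspace_arrangement_complement)
        qed
        also have "\<dots> = hom_induced (q n) (subtopology ?C M) {} (?M E A) {} (unslice E e0 a) z'"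
          unfolding z'_def by (rule hom_induced_compose'[OF \<Psi>'' _ \<Phi>, symmetric]) simp_all
        finally show ?thesis .
      qed
      ultimately show ?thesis
        using hom_one[OF hom_induced_hom] by simp
    qed
  qed
qed

section \<open>Rational cocycles and homology\<close>

text \<open>Subgroups and homomorphisms are expressed through differences, on the chains themselves;
  sums and integer multiples follow. Restricting a homomorphism to a smaller subgroup then leaves
  the function unchanged.\<close>

definition frag_subgroup :: "('b \<Rightarrow>\<^sub>0 int) set \<Rightarrow> bool" where
  "frag_subgroup Z \<longleftrightarrow> 0 \<in> Z \<and> (\<forall>x\<in>Z. \<forall>y\<in>Z. x - y \<in> Z)"

definition additive_on :: "('b \<Rightarrow>\<^sub>0 int) set \<Rightarrow> (('b \<Rightarrow>\<^sub>0 int) \<Rightarrow> rat) \<Rightarrow> bool" where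
  "additive_on Z f \<longleftrightarrow> (\<forall>x\<in>Z. \<forall>y\<in>Z. f (x - y) = f x - f y)"

lemma frag_subgroupD:
  assumes "frag_subgroup Z"
  shows "0 \<in> Z" "\<And>x y. x \<in> Z \<Longrightarrow> y \<in> Z \<Longrightarrow> x - y \<in> Z" "\<And>x. x \<in> Z \<Longrightarrow> - x \<in> Z"
    "\<And>x y. x \<in> Z \<Longrightarrow> y \<in> Z \<Longrightarrow> x + y \<in> Z" "\<And>x. x \<in> Z \<Longrightarrow> frag_cmul n x \<in> Z"
proof -
  show 0: "0 \<in> Z" and d: "\<And>x y. x \<in> Z \<Longrightarrow> y \<in> Z \<Longrightarrow> x - y \<in> Z"
    using assms by (auto simp: frag_subgroup_def)
  show m: "- x \<in> Z" if "x \<in> Z" for x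
    using d[OF 0 that] by simp
  show p: "x + y \<in> Z" if "x \<in> Z" "y \<in> Z" for x y
    using d[OF that(1) m[OF that(2)]] by simp
  show "frag_cmul n x \<in> Z" if "x \<in> Z" for x
  proof (induction n rule: int_induct[where k = 0])
    case (step1 i)
    then show ?case
      using p[OF step1(2) that] by (simp add: frag_cmul_distrib)
  next
    case (step2 i)
    then show ?case
      using d[OF step2(2) that] frag_cmul_distrib[of "i - 1" 1 x] by (simp add: eq_diff_eq[symmetric])
  qed (simp add: 0)
qed

lemma additive_onD:
  assumes "frag_subgroup Z" "additive_on Z f"
  shows "f 0 = 0" "\<And>x y. x \<in> Z \<Longrightarrow> y \<in> Z \<Longrightarrow> f (x - y) = f x - f y"
    "\<And>x y. x \<in> Z \<Longrightarrow> y \<in> Z \<Longrightarrow> f (x + y) = f x + f y"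
    "\<And>x. x \<in> Z \<Longrightarrow> f (frag_cmul n x) = of_int n * f x"
proof -
  show d: "f (x - y) = f x - f y" if "x \<in> Z" "y \<in> Z" for x y
    using assms that by (simp add: additive_on_def)
  show 0: "f 0 = 0"
    using d[OF frag_subgroupD(1) frag_subgroupD(1), OF assms(1) assms(1)] by simp
  show p: "f (x + y) = f x + f y" if "x \<in> Z" "y \<in> Z" for x y
    using d[OF frag_subgroupD(4)[OF assms(1) that] that(2)] by simp
  show "f (frag_cmul n x) = of_int n * f x" if x: "x \<in> Z" for x
  proof (induction n rule: int_induct[where k = 0])
    case (step1 i)
    then show ?case
      using p[OF frag_subgroupD(5)[OF assms(1) x] x, of i] by (simp add: frag_cmul_distrib algebra_simps)
  next
    case (step2 i)
    have "frag_cmul (i - 1) x = frag_cmul i x - x"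
      using frag_cmul_distrib[of "i - 1" 1 x] by simp
    then show ?case
      using step2 d[OF frag_subgroupD(5)[OF assms(1) x] x, of i] by (simp add: left_diff_distrib)
  qed (simp add: 0)
qed

text \<open>The rational numbers are an injective abelian group. A partial homomorphism is encoded by its
  graph, a subgroup of the product on which the first coordinate determines the second.\<close>

lemma rat_additive_extension:
  fixes f :: "('b \<Rightarrow>\<^sub>0 int) \<Rightarrow> rat"
  assumes Z: "frag_subgroup Z" and f: "additive_on Z f"
  obtains g where "additive_on UNIV g" "\<And>x. x \<in> Z \<Longrightarrow> g x = f x"
proof -
  define graph where "graph G \<longleftrightarrow> (\<forall>x r y s. (x, r) \<in> G \<longrightarrow> (y, s) \<in> G \<longrightarrow> (x - y, r - s) \<in> G) \<and> (\<forall>r. (0, r) \<in> G \<longrightarrow> r = 0)"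
    for G :: "(('b \<Rightarrow>\<^sub>0 int) \<times> rat) set"
  define G0 where "G0 = (\<lambda>x. (x, f x)) ` Z"
  let ?\<A> = "{G. graph G \<and> G0 \<subseteq> G}"
  have G0: "graph G0"
    using frag_subgroupD[OF Z] additive_onD[OF Z f] by (auto simp: graph_def G0_def image_iff)
  have chain: "\<Union>\<C> \<in> ?\<A>" if \<C>: "\<C> \<noteq> {}" "subset.chain ?\<A> \<C>" for \<C>
  proof -
    have gr: "graph G" "G0 \<subseteq> G" if "G \<in> \<C>" for G
      using \<C> that by (auto simp: subset.chain_def)
    have "(x - y, r - s) \<in> \<Union>\<C>" if xr: "(x, r) \<in> G" "G \<in> \<C>" and ys: "(y, s) \<in> G'" "G' \<in> \<C>" for x y r s G G'
    proof -
      have "G \<subseteq> G' \<or> G' \<subseteq> G"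
        using \<C>(2) xr(2) ys(2) unfolding subset_chain_def by blast
      then obtain H where "H \<in> \<C>" "(x, r) \<in> H" "(y, s) \<in> H"
        using xr ys by blast
      then show ?thesis
        using gr(1)[of H] unfolding graph_def by blast
    qed
    moreover have "r = 0" if "(0, r) \<in> G" "G \<in> \<C>" for r G
      using gr(1)[OF that(2)] that(1) unfolding graph_def by blast
    ultimately have "graph (\<Union>\<C>)"
      unfolding graph_def by blast
    then show ?thesis
      using \<C>(1) gr(2) by blast
  qed
  have "\<exists>G\<in>?\<A>. \<forall>H\<in>?\<A>. G \<subseteq> H \<longrightarrow> H = G"
    by (rule subset_Zorn_nonempty[OF _ chain]) (use G0 in blast)+
  then obtain G where "G \<in> ?\<A>" "\<forall>H\<in>?\<A>. G \<subseteq> H \<longrightarrow> H = G"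
    by blast
  then have G: "graph G" "G0 \<subseteq> G" and max: "\<And>H. graph H \<Longrightarrow> G \<subseteq> H \<Longrightarrow> H = G"
    by auto
  have G_diff: "(x - y, r - s) \<in> G" if "(x, r) \<in> G" "(y, s) \<in> G" for x y r s
    using G(1) that unfolding graph_def by blast
  have G_0: "(0, 0) \<in> G"
    using G(2) additive_onD(1)[OF Z f] frag_subgroupD(1)[OF Z] by (auto simp: G0_def image_iff)
  have G_zero: "r = 0" if "(0, r) \<in> G" for r
    using G(1) that unfolding graph_def by blast
  have G_unique: "r = s" if "(x, r) \<in> G" "(x, s) \<in> G" for x r s
    using G_diff[OF that] G_zero[of "r - s"] by simp
  have G_add: "(x + y, r + s) \<in> G" if "(x, r) \<in> G" "(y, s) \<in> G" for x y r s
    using G_diff[OF that(1) G_diff[OF G_0 that(2)]] by simp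
  have G_cmul: "(frag_cmul n x, of_int n * r) \<in> G" if x: "(x, r) \<in> G" for n x r
  proof (induction n rule: int_induct[where k = 0])
    case (step1 i)
    then show ?case
      using G_add[OF step1(2) x] by (simp add: frag_cmul_distrib algebra_simps)
  next
    case (step2 i)
    have "frag_cmul (i - 1) x = frag_cmul i x - x"
      using frag_cmul_distrib[of "i - 1" 1 x] by simp
    then show ?case
      using G_diff[OF step2(2) x] by (simp add: left_diff_distrib)
  qed (simp add: G_0)
  have total: "\<exists>r. (a, r) \<in> G" for a
  proof -
    \<comment> \<open>This is where divisibility enters: a value \<open>s\<close> at a nonzero
      multiple \<open>m\<close> of \<open>a\<close> forces the value \<open>s / m\<close> at
      \<open>a\<close>. If no nonzero multiple of \<open>a\<close> has a value, \<open>0\<close> is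
      taken.\<close>
    obtain q where q: "\<And>n r. (frag_cmul n a, r) \<in> G \<Longrightarrow> r = of_int n * q"
    proof (cases "\<exists>n r. n \<noteq> 0 \<and> (frag_cmul n a, r) \<in> G")
      case True
      then obtain m s where m: "m \<noteq> 0" "(frag_cmul m a, s) \<in> G"
        by blast
      have "r = of_int n * (s / of_int m)" if "(frag_cmul n a, r) \<in> G" for n r
      proof -
        have "of_int m * r = of_int n * s"
          using G_cmul[OF that, of m] G_cmul[OF m(2), of n] by (intro G_unique) (auto simp: mult.commute)
        then show ?thesis
          using m(1) by (simp add: field_simps)
      qed
      then show ?thesis
        using that by blast
    next
      case False
      then have "r = of_int n * 0" if "(frag_cmul n a, r) \<in> G" for n r
        using that G_zero by (cases "n = 0") auto
      then show ?thesis
        using that by blast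
    qed
    \<comment> \<open>The graph generated by \<open>G\<close> and the point with coordinates
      \<open>a\<close> and \<open>q\<close>. It is again a graph, so maximality of \<open>G\<close>
      shows that \<open>a\<close> already has a value.\<close>
    define H where "H = {(x + frag_cmul n a, r + of_int n * q) |x n r. (x, r) \<in> G}"
    have H_I: "(y, s) \<in> H" if "(y - frag_cmul n a, s - of_int n * q) \<in> G" for y s n
    proof -
      have "(y, s) = (y - frag_cmul n a + frag_cmul n a, s - of_int n * q + of_int n * q)"
        by simp
      then show ?thesis
        using that unfolding H_def by blast
    qed
    have "graph H"
      unfolding graph_def
    proof (intro conjI allI impI)
      fix y s y' s' assume "(y, s) \<in> H" "(y', s') \<in> H"
      then obtain x n r x' n' r' where *: "y = x + frag_cmul n a" "s = r + of_int n * q" "(x, r) \<in> G"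
        "y' = x' + frag_cmul n' a" "s' = r' + of_int n' * q" "(x', r') \<in> G"
        unfolding H_def by blast
      have "y - y' - frag_cmul (n - n') a = x - x'"
        using frag_cmul_distrib[of "n - n'" n' a] by (simp add: *)
      moreover have "s - s' - of_int (n - n') * q = r - r'"
        by (simp add: * algebra_simps)
      ultimately show "(y - y', s - s') \<in> H"
        using G_diff[OF *(3) *(6)] by (intro H_I[where n = "n - n'"]) simp
    next
      fix s assume "(0, s) \<in> H"
      then obtain x n r where *: "0 = x + frag_cmul n a" "s = r + of_int n * q" "(x, r) \<in> G"
        unfolding H_def by blast
      have "(frag_cmul n a, - r) \<in> G"
        using G_diff[OF G_0 *(3)] minus_unique[OF *(1)[symmetric]] by simp
      then show "s = 0"
        using q *(2) by fastforce
    qed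
    moreover have "G \<subseteq> H"
      using H_I[where n = 0] by auto
    ultimately have "H = G"
      by (rule max)
    moreover have "(a, q) \<in> H"
      using G_0 by (intro H_I[where n = 1]) simp
    ultimately show ?thesis
      by blast
  qed
  define g where "g x = (SOME r. (x, r) \<in> G)" for x
  have g: "(x, g x) \<in> G" for x
    unfolding g_def using total by (rule someI_ex)
  show thesis
  proof
    show "additive_on UNIV g"
      unfolding additive_on_def using G_unique[OF g G_diff[OF g g]] by blast
    show "g x = f x" if "x \<in> Z" for x
      using that G(2) by (intro G_unique[OF g]) (auto simp: G0_def)
  qed
qed

text \<open>The linear algebra fact that a functional vanishing on a common kernel is a combination
  of the given ones, over a subgroup in place of a vector space. In the induction one functional
  \<open>f t\<close> is set aside, the rest is solved on its kernel, and the remainder is a rational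
  multiple of \<open>f t\<close>.\<close>

lemma linear_combination_of_common_kernel:
  fixes c :: "('b \<Rightarrow>\<^sub>0 int) \<Rightarrow> rat"
  assumes "finite T" "frag_subgroup Z" "additive_on Z c" "\<And>t. t \<in> T \<Longrightarrow> additive_on Z (f t)"
    and "\<And>z. z \<in> Z \<Longrightarrow> (\<And>t. t \<in> T \<Longrightarrow> f t z = 0) \<Longrightarrow> c z = 0"
  shows "\<exists>r. \<forall>z\<in>Z. c z = (\<Sum>t\<in>T. r t * f t z)"
  using assms
proof (induction T arbitrary: Z rule: finite_induct)
  case empty
  then show ?case
    by simp
next
  case (insert t T)
  define Z' where "Z' = {z \<in> Z. f t z = 0}"
  note Z = insert.prems(1)
  note ft = additive_onD[OF Z insert.prems(3)[of t]]
  have Z': "frag_subgroup Z'"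
    using frag_subgroupD[OF Z] ft by (auto simp: Z'_def frag_subgroup_def)
  have Z'_on: "additive_on Z' h" if "additive_on Z h" for h
    using that by (auto simp: Z'_def additive_on_def)
  have "\<exists>r. \<forall>z\<in>Z'. c z = (\<Sum>t\<in>T. r t * f t z)"
  proof (rule insert.IH[OF Z'])
    show "additive_on Z' c" "\<And>s. s \<in> T \<Longrightarrow> additive_on Z' (f s)"
      using insert.prems(2,3) by (auto intro: Z'_on)
    show "c z = 0" if "z \<in> Z'" "\<And>s. s \<in> T \<Longrightarrow> f s z = 0" for z
      using that by (intro insert.prems(4)) (auto simp: Z'_def)
  qed
  then obtain r where r: "\<forall>z\<in>Z'. c z = (\<Sum>t\<in>T. r t * f t z)"
    by blast
  define c' where "c' z = c z - (\<Sum>t\<in>T. r t * f t z)" for z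
  have c': "additive_on Z c'"
    using insert.prems(2,3)
    by (simp add: additive_on_def c'_def sum_subtractf right_diff_distrib)
  have c'0: "c' z = 0" if "z \<in> Z'" for z
    using r that by (simp add: c'_def)
  obtain q where q: "\<forall>z\<in>Z. c' z = q * f t z"
  proof (cases "\<forall>z\<in>Z. f t z = 0")
    case True
    then show ?thesis
      using c'0 that[of 0] by (auto simp: Z'_def)
  next
    case False
    then obtain z0 where z0: "z0 \<in> Z" "f t z0 \<noteq> 0"
      by blast
    have "c' z = c' z0 / f t z0 * f t z" if z: "z \<in> Z" for z
    proof -
      \<comment> \<open>The ratio of two values of \<open>f t\<close> is rational, so an integer
        combination of \<open>z\<close> and \<open>z0\<close> lies in the kernel of
        \<open>f t\<close>, where \<open>c'\<close> vanishes.\<close>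
      obtain m n where mn: "f t z / f t z0 = Fract m n" "n > 0"
        using Rat_cases by metis
      then have mn': "of_int n * f t z = of_int m * f t z0"
        using z0(2) by (simp add: Fract_of_int_quotient field_simps)
      let ?y = "frag_cmul n z - frag_cmul m z0"
      have "?y \<in> Z'"
        using mn' z z0 frag_subgroupD[OF Z] ft by (simp add: Z'_def)
      then have "of_int n * c' z = of_int m * c' z0"
        using c'0[of ?y] z z0 frag_subgroupD[OF Z] additive_onD[OF Z c'] by simp
      then have "of_int n * (c' z * f t z0) = of_int n * (c' z0 * f t z)"
        using mn' by (metis mult.assoc mult.commute)
      then show ?thesis
        using mn(2) z0(2) by (simp add: field_simps)
    qed
    then show ?thesis
      using that by blast
  qed
  have "c z = (\<Sum>s\<in>insert t T. (r(t := q)) s * f s z)" if "z \<in> Z" for z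
  proof -
    have "(\<Sum>s\<in>T. (r(t := q)) s * f s z) = (\<Sum>s\<in>T. r s * f s z)"
      using insert.hyps by (intro sum.cong) auto
    then show ?thesis
      using q that insert.hyps by (simp add: c'_def algebra_simps)
  qed
  then show ?case
    by blast
qed

section \<open>Rational cochains on singular chains\<close>

lemma frag_subgroup_chains: "frag_subgroup (singular_chain_set p X)"
  by (simp add: frag_subgroup_def singular_chain_diff)

lemma frag_subgroup_cycles: "frag_subgroup (singular_relcycle_set p X {})"
  by (simp add: frag_subgroup_def singular_relcycle_diff)

lemma cochains_iff:
  "c \<in> cochains p X \<longleftrightarrow> additive_on (singular_chain_set p X) c \<and> c \<in> extensional (singular_chain_set p X)"
proof -
  let ?C = "singular_chain_set p X"
  have "additive_on ?C c" if c: "\<And>x y. x \<in> ?C \<Longrightarrow> y \<in> ?C \<Longrightarrow> c (x + y) = c x + c y"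
    unfolding additive_on_def
  proof (intro ballI)
    fix x y assume "x \<in> ?C" "y \<in> ?C"
    then show "c (x - y) = c x - c y"
      using c[of "x - y" y] by (simp add: singular_chain_diff)
  qed
  moreover have "c (x + y) = c x + c y" if "additive_on ?C c" "x \<in> ?C" "y \<in> ?C" for x y
    by (rule additive_onD(3)[OF frag_subgroup_chains that])
  ultimately show ?thesis
    by (auto simp: cochains_def hom_def rat_field_def)
qed

lemma cocycles_iff:
  "c \<in> cocycles p X \<longleftrightarrow> c \<in> cochains p X \<and> (\<forall>z. singular_chain (Suc p) X z \<longrightarrow> c (chain_boundary (Suc p) z) = 0)"
  by (auto simp: cocycles_def coboundary_def fun_eq_iff restrict_def)

lemma restrict_in_cochains:
  "additive_on (singular_chain_set p X) g \<Longrightarrow> restrict g (singular_chain_set p X) \<in> cochains p X"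
  by (simp add: cochains_iff additive_on_def singular_chain_diff)

text \<open>Such a cochain factors through the boundary map. The resulting homomorphism on
  boundaries extends to all chains of the degree below, as the rationals are injective, and the
  extension is a primitive. In degree zero every chain is a cycle, so the cochain is zero.\<close>

lemma coboundaries_if_zero_on_cycles:
  assumes c: "c \<in> cochains p X" and zero: "\<And>z. singular_relcycle p X {} z \<Longrightarrow> c z = 0"
  shows "c \<in> coboundaries p X"
proof (cases p)
  case 0
  then have "c z = 0" if "singular_chain p X z" for z
    using that by (intro zero) (simp add: singular_cycle chain_boundary_def)
  then have "c = (\<lambda>z\<in>singular_chain_set 0 X. 0)"
    using c 0 by (auto simp: cochains_iff extensional_def)
  then show ?thesis
    using 0 by simp
next
  case (Suc q)
  let ?C = "singular_chain_set p X" and ?D = "singular_chain_set q X"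
  have c_add: "c (x - y) = c x - c y" if "x \<in> ?C" "y \<in> ?C" for x y
    using c that by (simp add: cochains_iff additive_on_def)
  define B where "B = chain_boundary p ` ?C"
  \<comment> \<open>Independent of the chosen chain, since two chains with the same boundary differ
    by a cycle, on which \<open>c\<close> vanishes.\<close>
  define f where "f b = c (SOME z. z \<in> ?C \<and> chain_boundary p z = b)" for b
  have f: "f (chain_boundary p z) = c z" if z: "z \<in> ?C" for z
  proof -
    define y where "y = (SOME y. y \<in> ?C \<and> chain_boundary p y = chain_boundary p z)"
    have y: "y \<in> ?C \<and> chain_boundary p y = chain_boundary p z"
      unfolding y_def by (rule someI[of _ z]) (use z in simp)
    then have "c (y - z) = 0"
      using z by (intro zero) (simp add: singular_cycle singular_chain_diff chain_boundary_diff)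
    then show ?thesis
      using c_add[of y z] y z by (simp add: f_def y_def)
  qed
  have "frag_subgroup B"
    unfolding frag_subgroup_def
  proof (intro conjI ballI)
    show "0 \<in> B"
      unfolding B_def by (rule image_eqI[of _ _ 0]) simp_all
    show "x - y \<in> B" if xy: "x \<in> B" "y \<in> B" for x y
    proof -
      obtain x' y' where "x' \<in> ?C" "y' \<in> ?C" "x = chain_boundary p x'" "y = chain_boundary p y'"
        using xy by (auto simp: B_def)
      then show ?thesis
        unfolding B_def by (intro image_eqI[of _ _ "x' - y'"]) (simp_all add: singular_chain_diff chain_boundary_diff)
    qed
  qed
  moreover have "additive_on B f"
    unfolding additive_on_def B_def
    by (auto simp: f c_add singular_chain_diff simp flip: chain_boundary_diff)
  ultimately obtain g where g: "additive_on UNIV g" "\<And>x. x \<in> B \<Longrightarrow> g x = f x"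
    using rat_additive_extension by blast
  have "additive_on ?D g"
    using g(1) by (simp add: additive_on_def)
  then have g': "restrict g ?D \<in> cochains q X"
    by (rule restrict_in_cochains)
  have "coboundary q X (restrict g ?D) z = c z" for z
  proof (cases "z \<in> ?C")
    case True
    then show ?thesis
      using g(2)[of "chain_boundary p z"] f[OF True] Suc
      by (simp add: coboundary_def B_def singular_chain_boundary_alt)
  next
    case False
    then show ?thesis
      using c Suc by (simp add: coboundary_def cochains_iff extensional_def)
  qed
  then have "c = coboundary q X (restrict g ?D)"
    by (simp add: fun_eq_iff)
  then show ?thesis
    unfolding Suc using g' by (simp add: image_eqI)
qed

lemma homologous_rel_set_eq_one_iff:
  "homologous_rel_set p X {} z = \<one>\<^bsub>homology_group (int p) X\<^esub> \<longleftrightarrow> singular_relboundary p X {} z"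
  by (simp add: homologous_rel_set_eq_relboundary)

text \<open>The class of a cycle, read as an integer through the isomorphism, is additive on cycles
  and zero exactly on boundaries. Extending it to all chains gives a cochain, which is a cocycle
  because it vanishes on boundaries.\<close>

lemma obtain_detecting_cocycle:
  assumes "homology_group (int p) X \<cong> integer_group"
  obtains w where "w \<in> cocycles p X"
    "\<And>z. singular_relcycle p X {} z \<Longrightarrow> w z = 0 \<Longrightarrow> singular_relboundary p X {} z"
proof -
  let ?H = "homology_group (int p) X" and ?Z = "singular_relcycle_set p X {}" and ?C = "singular_chain_set p X"
  obtain h where h: "h \<in> iso ?H integer_group"
    using assms by (auto simp: is_iso_def)
  define cl where "cl = homologous_rel_set p X {}"
  define f where "f z = (of_int (h (cl z)) :: rat)" for z
  have clH: "cl z \<in> carrier ?H" if "z \<in> ?Z" for z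
    using that by (simp add: carrier_relative_homology_group cl_def)
  have "cl \<in> hom (relcycle_group p X {}) ?H"
    using normal.r_coset_hom_Mod[OF normal_subgroup_singular_relboundary_relcycle, of p X "{}"]
    by (simp add: nontrivial_relative_homology_group right_coset_singular_relboundary cl_def[abs_def])
  then have cl_add: "cl (x + y) = cl x \<otimes>\<^bsub>?H\<^esub> cl y" if "x \<in> ?Z" "y \<in> ?Z" for x y
    using that hom_mult by fastforce
  have "f (x - y) = f x - f y" if "x \<in> ?Z" "y \<in> ?Z" for x y
  proof -
    have "x - y \<in> ?Z"
      using that by (simp add: singular_relcycle_diff)
    then have "h (cl (x - y + y)) = h (cl (x - y)) + h (cl y)"
      using h clH that cl_add[of "x - y" y] by (simp add: Group.iso_def hom_def)
    then show ?thesis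
      by (simp add: f_def)
  qed
  then have "additive_on ?Z f"
    by (simp add: additive_on_def)
  then obtain g where g: "additive_on UNIV g" "\<And>x. x \<in> ?Z \<Longrightarrow> g x = f x"
    using rat_additive_extension[OF frag_subgroup_cycles] by blast
  have f0: "f z = 0 \<longleftrightarrow> singular_relboundary p X {} z" if "z \<in> ?Z" for z
    using iso_eq_one_iff[OF _ _ h clH[OF that]] homologous_rel_set_eq_one_iff[of p X z]
    by (simp add: f_def cl_def)
  show thesis
  proof
    have "additive_on ?C g"
      using g(1) by (simp add: additive_on_def)
    moreover have "restrict g ?C (chain_boundary (Suc p) z) = 0" if z: "singular_chain (Suc p) X z" for z
    proof -
      have "singular_relboundary p X {} (chain_boundary (Suc p) z)"
        using z by (auto simp: singular_boundary)
      then show ?thesis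
        using f0 g(2) singular_relboundary_imp_relcycle z by (fastforce simp: singular_chain_boundary_alt)
    qed
    ultimately show "restrict g ?C \<in> cocycles p X"
      unfolding cocycles_iff by (simp add: restrict_in_cochains)
    show "singular_relboundary p X {} z" if "singular_relcycle p X {} z" "restrict g ?C z = 0" for z
      using that f0[of z] g(2)[of z] by (simp add: singular_cycle)
  qed
qed

lemma cochain_pullback_in_cochains:
  assumes "continuous_map X Y g" "c \<in> cochains p Y"
  shows "cochain_pullback p X g c \<in> cochains p X"
  using assms singular_chain_chain_map[OF _ assms(1)]
  by (simp add: cochains_iff cochain_pullback_def additive_on_def singular_chain_diff chain_map_diff)

lemma cochain_pullback_in_cocycles:
  assumes "continuous_map X Y g" "c \<in> cocycles p Y"
  shows "cochain_pullback p X g c \<in> cocycles p X"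
proof -
  have "cochain_pullback p X g c (chain_boundary (Suc p) z) = 0" if z: "singular_chain (Suc p) X z" for z
    using z assms chain_boundary_chain_map[OF z, of g, symmetric] singular_chain_chain_map[OF z assms(1)]
    by (simp add: cochain_pullback_def singular_chain_boundary_alt cocycles_iff)
  then show ?thesis
    using assms by (simp add: cocycles_iff cochain_pullback_in_cochains)
qed

text \<open>If all pullbacks of \<open>w\<close> vanish on a cycle, its images in the power bound,
  because \<open>w\<close> detects; by joint injectivity the cycle bounds, and the cocycle
  \<open>c\<close> vanishes on it. Hence \<open>c\<close> is a combination of the pullbacks on
  cycles, and the difference, being zero on cycles, is a coboundary.\<close>

lemma cocycle_arrangement_eq:
  fixes E :: "'e set"
  assumes d: "CARD('d::finite) \<ge> 2" and fin: "finite E" "finite A" and p: "p = (CARD('d) - 1) * n"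
    and w: "w \<in> cocycles p (punctured_power n :: (nat \<Rightarrow> real ^ 'd) topology)"
      "\<And>z. singular_relcycle p (punctured_power n) {} z \<Longrightarrow> w z = 0 \<Longrightarrow> singular_relboundary p (punctured_power n) {} z"
    and c: "c \<in> cocycles p (arrangement_complement E A)"
  shows "\<exists>r. (\<lambda>z\<in>singular_chain_set p (arrangement_complement E A).
            c z - (\<Sum>\<tau>\<in>{..<n} \<rightarrow>\<^sub>E A. r \<tau> * cochain_pullback p (arrangement_complement E A) (combinations E n \<tau>) w z))
          \<in> coboundaries p (arrangement_complement E A)"
proof -
  let ?M = "arrangement_complement E A :: ('e \<Rightarrow> real ^ 'd) topology"
  let ?Y = "punctured_power n :: (nat \<Rightarrow> real ^ 'd) topology"
  let ?T = "{..<n} \<rightarrow>\<^sub>E A" and ?Z = "singular_relcycle_set p ?M {}" and ?C = "singular_chain_set p ?M"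
  let ?f = "\<lambda>\<tau>. cochain_pullback p ?M (combinations E n \<tau>) w"
  have p': "int p = (int CARD('d) - 1) * int n"
    using d by (simp add: p of_nat_diff)
  have cont: "continuous_map ?M ?Y (combinations E n \<tau>)" if "\<tau> \<in> {..<n} \<rightarrow> A" for \<tau>
    using that fin by (intro continuous_map_combinations) auto
  have f: "?f \<tau> \<in> cochains p ?M" if "\<tau> \<in> ?T" for \<tau>
    using that w(1) by (intro cochain_pullback_in_cochains[OF cont]) (auto simp: cocycles_iff)
  have add: "additive_on ?Z h" if "h \<in> cochains p ?M" for h
    using that by (simp add: cochains_iff additive_on_def singular_cycle)
  have vanish: "c z = 0" if z: "z \<in> ?Z" and f0: "\<And>\<tau>. \<tau> \<in> ?T \<Longrightarrow> ?f \<tau> z = 0" for z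
  proof -
    have "homologous_rel_set p ?M {} z = \<one>\<^bsub>homology_group (int p) ?M\<^esub>"
    proof (rule jointly_injD[OF jointly_inj_combinations[OF d fin, of n, folded p']])
      show "homologous_rel_set p ?M {} z \<in> carrier (homology_group (int p) ?M)"
        using z by (simp add: carrier_relative_homology_group)
      fix \<tau> assume \<tau>: "\<tau> \<in> {..<n} \<rightarrow> A"
      \<comment> \<open>Joint injectivity ranges over arbitrary functions, the linear combination
        over the finite set of extensional ones; restriction leaves the evaluation map
        unchanged.\<close>
      define \<tau>' where "\<tau>' = restrict \<tau> {..<n}"
      have \<tau>': "\<tau>' \<in> ?T" "combinations E n \<tau>' = (combinations E n \<tau> :: _ \<Rightarrow> nat \<Rightarrow> real ^ 'd)"
        using \<tau> by (auto simp: \<tau>'_def combinations_def[abs_def] fun_eq_iff)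
      have cyc: "singular_relcycle p ?Y {} (chain_map p (combinations E n \<tau>) z)"
        using z by (intro singular_relcycle_chain_map[OF _ cont[OF \<tau>]]) auto
      have "w (chain_map p (combinations E n \<tau>) z) = 0"
        using f0[OF \<tau>'(1)] z \<tau>'(2) by (simp add: cochain_pullback_def singular_cycle)
      then have "singular_relboundary p ?Y {} (chain_map p (combinations E n \<tau>) z)"
        using w(2) cyc by blast
      then show "hom_induced (int p) ?M {} ?Y {} (combinations E n \<tau>) (homologous_rel_set p ?M {} z)
          = \<one>\<^bsub>homology_group (int p) ?Y\<^esub>"
        using z by (subst hom_induced_chain_map[OF cont[OF \<tau>]]) (simp_all add: homologous_rel_set_eq_relboundary)
    qed
    then obtain y where "singular_chain (Suc p) ?M y" "chain_boundary (Suc p) y = z"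
      unfolding homologous_rel_set_eq_one_iff singular_boundary by blast
    then show ?thesis
      using c by (auto simp: cocycles_iff)
  qed
  have "\<exists>r. \<forall>z\<in>?Z. c z = (\<Sum>\<tau>\<in>?T. r \<tau> * ?f \<tau> z)"
  proof (rule linear_combination_of_common_kernel[OF _ frag_subgroup_cycles])
    show "finite ?T"
      using fin by (simp add: finite_PiE)
    show "additive_on ?Z c" "\<And>\<tau>. \<tau> \<in> ?T \<Longrightarrow> additive_on ?Z (?f \<tau>)"
      using c f by (auto simp: cocycles_iff intro: add)
  qed (fact vanish)
  then obtain r where r: "\<forall>z\<in>?Z. c z = (\<Sum>\<tau>\<in>?T. r \<tau> * ?f \<tau> z)"
    by blast
  let ?b = "\<lambda>z. c z - (\<Sum>\<tau>\<in>?T. r \<tau> * ?f \<tau> z)"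
  have "additive_on ?C ?b"
    using c f by (simp add: additive_on_def cocycles_iff cochains_iff sum_subtractf right_diff_distrib)
  then have "restrict ?b ?C \<in> cochains p ?M"
    by (rule restrict_in_cochains)
  then have "restrict ?b ?C \<in> coboundaries p ?M"
    using r by (intro coboundaries_if_zero_on_cycles) (auto simp: singular_cycle)
  then show ?thesis
    by blast
qed

section \<open>Cohomology as a quotient\<close>

lemma rat_field_simps [simp]:
  "carrier rat_field = UNIV" "a \<otimes>\<^bsub>rat_field\<^esub> b = a * b" "\<one>\<^bsub>rat_field\<^esub> = 1"
  "\<zero>\<^bsub>rat_field\<^esub> = 0" "a \<oplus>\<^bsub>rat_field\<^esub> b = a + b"
  by (simp_all add: rat_field_def)

lemma cring_rat_field: "cring rat_field"
proof (rule cringI)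
  show "abelian_group rat_field"
    by (rule abelian_groupI) (auto intro: exI[of _ "- x" for x])
  show "comm_monoid rat_field"
    by (rule comm_monoidI) auto
qed (simp add: distrib_right)

lemma quotient_space_simps:
  "carrier (quotient_space V W) = a_rcosets\<^bsub>V\<^esub> W" "\<zero>\<^bsub>quotient_space V W\<^esub> = W"
  "A \<oplus>\<^bsub>quotient_space V W\<^esub> B = A <+>\<^bsub>V\<^esub> B"
  "q \<odot>\<^bsub>quotient_space V W\<^esub> A = (\<Union>x\<in>A. W +>\<^bsub>V\<^esub> (q \<odot>\<^bsub>V\<^esub> x))"
  by (simp_all add: quotient_space_def)

locale rat_subspace = module rat_field V for V :: "(rat, 'v) module" (structure) +
  fixes W :: "'v set"
  assumes W_subset: "W \<subseteq> carrier V" and W_zero: "\<zero> \<in> W"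
    and W_add: "\<And>x y. x \<in> W \<Longrightarrow> y \<in> W \<Longrightarrow> x \<oplus> y \<in> W"
    and W_smult: "\<And>q x. x \<in> W \<Longrightarrow> q \<odot> x \<in> W"
begin

abbreviation Q where "Q \<equiv> quotient_space V W"

lemma smult_minus_one:
  assumes "x \<in> carrier V"
  shows "((-1) \<odot> x) \<oplus> x = \<zero>"
proof -
  have "((-1) \<odot> x) \<oplus> (1 \<odot> x) = (-1 + 1) \<odot> x"
    using smult_l_distr[of "-1" 1 x] assms by simp
  also have "\<dots> = \<zero>"
    using smult_l_null[OF assms] by simp
  finally show ?thesis
    using smult_one[OF assms] by simp
qed

lemma W_subgroup: "subgroup W (add_monoid V)"
proof
  fix x assume x: "x \<in> W"
  then have "x \<in> carrier V" "(-1) \<odot> x \<in> W"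
    using W_subset W_smult by auto
  moreover from this have "\<ominus> x = (-1) \<odot> x"
    using smult_minus_one W_subset by (intro minus_equality) auto
  ultimately show "inv\<^bsub>add_monoid V\<^esub> x \<in> W"
    by (simp add: a_inv_def)
qed (use W_subset W_zero W_add in auto)

sublocale W: abelian_subgroup W V
  using W_subgroup M.abelian_group_axioms by (intro abelian_subgroupI3 additive_subgroupI)

lemma carrier_quotient: "carrier Q = (\<lambda>x. W +> x) ` carrier V"
  by (auto simp: quotient_space_simps A_RCOSETS_def')

lemma add_quotient: "x \<in> carrier V \<Longrightarrow> y \<in> carrier V \<Longrightarrow> (W +> x) \<oplus>\<^bsub>Q\<^esub> (W +> y) = W +> (x \<oplus> y)"
  by (simp add: quotient_space_simps W.a_rcos_sum)

lemma zero_quotient: "\<zero>\<^bsub>Q\<^esub> = W +> \<zero>"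
  using W_zero W_subgroup by (simp add: quotient_space_simps a_coset_join2)

lemma coset_eqI:
  assumes "x \<in> carrier V" "w \<in> W"
  shows "W +> (w \<oplus> x) = W +> x"
  using a_repr_independence[of "w \<oplus> x" W x] assms W_subgroup by (auto simp: a_r_coset_def r_coset_def)

lemma coset_mem_eq:
  assumes "x \<in> carrier V" "y \<in> W +> x"
  shows "\<exists>w\<in>W. y = w \<oplus> x"
  using assms by (auto simp: a_r_coset_def r_coset_def)

text \<open>Scalar multiplication on the quotient and the induced map in cohomology are unions over
  all representatives of a class. Such a union collapses as soon as its members do not depend on the
  representative.\<close>

lemma coset_UN_eq:
  assumes x: "x \<in> carrier V" and F: "\<And>w. w \<in> W \<Longrightarrow> F (w \<oplus> x) = F x"
  shows "(\<Union>y\<in>W +> x. F y) = F x"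
proof -
  have "F y = F x" if "y \<in> W +> x" for y
    using coset_mem_eq[OF x that] F by auto
  moreover have "W +> x \<noteq> {}"
    using W.a_rcos_self[OF x] by blast
  ultimately show ?thesis
    by (intro SUP_eq_const)
qed

lemma smult_quotient:
  assumes x: "x \<in> carrier V"
  shows "q \<odot>\<^bsub>Q\<^esub> (W +> x) = W +> (q \<odot> x)"
  unfolding quotient_space_simps
proof (rule coset_UN_eq[OF x])
  fix w assume w: "w \<in> W"
  then have "q \<odot> (w \<oplus> x) = (q \<odot> w) \<oplus> (q \<odot> x)"
    using x W_subset by (intro smult_r_distr) auto
  then show "W +> (q \<odot> (w \<oplus> x)) = W +> (q \<odot> x)"
    using coset_eqI[OF smult_closed[OF _ x] W_smult[OF w]] by simp
qed

lemma module_quotient: "module rat_field Q"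
proof (rule moduleI[OF cring_rat_field])
  show "abelian_group Q"
  proof (rule abelian_groupI)
    fix A assume "A \<in> carrier Q"
    then obtain x where x: "x \<in> carrier V" "A = W +> x"
      by (auto simp: carrier_quotient)
    then show "\<exists>B\<in>carrier Q. B \<oplus>\<^bsub>Q\<^esub> A = \<zero>\<^bsub>Q\<^esub>"
      using smult_minus_one[OF x(1)]
      by (intro bexI[of _ "W +> ((-1) \<odot> x)"]) (auto simp: add_quotient zero_quotient carrier_quotient)
  qed (auto simp: carrier_quotient add_quotient zero_quotient M.add.m_ac)
qed (auto simp: carrier_quotient add_quotient smult_quotient smult_l_distr[simplified] smult_r_distr smult_assoc1[simplified] smult_one[simplified])

end

section \<open>Cohomology classes and their pullbacks\<close>

lemma cocycle_space_simps:
  "carrier (cocycle_space p X) = cocycles p X"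
  "u \<oplus>\<^bsub>cocycle_space p X\<^esub> v = (\<lambda>z\<in>singular_chain_set p X. u z + v z)"
  "q \<odot>\<^bsub>cocycle_space p X\<^esub> u = (\<lambda>z\<in>singular_chain_set p X. q * u z)"
  "\<zero>\<^bsub>cocycle_space p X\<^esub> = (\<lambda>z\<in>singular_chain_set p X. 0)"
  by (simp_all add: cocycle_space_def fun_space_def)

lemma cocycles_extensional: "c \<in> cocycles p X \<Longrightarrow> c \<in> extensional (singular_chain_set p X)"
  by (simp add: cocycles_iff cochains_iff)

lemma restrict_in_cocycles:
  assumes "additive_on (singular_chain_set p X) g"
    and "\<And>z. singular_chain (Suc p) X z \<Longrightarrow> g (chain_boundary (Suc p) z) = 0"
  shows "restrict g (singular_chain_set p X) \<in> cocycles p X"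
  using assms by (simp add: cocycles_iff restrict_in_cochains singular_chain_boundary_alt)

lemma cochains_additive: "c \<in> cochains p X \<Longrightarrow> additive_on (singular_chain_set p X) c"
  by (simp add: cochains_iff)

lemma module_cocycle_space: "module rat_field (cocycle_space p X)"
proof -
  let ?V = "cocycle_space p X"
  have add: "x \<oplus>\<^bsub>?V\<^esub> y \<in> cocycles p X" if "x \<in> cocycles p X" "y \<in> cocycles p X" for x y
    unfolding cocycle_space_simps using that
    by (intro restrict_in_cocycles) (auto simp: additive_on_def cocycles_iff cochains_iff)
  have smult: "q \<odot>\<^bsub>?V\<^esub> x \<in> cocycles p X" if "x \<in> cocycles p X" for q x
    unfolding cocycle_space_simps using that
    by (intro restrict_in_cocycles) (auto simp: additive_on_def cocycles_iff cochains_iff right_diff_distrib)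
  have zero: "\<zero>\<^bsub>?V\<^esub> \<in> cocycles p X"
    unfolding cocycle_space_simps by (intro restrict_in_cocycles) (auto simp: additive_on_def)
  show ?thesis
  proof (rule moduleI[OF cring_rat_field])
    show "abelian_group ?V"
    proof (rule abelian_groupI)
      fix x assume x: "x \<in> carrier ?V"
      then have "(-1) \<odot>\<^bsub>?V\<^esub> x \<in> carrier ?V" "((-1) \<odot>\<^bsub>?V\<^esub> x) \<oplus>\<^bsub>?V\<^esub> x = \<zero>\<^bsub>?V\<^esub>"
        using smult by (auto simp: cocycle_space_simps(1)) (auto simp: cocycle_space_simps restrict_def)
      then show "\<exists>y\<in>carrier ?V. y \<oplus>\<^bsub>?V\<^esub> x = \<zero>\<^bsub>?V\<^esub>"
        by blast
      show "\<zero>\<^bsub>?V\<^esub> \<oplus>\<^bsub>?V\<^esub> x = x"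
        using x cocycles_extensional[of x p X] by (auto simp: cocycle_space_simps extensional_def restrict_def fun_eq_iff)
    qed (use add zero in \<open>auto simp: cocycle_space_simps restrict_def fun_eq_iff\<close>)
    show "\<one>\<^bsub>rat_field\<^esub> \<odot>\<^bsub>?V\<^esub> x = x" if "x \<in> carrier ?V" for x
      using that cocycles_extensional[of x p X] by (auto simp: cocycle_space_simps extensional_def restrict_def fun_eq_iff)
  qed (use smult in \<open>auto simp: cocycle_space_simps restrict_def fun_eq_iff algebra_simps\<close>)
qed

lemma coboundary_in_cocycles:
  assumes "b \<in> cochains q X"
  shows "coboundary q X b \<in> cocycles (Suc q) X"
  unfolding coboundary_def carrier_chain_group
proof (rule restrict_in_cocycles)
  have b: "b (x - y) = b x - b y" if "singular_chain q X x" "singular_chain q X y" for x y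
    using cochains_additive[OF assms] that by (simp add: additive_on_def)
  then show "additive_on (singular_chain_set (Suc q) X) (\<lambda>z. b (chain_boundary (Suc q) z))"
    by (simp add: additive_on_def chain_boundary_diff singular_chain_boundary_alt)
  show "b (chain_boundary (Suc q) (chain_boundary (Suc (Suc q)) z)) = 0" if "singular_chain (Suc (Suc q)) X z" for z
    using b[of 0 0] chain_boundary_boundary_alt[OF that] by simp
qed

text \<open>Closure under the operations is read off from vanishing on cycles, which characterises
  coboundaries among cochains, so no primitives have to be combined.\<close>

lemma rat_subspace_coboundaries: "rat_subspace (cocycle_space p X) (coboundaries p X)"
proof (intro rat_subspace.intro module_cocycle_space rat_subspace_axioms.intro)
  let ?C = "singular_chain_set p X"
  show "coboundaries p X \<subseteq> carrier (cocycle_space p X)"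
    using coboundary_in_cocycles restrict_in_cocycles[of 0 X "\<lambda>_. 0"]
    by (cases p) (auto simp: cocycle_space_simps additive_on_def)
  show "\<zero>\<^bsub>cocycle_space p X\<^esub> \<in> coboundaries p X"
    by (intro coboundaries_if_zero_on_cycles)
      (auto simp: cocycle_space_simps restrict_in_cochains additive_on_def singular_cycle)
  fix x y q assume xy: "x \<in> coboundaries p X" 
  have zero: "x z = 0" if "singular_relcycle p X {} z" "x \<in> coboundaries p X" for z x
    using that by (cases p) (auto simp: coboundary_def singular_cycle cochains_iff additive_onD(1)[OF frag_subgroup_chains])
  have coc: "x \<in> cochains p X" if "x \<in> coboundaries p X" for x
    using that coboundary_in_cocycles restrict_in_cochains[of 0 X "\<lambda>_. 0"]
    by (cases p) (auto simp: cocycles_iff additive_on_def)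
  show "x \<oplus>\<^bsub>cocycle_space p X\<^esub> y \<in> coboundaries p X" if "y \<in> coboundaries p X"
    using zero[OF _ xy] zero[OF _ that] coc[OF xy] coc[OF that] unfolding cocycle_space_simps
    by (intro coboundaries_if_zero_on_cycles restrict_in_cochains) (auto simp: additive_on_def cochains_iff singular_cycle)
  show "q \<odot>\<^bsub>cocycle_space p X\<^esub> x \<in> coboundaries p X"
    using zero[OF _ xy] coc[OF xy] unfolding cocycle_space_simps
    by (intro coboundaries_if_zero_on_cycles restrict_in_cochains)
      (auto simp: additive_on_def cochains_iff singular_cycle right_diff_distrib)
qed

lemma coboundaries_iff:
  "c \<in> coboundaries p X \<longleftrightarrow> c \<in> cochains p X \<and> (\<forall>z. singular_relcycle p X {} z \<longrightarrow> c z = 0)"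
proof
  assume c: "c \<in> coboundaries p X"
  then have "c \<in> cocycles p X"
    using rat_subspace.W_subset[OF rat_subspace_coboundaries] by (auto simp: cocycle_space_simps)
  moreover have "c z = 0" if "singular_relcycle p X {} z" for z
    using that c by (cases p) (auto simp: coboundary_def singular_cycle cochains_iff additive_onD(1)[OF frag_subgroup_chains])
  ultimately show "c \<in> cochains p X \<and> (\<forall>z. singular_relcycle p X {} z \<longrightarrow> c z = 0)"
    by (simp add: cocycles_iff)
qed (auto intro: coboundaries_if_zero_on_cycles)

definition coh_class :: "nat \<Rightarrow> 'a topology \<Rightarrow> ('a chain \<Rightarrow> rat) \<Rightarrow> ('a chain \<Rightarrow> rat) set" where
  "coh_class p X c = coboundaries p X +>\<^bsub>cocycle_space p X\<^esub> c"

lemma carrier_cohomology: "carrier (cohomology p X) = coh_class p X ` cocycles p X"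
  unfolding cohomology_def coh_class_def
  using rat_subspace.carrier_quotient[OF rat_subspace_coboundaries[of p X]] by (simp add: cocycle_space_simps)

lemma module_cohomology: "module rat_field (cohomology p X)"
  unfolding cohomology_def by (rule rat_subspace.module_quotient[OF rat_subspace_coboundaries])

lemma add_cohomology:
  assumes "b \<in> cocycles p X" "c \<in> cocycles p X"
  shows "coh_class p X b \<oplus>\<^bsub>cohomology p X\<^esub> coh_class p X c = coh_class p X (\<lambda>z\<in>singular_chain_set p X. b z + c z)"
  unfolding cohomology_def coh_class_def
  using rat_subspace.add_quotient[OF rat_subspace_coboundaries[of p X], of b c] assms
  by (simp add: cocycle_space_simps)

lemma smult_cohomology:
  assumes "c \<in> cocycles p X"
  shows "q \<odot>\<^bsub>cohomology p X\<^esub> coh_class p X c = coh_class p X (\<lambda>z\<in>singular_chain_set p X. q * c z)"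
  unfolding cohomology_def coh_class_def
  using rat_subspace.smult_quotient[OF rat_subspace_coboundaries[of p X], of c q] assms
  by (simp add: cocycle_space_simps)

lemma coh_class_eqI:
  assumes "b \<in> cocycles p X" "c \<in> cocycles p X" "(\<lambda>z\<in>singular_chain_set p X. b z - c z) \<in> coboundaries p X"
  shows "coh_class p X b = coh_class p X c"
proof -
  have eq: "b = (\<lambda>z\<in>singular_chain_set p X. b z - c z) \<oplus>\<^bsub>cocycle_space p X\<^esub> c"
    using cocycles_extensional[OF assms(1)] by (auto simp: cocycle_space_simps extensional_def fun_eq_iff)
  have "coh_class p X ((\<lambda>z\<in>singular_chain_set p X. b z - c z) \<oplus>\<^bsub>cocycle_space p X\<^esub> c) = coh_class p X c"
    unfolding coh_class_def
    by (rule rat_subspace.coset_eqI[OF rat_subspace_coboundaries _ assms(3)])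
      (simp add: cocycle_space_simps(1) assms(2))
  then show ?thesis
    by (simp only: eq[symmetric])
qed

lemma cochain_pullback_in_coboundaries:
  assumes g: "continuous_map X Y g" and b: "b \<in> coboundaries p Y"
  shows "cochain_pullback p X g b \<in> coboundaries p X"
proof (rule coboundaries_if_zero_on_cycles)
  show "cochain_pullback p X g b \<in> cochains p X"
    using b by (intro cochain_pullback_in_cochains[OF g]) (simp add: coboundaries_iff)
  fix z assume z: "singular_relcycle p X {} z"
  then have "singular_relcycle p Y {} (chain_map p g z)"
    by (rule singular_relcycle_chain_map[OF _ g]) simp
  then show "cochain_pullback p X g b z = 0"
    using b z by (simp add: cochain_pullback_def coboundaries_iff singular_cycle)
qed

lemma cohomology_map_coh_class:
  assumes g: "continuous_map X Y g" and c: "c \<in> cocycles p Y"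
  shows "cohomology_map p X g (coh_class p Y c) = coh_class p X (cochain_pullback p X g c)"
  unfolding cohomology_map_def coh_class_def
proof (rule rat_subspace.coset_UN_eq[OF rat_subspace_coboundaries])
  show "c \<in> carrier (cocycle_space p Y)"
    using c by (simp add: cocycle_space_simps)
  fix b assume b: "b \<in> coboundaries p Y"
  have "cochain_pullback p X g (b \<oplus>\<^bsub>cocycle_space p Y\<^esub> c)
      = cochain_pullback p X g b \<oplus>\<^bsub>cocycle_space p X\<^esub> cochain_pullback p X g c"
    by (auto simp: cocycle_space_simps cochain_pullback_def singular_chain_chain_map[OF _ g])
  then show "coboundaries p X +>\<^bsub>cocycle_space p X\<^esub> cochain_pullback p X g (b \<oplus>\<^bsub>cocycle_space p Y\<^esub> c)
      = coboundaries p X +>\<^bsub>cocycle_space p X\<^esub> cochain_pullback p X g c"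
    using rat_subspace.coset_eqI[OF rat_subspace_coboundaries _ cochain_pullback_in_coboundaries[OF g b]]
      cochain_pullback_in_cocycles[OF g c] by (simp add: cocycle_space_simps(1))
qed

lemma cochain_pullback_compose:
  assumes f: "continuous_map X Y f" and eq: "\<And>x. x \<in> topspace X \<Longrightarrow> h x = g (f x)"
  shows "cochain_pullback p X h c = cochain_pullback p X f (cochain_pullback p Y g c)"
proof -
  have "chain_map p h z = chain_map p g (chain_map p f z)" if z: "singular_chain p X z" for z
  proof -
    have "chain_map p h z = chain_map p (g \<circ> f) z"
      by (rule chain_map_eq[OF z]) (simp add: eq)
    then show ?thesis
      by (simp add: chain_map_compose)
  qed
  then show ?thesis
    by (auto simp: cochain_pullback_def singular_chain_chain_map[OF _ f])
qed

section \<open>Modules given by the cohomology of spaces\<close>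

lemma FS_homD:
  assumes "\<phi> \<in> FS_hom E F"
  shows "\<phi> \<in> extensional E" "\<phi> ` E = F" "\<And>e. e \<in> E \<Longrightarrow> \<phi> e \<in> F"
  using assms by (auto simp: FS_hom_def PiE_def)

lemma finite_FS_hom: "E \<in> FS_obj \<Longrightarrow> F \<in> FS_obj \<Longrightarrow> finite (FS_hom E F)"
  unfolding FS_hom_def by (rule finite_subset[OF _ finite_PiE[of E "\<lambda>_. F"]]) (auto simp: FS_obj_def)

lemma compose_FS_hom: "\<phi> \<in> FS_hom E F \<Longrightarrow> \<psi> \<in> FS_hom F G \<Longrightarrow> compose E \<psi> \<phi> \<in> FS_hom E G"
  by (auto simp: FS_hom_def compose_def PiE_def Pi_iff image_iff)

lemma id_FS_hom: "(\<lambda>e\<in>E. e) \<in> FS_hom E E"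
  by (auto simp: FS_hom_def)

text \<open>A functor from finite sets and surjections to topological spaces. The functor laws are
  asked only on points of the spaces, which is all that singular chains see.\<close>

locale FS_space =
  fixes T :: "nat set \<Rightarrow> 'a topology" and g :: "nat set \<Rightarrow> nat set \<Rightarrow> (nat \<Rightarrow> nat) \<Rightarrow> 'a \<Rightarrow> 'a" and p :: nat
  assumes cont: "\<And>E F \<phi>. E \<in> FS_obj \<Longrightarrow> F \<in> FS_obj \<Longrightarrow> \<phi> \<in> FS_hom E F \<Longrightarrow> continuous_map (T E) (T F) (g E F \<phi>)"
    and g_id: "\<And>E x. E \<in> FS_obj \<Longrightarrow> x \<in> topspace (T E) \<Longrightarrow> g E E (\<lambda>e\<in>E. e) x = x"
    and g_compose: "\<And>E F G \<phi> \<psi> x. E \<in> FS_obj \<Longrightarrow> F \<in> FS_obj \<Longrightarrow> G \<in> FS_obj \<Longrightarrow> \<phi> \<in> FS_hom E F \<Longrightarrow>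
      \<psi> \<in> FS_hom F G \<Longrightarrow> x \<in> topspace (T E) \<Longrightarrow> g E G (compose E \<psi> \<phi>) x = g F G \<psi> (g E F \<phi> x)"
begin

definition coh_module :: "('a chain \<Rightarrow> rat) set FSop_data" where
  "coh_module = \<lparr>space_at = (\<lambda>E. cohomology p (T E)), pull = (\<lambda>E F \<phi>. cohomology_map p (T E) (g E F \<phi>))\<rparr>"

abbreviation pb where "pb E F \<phi> \<equiv> cochain_pullback p (T E) (g E F \<phi>)"

abbreviation C where "C E \<equiv> singular_chain_set p (T E)"

lemma pull_coh_class:
  assumes "E \<in> FS_obj" "F \<in> FS_obj" "\<phi> \<in> FS_hom E F" "c \<in> cocycles p (T F)"
  shows "pull coh_module E F \<phi> (coh_class p (T F) c) = coh_class p (T E) (pb E F \<phi> c)"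
  using cohomology_map_coh_class[OF cont] assms by (simp add: coh_module_def)

lemma pb_in_cocycles:
  assumes "E \<in> FS_obj" "F \<in> FS_obj" "\<phi> \<in> FS_hom E F" "c \<in> cocycles p (T F)"
  shows "pb E F \<phi> c \<in> cocycles p (T E)"
  using assms cont cochain_pullback_in_cocycles by blast

lemma FSop_module_coh_module: "FSop_module coh_module"
  unfolding FSop_module_def
proof (intro conjI ballI)
  show "module rat_field (space_at coh_module E)" for E
    by (simp add: coh_module_def module_cohomology)
next
  fix E F \<phi> assume EF: "E \<in> FS_obj" "F \<in> FS_obj" "\<phi> \<in> FS_hom E F"
  have chain: "chain_map p (g E F \<phi>) z \<in> C F" if "z \<in> C E" for z
    using singular_chain_chain_map[OF _ cont[OF EF]] that by simp
  have add: "(\<lambda>z\<in>C F. a z + b z) \<in> cocycles p (T F)" if "a \<in> cocycles p (T F)" "b \<in> cocycles p (T F)" for a b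
    using abelian_groupE(1)[OF module.axioms(2)[OF module_cocycle_space[of p "T F"]], of a b] that
    by (simp add: cocycle_space_simps)
  have smult: "(\<lambda>z\<in>C F. q * a z) \<in> cocycles p (T F)" if "a \<in> cocycles p (T F)" for a q
    using module.smult_closed[OF module_cocycle_space[of p "T F"], of q a] that
    by (simp add: cocycle_space_simps)
  show "linear_map (space_at coh_module F) (space_at coh_module E) (pull coh_module E F \<phi>)"
    unfolding linear_map_def
  proof (intro conjI allI ballI homI)
    fix A B assume "A \<in> carrier (add_monoid (space_at coh_module F))" "B \<in> carrier (add_monoid (space_at coh_module F))"
    then obtain a b where ab: "a \<in> cocycles p (T F)" "A = coh_class p (T F) a" "b \<in> cocycles p (T F)" "B = coh_class p (T F) b"
      by (auto simp: coh_module_def carrier_cohomology)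
    have "pb E F \<phi> (\<lambda>z\<in>C F. a z + b z) = (\<lambda>z\<in>C E. pb E F \<phi> a z + pb E F \<phi> b z)"
      using chain by (auto simp: cochain_pullback_def)
    then show "pull coh_module E F \<phi> (A \<otimes>\<^bsub>add_monoid (space_at coh_module F)\<^esub> B)
        = pull coh_module E F \<phi> A \<otimes>\<^bsub>add_monoid (space_at coh_module E)\<^esub> pull coh_module E F \<phi> B"
      using ab EF by (simp add: pull_coh_class pb_in_cocycles add_cohomology add) (simp add: coh_module_def ab add_cohomology add pb_in_cocycles EF pull_coh_class[unfolded coh_module_def, simplified])
    show "pull coh_module E F \<phi> A \<in> carrier (add_monoid (space_at coh_module E))"
      using ab EF pb_in_cocycles by (auto simp: pull_coh_class) (auto simp: coh_module_def carrier_cohomology)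
  next
    fix q A assume "A \<in> carrier (space_at coh_module F)"
    then obtain a where a: "a \<in> cocycles p (T F)" "A = coh_class p (T F) a"
      by (auto simp: coh_module_def carrier_cohomology)
    have "pb E F \<phi> (\<lambda>z\<in>C F. q * a z) = (\<lambda>z\<in>C E. q * pb E F \<phi> a z)"
      using chain by (auto simp: cochain_pullback_def)
    then have "pull coh_module E F \<phi> (coh_class p (T F) (\<lambda>z\<in>C F. q * a z)) = q \<odot>\<^bsub>cohomology p (T E)\<^esub> coh_class p (T E) (pb E F \<phi> a)"
      using a EF by (simp add: pull_coh_class smult smult_cohomology pb_in_cocycles)
    then show "pull coh_module E F \<phi> (q \<odot>\<^bsub>space_at coh_module F\<^esub> A) = q \<odot>\<^bsub>space_at coh_module E\<^esub> pull coh_module E F \<phi> A"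
      using a EF by (simp add: pull_coh_class) (simp add: coh_module_def smult_cohomology)
  qed
next
  fix E A assume E: "E \<in> FS_obj" and "A \<in> carrier (space_at coh_module E)"
  then obtain a where a: "a \<in> cocycles p (T E)" "A = coh_class p (T E) a"
    by (auto simp: coh_module_def carrier_cohomology)
  have "pb E E (\<lambda>e\<in>E. e) a = a"
    using cocycles_extensional[OF a(1)] chain_map_id_gen[of p "T E" _ "g E E (\<lambda>e\<in>E. e)"] g_id[OF E]
    by (auto simp: cochain_pullback_def extensional_def fun_eq_iff)
  then show "pull coh_module E E (\<lambda>e\<in>E. e) A = A"
    using a E id_FS_hom by (simp add: pull_coh_class)
next
  fix E F G \<phi> \<psi> A assume EFG: "E \<in> FS_obj" "F \<in> FS_obj" "G \<in> FS_obj" "\<phi> \<in> FS_hom E F" "\<psi> \<in> FS_hom F G"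
    and "A \<in> carrier (space_at coh_module G)"
  then obtain a where a: "a \<in> cocycles p (T G)" "A = coh_class p (T G) a"
    by (auto simp: coh_module_def carrier_cohomology)
  have "pb E G (compose E \<psi> \<phi>) a = pb E F \<phi> (pb F G \<psi> a)"
    using EFG by (intro cochain_pullback_compose cont g_compose) auto
  then show "pull coh_module E G (compose E \<psi> \<phi>) A = pull coh_module E F \<phi> (pull coh_module F G \<psi> A)"
    using a EFG compose_FS_hom by (simp add: pull_coh_class pb_in_cocycles)
qed

text \<open>By the Yoneda lemma a class at \<open>F j\<close> is the same as a map from the
  principal projective of \<open>F j\<close>. The hypothesis \<open>span\<close> is surjectivity of
  the resulting map from the direct sum, stated for cocycles modulo coboundaries.\<close>

lemma finitely_generated_coh_module:
  fixes k :: nat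
  assumes F: "\<And>j. j < k \<Longrightarrow> F j \<in> FS_obj \<and> card (F j) \<le> m"
    and w: "\<And>j. j < k \<Longrightarrow> w j \<in> cocycles p (T (F j))"
    and span: "\<And>E c. E \<in> FS_obj \<Longrightarrow> c \<in> cocycles p (T E) \<Longrightarrow>
      \<exists>v. (\<lambda>z\<in>C E. c z - (\<Sum>j<k. \<Sum>\<psi>\<in>FS_hom E (F j). v j \<psi> * pb E (F j) \<psi> (w j) z)) \<in> coboundaries p (T E)"
  shows "finitely_generated_in_degrees coh_module m"
proof -
  \<comment> \<open>A representative on the level of cochains, for which additivity and naturality
    hold as equalities before classes are taken.\<close>
  define gen where "gen E v = (\<lambda>z\<in>C E. \<Sum>j<k. \<Sum>\<psi>\<in>FS_hom E (F j). v j \<psi> * pb E (F j) \<psi> (w j) z)" for E v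
  define \<eta> where "\<eta> E v = coh_class p (T E) (gen E v)" for E v
  let ?P = "FSop_sum {..<k} (\<lambda>j. principal_projective (F j))"
  have P_simps: "carrier (space_at ?P E) = (\<Pi>\<^sub>E j\<in>{..<k}. FS_hom E (F j) \<rightarrow>\<^sub>E UNIV)"
    "u \<oplus>\<^bsub>space_at ?P E\<^esub> v = (\<lambda>j\<in>{..<k}. \<lambda>\<psi>\<in>FS_hom E (F j). u j \<psi> + v j \<psi>)"
    "q \<odot>\<^bsub>space_at ?P E\<^esub> v = (\<lambda>j\<in>{..<k}. \<lambda>\<psi>\<in>FS_hom E (F j). q * v j \<psi>)"
    "pull ?P E E' \<phi> v = (\<lambda>j\<in>{..<k}. \<lambda>\<theta>\<in>FS_hom E (F j). \<Sum>\<psi> | \<psi> \<in> FS_hom E' (F j) \<and> compose E \<psi> \<phi> = \<theta>. v j \<psi>)"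
    for E E' u v q \<phi>
    by (simp_all add: FSop_sum_def principal_projective_def sum_space_def fun_space_def)
  have gen: "gen E v \<in> cocycles p (T E)" if E: "E \<in> FS_obj" for E v
    unfolding gen_def
  proof (rule restrict_in_cocycles)
    have pb: "pb E (F j) \<psi> (w j) \<in> cocycles p (T E)" if "j < k" "\<psi> \<in> FS_hom E (F j)" for j \<psi>
      using that F w E by (intro pb_in_cocycles) auto
    then have pb_diff: "pb E (F j) \<psi> (w j) (x - y) = pb E (F j) \<psi> (w j) x - pb E (F j) \<psi> (w j) y"
      if "j < k" "\<psi> \<in> FS_hom E (F j)" "x \<in> C E" "y \<in> C E" for j \<psi> x y
      using that unfolding cocycles_iff cochains_iff additive_on_def by blast
    show "additive_on (C E) (\<lambda>z. \<Sum>j<k. \<Sum>\<psi>\<in>FS_hom E (F j). v j \<psi> * pb E (F j) \<psi> (w j) z)"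
      by (simp add: additive_on_def pb_diff[simplified] right_diff_distrib sum_subtractf)
    show "(\<Sum>j<k. \<Sum>\<psi>\<in>FS_hom E (F j). v j \<psi> * pb E (F j) \<psi> (w j) (chain_boundary (Suc p) z)) = 0"
      if "singular_chain (Suc p) (T E) z" for z
      using pb that by (simp add: cocycles_iff)
  qed
  have linear: "linear_map (space_at ?P E) (space_at coh_module E) (\<eta> E)" if E: "E \<in> FS_obj" for E
    unfolding linear_map_def
  proof (intro conjI allI ballI homI)
    fix u v
    have "gen E (u \<oplus>\<^bsub>space_at ?P E\<^esub> v) = (\<lambda>z\<in>C E. gen E u z + gen E v z)"
      unfolding gen_def P_simps by (rule restrict_ext) (simp add: distrib_right sum.distrib)
    then show "\<eta> E (u \<otimes>\<^bsub>add_monoid (space_at ?P E)\<^esub> v) = \<eta> E u \<otimes>\<^bsub>add_monoid (space_at coh_module E)\<^esub> \<eta> E v"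
      using gen[OF E] by (simp add: \<eta>_def coh_module_def add_cohomology)
    show "\<eta> E u \<in> carrier (add_monoid (space_at coh_module E))"
      using gen[OF E] by (simp add: \<eta>_def coh_module_def carrier_cohomology)
  next
    fix q u
    have "gen E (q \<odot>\<^bsub>space_at ?P E\<^esub> u) = (\<lambda>z\<in>C E. q * gen E u z)"
      unfolding gen_def P_simps by (rule restrict_ext) (simp add: sum_distrib_left mult.assoc)
    then show "\<eta> E (q \<odot>\<^bsub>space_at ?P E\<^esub> u) = q \<odot>\<^bsub>space_at coh_module E\<^esub> \<eta> E u"
      using gen[OF E] by (simp add: \<eta>_def coh_module_def smult_cohomology)
  qed
  have natural: "\<eta> E (pull ?P E E' \<phi> v) = pull coh_module E E' \<phi> (\<eta> E' v)"
    if E: "E \<in> FS_obj" "E' \<in> FS_obj" and \<phi>: "\<phi> \<in> FS_hom E E'" for E E' \<phi> v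
  proof -
    have "gen E (pull ?P E E' \<phi> v) z = pb E E' \<phi> (gen E' v) z" if z: "z \<in> C E" for z
    proof -
      have "(\<Sum>\<theta>\<in>FS_hom E (F j). (\<Sum>\<psi> | \<psi> \<in> FS_hom E' (F j) \<and> compose E \<psi> \<phi> = \<theta>. v j \<psi>) * pb E (F j) \<theta> (w j) z)
          = (\<Sum>\<psi>\<in>FS_hom E' (F j). v j \<psi> * pb E' (F j) \<psi> (w j) (chain_map p (g E E' \<phi>) z))"
        if j: "j < k" for j
      proof -
        let ?I = "FS_hom E' (F j)" and ?J = "FS_hom E (F j)"
        let ?h = "\<lambda>\<psi>. v j \<psi> * pb E (F j) (compose E \<psi> \<phi>) (w j) z"
        have fin: "finite ?I" "finite ?J"
          using finite_FS_hom E F j by auto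
        \<comment> \<open>The pullback on a principal projective adds up coefficients over the
          fibres of composition with \<open>\<phi>\<close>, so the double sum regroups into one sum
          over the surjections from \<open>E'\<close>.\<close>
        have "(\<Sum>\<theta>\<in>?J. (\<Sum>\<psi> | \<psi> \<in> ?I \<and> compose E \<psi> \<phi> = \<theta>. v j \<psi>) * pb E (F j) \<theta> (w j) z)
            = (\<Sum>\<theta>\<in>?J. \<Sum>\<psi> | \<psi> \<in> ?I \<and> compose E \<psi> \<phi> = \<theta>. ?h \<psi>)"
          by (auto simp: sum_distrib_right intro!: sum.cong)
        also have "\<dots> = sum ?h ?I"
          using fin compose_FS_hom[OF \<phi>] by (intro sum.group) auto
        also have "\<dots> = (\<Sum>\<psi>\<in>?I. v j \<psi> * pb E' (F j) \<psi> (w j) (chain_map p (g E E' \<phi>) z))"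
        proof (rule sum.cong[OF refl])
          fix \<psi> assume \<psi>: "\<psi> \<in> ?I"
          have "pb E (F j) (compose E \<psi> \<phi>) (w j) = pb E E' \<phi> (pb E' (F j) \<psi> (w j))"
            using E F j \<phi> \<psi> by (intro cochain_pullback_compose cont g_compose) auto
          then show "?h \<psi> = v j \<psi> * pb E' (F j) \<psi> (w j) (chain_map p (g E E' \<phi>) z)"
            using z by (simp add: cochain_pullback_def[of p "T E" "g E E' \<phi>"])
        qed
        finally show ?thesis .
      qed
      moreover have "singular_chain p (T E') (chain_map p (g E E' \<phi>) z)"
        using singular_chain_chain_map[OF _ cont[OF E \<phi>]] z by simp
      ultimately show ?thesis
        using z by (simp add: gen_def P_simps cochain_pullback_def[of p "T E" "g E E' \<phi>"])
    qed
    then have "gen E (pull ?P E E' \<phi> v) = pb E E' \<phi> (gen E' v)"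
      by (intro ext) (auto simp: gen_def cochain_pullback_def)
    then show ?thesis
      using gen E \<phi> by (simp add: \<eta>_def pull_coh_class)
  qed
  have surj: "\<eta> E ` carrier (space_at ?P E) = carrier (space_at coh_module E)" if E: "E \<in> FS_obj" for E
  proof
    show "\<eta> E ` carrier (space_at ?P E) \<subseteq> carrier (space_at coh_module E)"
      using gen[OF E] by (auto simp: \<eta>_def coh_module_def carrier_cohomology)
    show "carrier (space_at coh_module E) \<subseteq> \<eta> E ` carrier (space_at ?P E)"
    proof
      fix A assume "A \<in> carrier (space_at coh_module E)"
      then obtain c where c: "c \<in> cocycles p (T E)" "A = coh_class p (T E) c"
        by (auto simp: coh_module_def carrier_cohomology)
      obtain v where v: "(\<lambda>z\<in>C E. c z - (\<Sum>j<k. \<Sum>\<psi>\<in>FS_hom E (F j). v j \<psi> * pb E (F j) \<psi> (w j) z)) \<in> coboundaries p (T E)"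
        using span[OF E c(1)] by blast
      define v' where "v' = (\<lambda>j\<in>{..<k}. \<lambda>\<psi>\<in>FS_hom E (F j). v j \<psi>)"
      have "(\<lambda>z\<in>C E. c z - (\<Sum>j<k. \<Sum>\<psi>\<in>FS_hom E (F j). v j \<psi> * pb E (F j) \<psi> (w j) z)) = (\<lambda>z\<in>C E. c z - gen E v' z)"
        by (rule restrict_ext) (simp add: gen_def v'_def)
      then have A: "A = \<eta> E v'"
        unfolding c(2) \<eta>_def using v by (intro coh_class_eqI c(1) gen E) simp
      show "A \<in> \<eta> E ` carrier (space_at ?P E)"
        unfolding A by (rule imageI) (auto simp: P_simps v'_def)
    qed
  qed
  have "\<forall>j<k. F j \<in> FS_obj \<and> card (F j) \<le> m"
    using F by blast
  moreover have "FSop_hom ?P coh_module \<eta>"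
    unfolding FSop_hom_def using linear natural by blast
  moreover have "\<forall>E\<in>FS_obj. \<eta> E ` carrier (space_at ?P E) = carrier (space_at coh_module E)"
    using surj by blast
  ultimately have "\<exists>\<eta>. (\<forall>j<k. F j \<in> FS_obj \<and> card (F j) \<le> m) \<and> FSop_hom ?P coh_module \<eta> \<and>
      (\<forall>E\<in>FS_obj. \<eta> E ` carrier (space_at ?P E) = carrier (space_at coh_module E))"
    by (intro exI[of _ \<eta>] conjI)
  then show ?thesis
    unfolding finitely_generated_in_degrees_def
    by (intro conjI[OF FSop_module_coh_module] exI[of _ k] exI[of _ F])
qed

end

section \<open>Spaces of tuples\<close>

text \<open>Extensional coefficient functions represent the same forms as all functions into
  \<open>S\<close>, and there are only finitely many of them.\<close>

definition nonzero_coefficients :: "real set \<Rightarrow> 'e set \<Rightarrow> ('e \<Rightarrow> real) set" where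
  "nonzero_coefficients S E = {c \<in> E \<rightarrow>\<^sub>E S. \<exists>e\<in>E. c e \<noteq> 0}"

lemma finite_nonzero_coefficients: "finite S \<Longrightarrow> finite E \<Longrightarrow> finite (nonzero_coefficients S E)"
  unfolding nonzero_coefficients_def by (simp add: finite_PiE)

lemma tuple_space_eq_arrangement_complement:
  "tuple_space S E = arrangement_complement E (nonzero_coefficients S E)"
proof -
  have "(\<forall>c\<in>E \<rightarrow> S. (\<exists>e\<in>E. c e \<noteq> 0) \<longrightarrow> (\<Sum>e\<in>E. c e *\<^sub>R x e) \<noteq> 0) \<longleftrightarrow>
      (\<forall>c\<in>nonzero_coefficients S E. combination E c x \<noteq> 0)" (is "?l = ?r") for x :: "'a \<Rightarrow> real ^ 'b"
  proof
    assume ?l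
    then show ?r
      by (auto simp: nonzero_coefficients_def combination_def PiE_def)
  next
    assume r: ?r
    show ?l
    proof (intro ballI impI)
      fix c assume "c \<in> E \<rightarrow> S" "\<exists>e\<in>E. c e \<noteq> 0"
      then have "restrict c E \<in> nonzero_coefficients S E"
        by (auto simp: nonzero_coefficients_def)
      with r have "combination E (restrict c E) x \<noteq> 0"
        by blast
      then show "(\<Sum>e\<in>E. c e *\<^sub>R x e) \<noteq> 0"
        by (simp add: combination_def)
    qed
  qed
  then show ?thesis
    by (simp add: tuple_space_def arrangement_complement_def)
qed

lemma topspace_tuple_space:
  "topspace (tuple_space S E) = {x \<in> extensional E. \<forall>c\<in>nonzero_coefficients S E. combination E c x \<noteq> 0}"
  by (simp add: tuple_space_eq_arrangement_complement topspace_arrangement_complement)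

text \<open>Summation over fibres is adjoint to composition of coefficients with
  \<open>\<phi>\<close>: the sum over \<open>E\<close> is grouped by fibres, on which the
  coefficient is constant. Both the functoriality of the spaces and the factorisation of evaluation
  maps through quotients of \<open>E\<close> rest on this.\<close>

lemma combination_fiber_sum:
  assumes "finite E" "finite F" "\<And>e. e \<in> E \<Longrightarrow> \<phi> e \<in> F"
  shows "combination F c (fiber_sum E F \<phi> x) = combination E (\<lambda>e. c (\<phi> e)) x"
proof -
  have "combination F c (fiber_sum E F \<phi> x) = (\<Sum>f\<in>F. \<Sum>e | e \<in> E \<and> \<phi> e = f. c (\<phi> e) *\<^sub>R x e)"
    unfolding combination_def fiber_sum_def by (intro sum.cong refl) (simp add: scaleR_sum_right)
  also have "\<dots> = combination E (\<lambda>e. c (\<phi> e)) x"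
    unfolding combination_def using assms by (intro sum.group) auto
  finally show ?thesis .
qed

lemma continuous_map_fiber_sum:
  assumes E: "E \<in> FS_obj" and F: "F \<in> FS_obj" and \<phi>: "\<phi> \<in> FS_hom E F"
  shows "continuous_map (tuple_space S E) (tuple_space S F :: (nat \<Rightarrow> real ^ 'd::finite) topology) (fiber_sum E F \<phi>)"
  unfolding tuple_space_eq_arrangement_complement arrangement_complement_def
proof (rule continuous_map_into_subtopology)
  have fin: "finite E" "finite F"
    using E F by (auto simp: FS_obj_def)
  have "continuous_map (tuples E :: (nat \<Rightarrow> real ^ 'd) topology) (tuples F) (fiber_sum E F \<phi>)"
    unfolding continuous_map_componentwise
  proof (intro conjI ballI)
    fix f assume f: "f \<in> F"
    have "continuous_map (tuples E) euclidean (\<lambda>x :: nat \<Rightarrow> real ^ 'd. \<Sum>e | e \<in> E \<and> \<phi> e = f. x e)"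
      using fin by (intro continuous_map_sum continuous_map_product_projection) auto
    then show "continuous_map (tuples E) euclidean (\<lambda>x :: nat \<Rightarrow> real ^ 'd. fiber_sum E F \<phi> x f)"
      using f by (simp add: fiber_sum_def)
  qed (auto simp: fiber_sum_def)
  then show "continuous_map (subtopology (tuples E) {x :: nat \<Rightarrow> real ^ 'd. \<forall>c\<in>nonzero_coefficients S E. combination E c x \<noteq> 0})
      (tuples F) (fiber_sum E F \<phi>)"
    by (rule continuous_map_from_subtopology)
  show "fiber_sum E F \<phi> \<in> topspace (subtopology (tuples E) {x :: nat \<Rightarrow> real ^ 'd. \<forall>c\<in>nonzero_coefficients S E. combination E c x \<noteq> 0})
      \<rightarrow> {x. \<forall>c\<in>nonzero_coefficients S F. combination F c x \<noteq> 0}"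
  proof (intro funcsetI CollectI ballI)
    fix x :: "nat \<Rightarrow> real ^ 'd" and c
    assume x: "x \<in> topspace (subtopology (tuples E) {x. \<forall>c\<in>nonzero_coefficients S E. combination E c x \<noteq> 0})"
      and c: "c \<in> nonzero_coefficients S F"
    then obtain f where "f \<in> F" "c f \<noteq> 0"
      by (auto simp: nonzero_coefficients_def)
    \<comment> \<open>Surjectivity of \<open>\<phi>\<close> is what keeps the pulled back
      coefficients from being all zero.\<close>
    then have "(\<lambda>e\<in>E. c (\<phi> e)) \<in> nonzero_coefficients S E"
      using c FS_homD[OF \<phi>] by (auto simp: nonzero_coefficients_def)
    then have "combination E (\<lambda>e\<in>E. c (\<phi> e)) x \<noteq> 0"
      using x by auto
    moreover have "combination F c (fiber_sum E F \<phi> x) = combination E (\<lambda>e. c (\<phi> e)) x"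
      by (rule combination_fiber_sum[OF fin]) (rule FS_homD(3)[OF \<phi>])
    ultimately show "combination F c (fiber_sum E F \<phi> x) \<noteq> 0"
      by (simp add: combination_def)
  qed
qed

lemma fiber_sum_id: "x \<in> extensional E \<Longrightarrow> fiber_sum E E (\<lambda>e\<in>E. e) x = x"
proof -
  assume x: "x \<in> extensional E"
  have "{e \<in> E. (\<lambda>e\<in>E. e) e = f} = {f}" if "f \<in> E" for f
    using that by auto
  then show ?thesis
    using x by (auto simp: fiber_sum_def extensional_def fun_eq_iff)
qed

lemma fiber_sum_compose:
  assumes "finite E" "finite F" and \<phi>: "\<phi> \<in> FS_hom E F"
  shows "fiber_sum E G (compose E \<psi> \<phi>) x = fiber_sum F G \<psi> (fiber_sum E F \<phi> x)"
  unfolding fiber_sum_def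
proof (rule restrict_ext)
  fix h assume "h \<in> G"
  have "(\<Sum>e | e \<in> E \<and> compose E \<psi> \<phi> e = h. x e) = (\<Sum>f | f \<in> F \<and> \<psi> f = h. \<Sum>e | e \<in> {e \<in> E. compose E \<psi> \<phi> e = h} \<and> \<phi> e = f. x e)"
    using assms FS_homD(3)[OF \<phi>] by (intro sum.group[symmetric]) (auto simp: compose_def)
  also have "\<dots> = (\<Sum>f | f \<in> F \<and> \<psi> f = h. \<Sum>e | e \<in> E \<and> \<phi> e = f. x e)"
    by (intro sum.cong refl) (auto simp: compose_def)
  finally show "(\<Sum>e | e \<in> E \<and> compose E \<psi> \<phi> e = h. x e)
      = (\<Sum>f | f \<in> F \<and> \<psi> f = h. (\<lambda>f\<in>F. \<Sum>e | e \<in> E \<and> \<phi> e = f. x e) f)"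
    by simp
qed

lemma FS_space_tuple_space: "FS_space (tuple_space S :: nat set \<Rightarrow> (nat \<Rightarrow> real ^ 'd::finite) topology) fiber_sum"
proof
  show "fiber_sum E E (\<lambda>e\<in>E. e) x = x" if "x \<in> topspace (tuple_space S E :: (nat \<Rightarrow> real ^ 'd) topology)" for E x
    using that by (intro fiber_sum_id) (simp add: topspace_tuple_space)
  show "fiber_sum E G (compose E \<psi> \<phi>) x = fiber_sum F G \<psi> (fiber_sum E F \<phi> x)"
    if "E \<in> FS_obj" "F \<in> FS_obj" "\<phi> \<in> FS_hom E F" for E F G \<phi> \<psi> and x :: "nat \<Rightarrow> real ^ 'd"
    using that by (intro fiber_sum_compose) (auto simp: FS_obj_def)
qed (rule continuous_map_fiber_sum)

text \<open>A tuple of \<open>i\<close> coefficient systems on \<open>E\<close> factors through the set of its value vectors, which has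
  at most \<open>card S ^ i\<close> elements.\<close>

lemma factor_coefficient_tuple:
  assumes S: "finite S" and E: "E \<in> FS_obj" and \<tau>: "\<tau> \<in> {..<i} \<rightarrow>\<^sub>E nonzero_coefficients S E"
  shows "\<exists>r \<tau>' \<psi>. r \<in> {1..card S ^ i} \<and> \<tau>' \<in> {..<i} \<rightarrow>\<^sub>E nonzero_coefficients S {..<r} \<and>
           \<psi> \<in> FS_hom E {..<r} \<and> (\<forall>k<i. \<forall>e\<in>E. \<tau> k e = \<tau>' k (\<psi> e))"
proof -
  define row where "row e = (\<lambda>k\<in>{..<i}. \<tau> k e)" for e
  define R where "R = row ` E"
  define r where "r = card R"
  have \<tau>_mem: "\<tau> k \<in> nonzero_coefficients S E" if "k < i" for k
    using \<tau> that by auto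
  then have \<tau>_S: "\<tau> k e \<in> S" if "k < i" "e \<in> E" for k e
    using that by (auto simp: nonzero_coefficients_def)
  have R: "finite R" "R \<noteq> {}" "R \<subseteq> {..<i} \<rightarrow>\<^sub>E S"
    using E \<tau>_S by (auto simp: R_def row_def FS_obj_def)
  then have r: "r \<in> {1..card S ^ i}"
    using card_mono[OF finite_PiE[of "{..<i}" "\<lambda>_. S"] R(3)] S card_gt_0_iff[of R]
    by (simp add: r_def card_PiE)
  \<comment> \<open>The value vectors are numbered, since the objects of the category are sets of
    natural numbers. \<open>\<psi>\<close> sends an element to the number of its value vector, and
    \<open>\<tau>'\<close> reads off the entries of a numbered vector.\<close>
  obtain h where h: "bij_betw h {..<r} R"
    using ex_bij_betw_nat_finite[OF R(1)] by (auto simp: r_def atLeast0LessThan)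
  define \<psi> where "\<psi> = (\<lambda>e\<in>E. inv_into {..<r} h (row e))"
  define \<tau>' where "\<tau>' = (\<lambda>k\<in>{..<i}. \<lambda>x\<in>{..<r}. h x k)"
  have \<psi>: "\<psi> e < r" "h (\<psi> e) = row e" if "e \<in> E" for e
    using that h bij_betw_inv_into_right[OF h, of "row e"] inv_into_into[of "row e" h "{..<r}"]
    by (auto simp: \<psi>_def R_def bij_betw_def)
  have row: "\<exists>e\<in>E. h x = row e \<and> \<psi> e = x" if "x < r" for x
  proof -
    have "h x \<in> R"
      using h that by (auto simp: bij_betw_def)
    then obtain e where e: "e \<in> E" "h x = row e"
      by (auto simp: R_def)
    then have "\<psi> e = x"
      using \<psi>[OF e(1)] h that by (auto simp: bij_betw_def inj_on_def)
    with e show ?thesis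
      by blast
  qed
  have "\<psi> \<in> extensional E"
    by (simp add: \<psi>_def)
  moreover have "\<psi> ` E = {..<r}"
  proof
    show "\<psi> ` E \<subseteq> {..<r}"
      using \<psi>(1) by blast
    show "{..<r} \<subseteq> \<psi> ` E"
      using row by blast
  qed
  ultimately have "\<psi> \<in> FS_hom E {..<r}"
    using \<psi>(1) by (simp add: FS_hom_def PiE_def)
  note \<psi>_FS = this
  have eq: "\<tau> k e = \<tau>' k (\<psi> e)" if "k < i" "e \<in> E" for k e
    using that \<psi>[OF that(2)] by (simp add: \<tau>'_def row_def)
  have "\<tau>' k \<in> nonzero_coefficients S {..<r}" if k: "k < i" for k
  proof -
    have "h x k \<in> S" if "x < r" for x
      using row[OF that] \<tau>_S k by (auto simp: row_def)
    moreover obtain e where "e \<in> E" "\<tau> k e \<noteq> 0"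
      using \<tau>_mem[OF k] by (auto simp: nonzero_coefficients_def)
    then have "\<psi> e < r" "\<tau>' k (\<psi> e) \<noteq> 0"
      using \<psi>(1) eq[OF k] by auto
    ultimately show ?thesis
      using k by (auto simp: nonzero_coefficients_def \<tau>'_def)
  qed
  then have "\<tau>' \<in> {..<i} \<rightarrow>\<^sub>E nonzero_coefficients S {..<r}"
    by (simp add: PiE_iff) (simp add: \<tau>'_def)
  then show ?thesis
    using r \<psi>_FS eq by (intro exI[of _ r] exI[of _ \<tau>'] exI[of _ \<psi>] conjI) simp_all
qed

theorem theorem1p1:
  fixes S :: "real set" and i :: nat
  assumes "finite S" and "CARD('d::finite) \<ge> 2"
  shows "finitely_generated_in_degrees
           (B_module S i :: (((nat \<Rightarrow> real ^ 'd) chain \<Rightarrow> rat) set) FSop_data) (card S ^ i)"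
proof -
  define p where "p = (CARD('d) - 1) * i"
  let ?T = "tuple_space S :: nat set \<Rightarrow> (nat \<Rightarrow> real ^ 'd) topology"
  let ?Y = "punctured_power i :: (nat \<Rightarrow> real ^ 'd) topology"
  interpret FS_space ?T fiber_sum p
    by (rule FS_space_tuple_space)
  have B: "B_module S i = coh_module"
    by (simp only: B_module_def coh_module_def p_def[symmetric])
  have "int p = (int CARD('d) - 1) * int i"
    using assms(2) by (simp add: p_def of_nat_diff)
  then have "homology_group (int p) ?Y \<cong> integer_group"
    using homology_punctured_power[OF assms(2), of i] by simp
  then obtain w0 where w0: "w0 \<in> cocycles p ?Y"
    "\<And>z. singular_relcycle p ?Y {} z \<Longrightarrow> w0 z = 0 \<Longrightarrow> singular_relboundary p ?Y {} z"
    using obtain_detecting_cocycle by blast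
  \<comment> \<open>A list of generators independent of \<open>E\<close>: one for each size
    \<open>r\<close> and each tuple of coefficient systems on the standard set with \<open>r\<close>
    elements. Finiteness of \<open>S\<close> makes the list finite.\<close>
  define G where "G = (SIGMA r:{1..card S ^ i}. {..<i} \<rightarrow>\<^sub>E nonzero_coefficients S {..<r})"
  have "finite G"
    unfolding G_def using assms(1) by (intro finite_SigmaI finite_PiE) (auto simp: finite_nonzero_coefficients)
  then obtain enum where enum: "bij_betw enum {..<card G} G"
    using ex_bij_betw_nat_finite[of G] by (auto simp: atLeast0LessThan)
  define F where "F j = {..<fst (enum j)}" for j
  define w where "w j = cochain_pullback p (?T (F j)) (combinations (F j) i (snd (enum j))) w0" for j
  have enum_G: "fst (enum j) \<in> {1..card S ^ i}" "snd (enum j) \<in> {..<i} \<rightarrow>\<^sub>E nonzero_coefficients S (F j)"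
    if "j < card G" for j
  proof -
    have "enum j \<in> G"
      using bij_betw_apply[OF enum] that by blast
    then show "fst (enum j) \<in> {1..card S ^ i}" "snd (enum j) \<in> {..<i} \<rightarrow>\<^sub>E nonzero_coefficients S (F j)"
      unfolding G_def F_def by (cases "enum j"; simp only: mem_Sigma_iff fst_conv snd_conv)+
  qed
  have F_obj: "F j \<in> FS_obj \<and> card (F j) \<le> card S ^ i" if "j < card G" for j
    using enum_G(1)[OF that] by (auto simp: F_def FS_obj_def lessThan_empty_iff)
  have cont_comb: "continuous_map (?T E) ?Y (combinations E i \<tau>)"
    if "finite E" "\<tau> \<in> {..<i} \<rightarrow>\<^sub>E nonzero_coefficients S E" for E \<tau>
    unfolding tuple_space_eq_arrangement_complement using that by (intro continuous_map_combinations) auto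
  have factor: "\<exists>j \<psi>. j < card G \<and> \<psi> \<in> FS_hom E (F j) \<and>
      cochain_pullback p (?T E) (combinations E i \<tau>) w0 = pb E (F j) \<psi> (w j)"
    if E: "E \<in> FS_obj" and \<tau>: "\<tau> \<in> {..<i} \<rightarrow>\<^sub>E nonzero_coefficients S E" for E \<tau>
  proof -
    obtain r \<tau>' \<psi> where *: "r \<in> {1..card S ^ i}" "\<tau>' \<in> {..<i} \<rightarrow>\<^sub>E nonzero_coefficients S {..<r}"
      "\<psi> \<in> FS_hom E {..<r}" "\<forall>k<i. \<forall>e\<in>E. \<tau> k e = \<tau>' k (\<psi> e)"
      using factor_coefficient_tuple[OF assms(1) E \<tau>] by blast
    then have "(r, \<tau>') \<in> G"
      by (simp add: G_def)
    then have "(r, \<tau>') \<in> enum ` {..<card G}"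
      using enum by (simp add: bij_betw_def)
    then obtain j where j: "j < card G" "enum j = (r, \<tau>')"
      by (metis imageE lessThan_iff)
    have r: "{..<r} \<in> FS_obj"
      using *(1) by (auto simp: FS_obj_def lessThan_empty_iff)
    have fin: "finite E"
      using E by (simp add: FS_obj_def)
    have "combinations E i \<tau> x = combinations {..<r} i \<tau>' (fiber_sum E {..<r} \<psi> x)" for x :: "nat \<Rightarrow> real ^ 'd"
      unfolding combinations_def
    proof (rule restrict_ext)
      fix k assume "k \<in> {..<i}"
      then have "combination E (\<tau> k) x = combination E (\<lambda>e. \<tau>' k (\<psi> e)) x"
        using *(4) by (simp add: combination_def)
      also have "\<dots> = combination {..<r} (\<tau>' k) (fiber_sum E {..<r} \<psi> x)"
        by (rule combination_fiber_sum[OF fin finite_lessThan, symmetric]) (rule FS_homD(3)[OF *(3)])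
      finally show "combination E (\<tau> k) x = combination {..<r} (\<tau>' k) (fiber_sum E {..<r} \<psi> x)" .
    qed
    then have "cochain_pullback p (?T E) (combinations E i \<tau>) w0
        = pb E {..<r} \<psi> (cochain_pullback p (?T {..<r}) (combinations {..<r} i \<tau>') w0)"
      by (intro cochain_pullback_compose cont[OF E r *(3)])
    then show ?thesis
      using j *(3) by (intro exI[of _ j] exI[of _ \<psi>]) (simp add: F_def w_def)
  qed
  show ?thesis
    unfolding B
  proof (rule finitely_generated_coh_module)
    fix j assume j: "j < card G"
    show "F j \<in> FS_obj \<and> card (F j) \<le> card S ^ i"
      by (rule F_obj[OF j])
    show "w j \<in> cocycles p (?T (F j))"
      unfolding w_def by (rule cochain_pullback_in_cocycles[OF cont_comb w0(1)]) (use enum_G(2)[OF j] in \<open>auto simp: F_def\<close>)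
  next
    fix E c assume E: "E \<in> FS_obj" and c: "c \<in> cocycles p (?T E)"
    let ?I = "{..<i} \<rightarrow>\<^sub>E nonzero_coefficients S E"
    have fin: "finite E" "finite (nonzero_coefficients S E)"
      using E assms(1) by (auto simp: FS_obj_def finite_nonzero_coefficients)
    obtain r where r: "(\<lambda>z\<in>C E. c z - (\<Sum>\<tau>\<in>?I. r \<tau> * cochain_pullback p (?T E) (combinations E i \<tau>) w0 z)) \<in> coboundaries p (?T E)"
      using cocycle_arrangement_eq[OF assms(2) fin p_def w0 c[unfolded tuple_space_eq_arrangement_complement]]
      unfolding tuple_space_eq_arrangement_complement by blast
    obtain J \<Psi> where J: "\<And>\<tau>. \<tau> \<in> ?I \<Longrightarrow> J \<tau> < card G \<and> \<Psi> \<tau> \<in> FS_hom E (F (J \<tau>)) \<and>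
        cochain_pullback p (?T E) (combinations E i \<tau>) w0 = pb E (F (J \<tau>)) (\<Psi> \<tau>) (w (J \<tau>))"
      using factor[OF E] by metis
    \<comment> \<open>Different tuples on \<open>E\<close> may lead to the same generator and the
      same surjection, so their coefficients are added.\<close>
    define v where "v j \<psi> = (\<Sum>\<tau> | \<tau> \<in> ?I \<and> (J \<tau>, \<Psi> \<tau>) = (j, \<psi>). r \<tau>)" for j \<psi>
    have "(\<Sum>j<card G. \<Sum>\<psi>\<in>FS_hom E (F j). v j \<psi> * pb E (F j) \<psi> (w j) z)
        = (\<Sum>\<tau>\<in>?I. r \<tau> * cochain_pullback p (?T E) (combinations E i \<tau>) w0 z)" for z
    proof -
      let ?P = "SIGMA j:{..<card G}. FS_hom E (F j)"
      let ?h = "\<lambda>\<tau>. r \<tau> * pb E (F (J \<tau>)) (\<Psi> \<tau>) (w (J \<tau>)) z"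
      have finP: "\<forall>j\<in>{..<card G}. finite (FS_hom E (F j))"
        using finite_FS_hom[OF E] F_obj by blast
      have "(\<Sum>j<card G. \<Sum>\<psi>\<in>FS_hom E (F j). v j \<psi> * pb E (F j) \<psi> (w j) z)
          = (\<Sum>(j, \<psi>)\<in>?P. v j \<psi> * pb E (F j) \<psi> (w j) z)"
        using finP by (simp add: sum.Sigma)
      also have "\<dots> = (\<Sum>x\<in>?P. \<Sum>\<tau> | \<tau> \<in> ?I \<and> (J \<tau>, \<Psi> \<tau>) = x. ?h \<tau>)"
        by (intro sum.cong refl) (auto simp: v_def sum_distrib_right intro!: sum.cong)
      also have "\<dots> = sum ?h ?I"
        using fin finP J by (intro sum.group) (auto simp: finite_PiE)
      also have "\<dots> = (\<Sum>\<tau>\<in>?I. r \<tau> * cochain_pullback p (?T E) (combinations E i \<tau>) w0 z)"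
        using J by (intro sum.cong) auto
      finally show ?thesis .
    qed
    then show "\<exists>v. (\<lambda>z\<in>C E. c z - (\<Sum>j<card G. \<Sum>\<psi>\<in>FS_hom E (F j). v j \<psi> * pb E (F j) \<psi> (w j) z)) \<in> coboundaries p (?T E)"
      using r by (intro exI[of _ v]) simp
  qed
qed

end
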